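(* Assume that: (P1) there exist $\lambda_0>0$ and a quasi-stationary distribution $\alpha$, a probability measure on $E$, with $\alpha P_t=e^{-\lambda_0t}\alpha$ for all $t\ge0$, and a function $\eta$, positive on $E$, such that $\alpha(\eta)=1$ and $P_t\eta(x)=e^{-\lambda_0t}\eta(x)$ for all $x\in E$, $t\ge0$; (P2) there exists $C_P\in(0,+\infty)$ such that $$\mathrm{Var}_{\eta\circ\alpha}(f)\le-C_P\Big[\int_Ef\,\big(\lambda_0f\eta+\mathcal{L}(f\eta)\big)\,d\alpha\Big]$$ for any measurable function $f$ such that $\lambda_0\int_Ef^2\,d(\eta\circ\alpha)+\int_Ef\,\mathcal{L}(f\eta)\,d\alpha$ is well-defined; (P3) for some $x_0\in E$, the function $\psi:x\mapsto1+d(x,x_0)$ satisfies $\alpha(\psi)<+\infty$ and $\alpha(\psi^2/\eta)<+\infty$. Then, for any probability measure $\mu$ on $E$, there exists $t_\mu$ such that, for any $t\ge t_\mu$, $$\mathcal{W}_1\big(\mathbb{P}_\mu[X_t\in\cdot\mid\tau_\partial>t],\alpha\big)\le C_\psi\,\chi_2(\eta\circ\mu\mid\eta\circ\alpha)\,e^{-t/C_P},$$ where $C_\psi=(a+b\,\alpha(\psi))\,\alpha(\psi^2/\eta)^{1/2}$ with some positive constants $a,b$.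
   Context: $(X_t)_{t\ge0}$ is a time-homogeneous Markov process on a metric space $(E\cup\{\partial\},d)$, $\partial\notin E$, absorbed at $\partial$: $X_t=\partial$ for all $t\ge\tau_\partial:=\inf\{t\ge0:X_t=\partial\}$. $\mathbb{P}_\mu,\mathbb{E}_\mu$ correspond to initial law $\mu$ and $\mathbb{P}_x=\mathbb{P}_{\delta_x}$. Standing assumptions: $\mathbb{P}_x[\tau_\partial<+\infty]=1$ and $\mathbb{P}_x[\tau_\partial>t]>0$ for all $x\in E$, $t\ge0$. $P_tf(x):=\mathbb{E}_x(f(X_t)\mathbf{1}_{\tau_\partial>t})$ and $\alpha P_t:=\mathbb{P}_\alpha(X_t\in\cdot,\tau_\partial>t)$. $\alpha$ is a quasi-stationary distribution if $\mathbb{P}_\alpha(X_t\in\cdot\mid\tau_\partial>t)=\alpha$ for all $t\ge0$. The generator is $\mathcal{L}f(x):=\lim_{t\to0}\frac{P_tf(x)-f(x)}{t}$, defined for $f$ in $\mathcal{D}(\mathcal{L})$, the set of $f$ for which the limit exists for every $x$. $\mu(f):=\int f\,d\mu$; $\mathrm{Var}_\pi(f):=\int(f-\pi(f))^2d\pi$. For a positive measure $\mu$ and measurable $f>0$ with $\mu(f)<+\infty$, $f\circ\mu(dx):=f(x)\mu(dx)/\mu(f)$. $\chi_2(\mu\mid\nu):=\sqrt{\int(\frac{d\mu}{d\nu}-1)^2d\nu}$ if $\mu\ll\nu$ and $+\infty$ otherwise. $\mathcal{W}_1(\mu,\nu):=\inf\mathbb{E}[d(X,Y)]$ over all couplings $(X,Y)$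 of $\mu$ and $\nu$. Convention: the bound is regarded as trivially true when its right-hand side is $+\infty$, and $\chi_2(\eta\circ\mu\mid\cdot)$ is read as $+\infty$ if $\mu(\eta)=+\infty$.
   Formalization: The process X_t(ω) is additionally assumed jointly measurable in (t, ω), as right-continuous paths would imply; without such regularity the claim fails, e.g. for a killed rotation of the circle by a non-measurable additive function of time. *)

theory Defs
  imports "HOL-Probability.Probability"
begin

text \<open>
  The type \<open>'a\<close> is the metric space \<open>E \<union> {\<partial>}\<close>; the cemetery is a point \<open>c :: 'a\<close>, so that \<open>E = - {c}\<close>.
  Measures on \<open>E\<close> are Borel measures on \<open>'a\<close> which do not charge \<open>c\<close>, and functions on \<open>E\<close> are
  functions on \<open>'a\<close> whose value at \<open>c\<close> plays no role. As \<open>{c}\<close> is closed, this identification does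
  not affect measurability.
\<close>

definition prob_on_E :: "'a::metric_space \<Rightarrow> 'a measure \<Rightarrow> bool" where
  "prob_on_E c \<mu> \<longleftrightarrow> prob_space \<mu> \<and> sets \<mu> = sets borel \<and> emeasure \<mu> {c} = 0"

definition lifetime :: "(real \<Rightarrow> 'w \<Rightarrow> 'a) \<Rightarrow> 'a \<Rightarrow> 'w \<Rightarrow> ereal" where
  "lifetime X c \<omega> = Inf {ereal t | t. 0 \<le> t \<and> X t \<omega> = c}"

definition natural_filtration ::
  "'w measure \<Rightarrow> (real \<Rightarrow> 'w \<Rightarrow> 'a::metric_space) \<Rightarrow> real \<Rightarrow> 'w measure" where
  "natural_filtration \<F> X t =
     sigma (space \<F>) {X s -` A \<inter> space \<F> | s A. 0 \<le> s \<and> s \<le> t \<and> A \<in> sets borel}"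

text \<open>
  \<open>P x\<close> is the law started from \<open>x\<close> on the path space \<open>\<F>\<close>. The process is assumed jointly measurable
  in time and path (which right-continuity of the paths would imply): with measurability
  of each \<open>X t\<close> alone, \<open>t \<mapsto> P\<^sub>t f(x)\<close> could fail to be measurable and the generator could act on
  trivial functions only.
\<close>

locale absorbed_markov_process =
  fixes \<F> :: "'w measure"
    and P :: "'a::metric_space \<Rightarrow> 'w measure"
    and X :: "real \<Rightarrow> 'w \<Rightarrow> 'a"
    and c :: 'a
  assumes kernel: "P \<in> borel \<rightarrow>\<^sub>M prob_algebra \<F>"
    and jointly_measurable:
      "(\<lambda>(t, \<omega>). X t \<omega>) \<in> restrict_space borel {0..} \<Otimes>\<^sub>M \<F> \<rightarrow>\<^sub>M borel"
    and initial: "AE \<omega> in P x. X 0 \<omega> = x"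
    and markov: "\<lbrakk>0 \<le> s; 0 \<le> t; A \<in> sets borel\<rbrakk> \<Longrightarrow>
      AE \<omega> in P x.
        real_cond_exp (P x) (natural_filtration \<F> X s) (indicator {\<omega>. X (s + t) \<omega> \<in> A}) \<omega>
        = measure (P (X s \<omega>)) {\<omega>' \<in> space \<F>. X t \<omega>' \<in> A}"
    and absorbing: "\<lbrakk>\<omega> \<in> space \<F>; 0 \<le> t; lifetime X c \<omega> \<le> ereal t\<rbrakk> \<Longrightarrow> X t \<omega> = c"
    and lifetime_finite: "x \<noteq> c \<Longrightarrow> measure (P x) {\<omega> \<in> space \<F>. lifetime X c \<omega> < \<infinity>} = 1"
    and survival: "\<lbrakk>x \<noteq> c; 0 \<le> t\<rbrakk> \<Longrightarrow> measure (P x) {\<omega> \<in> space \<F>. ereal t < lifetime X c \<omega>} > 0"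

definition path_law :: "('a \<Rightarrow> 'w measure) \<Rightarrow> 'a measure \<Rightarrow> 'w measure" where
  "path_law P \<mu> = \<mu> \<bind> P"

definition alive :: "'w measure \<Rightarrow> (real \<Rightarrow> 'w \<Rightarrow> 'a) \<Rightarrow> 'a \<Rightarrow> real \<Rightarrow> 'w set" where
  "alive \<F> X c t = {\<omega> \<in> space \<F>. ereal t < lifetime X c \<omega>}"

text \<open>\<open>P\<^sub>t f(x)\<close>\<close>

definition killed_semigroup ::
  "'w measure \<Rightarrow> ('a \<Rightarrow> 'w measure) \<Rightarrow> (real \<Rightarrow> 'w \<Rightarrow> 'a) \<Rightarrow> 'a \<Rightarrow> real \<Rightarrow> ('a \<Rightarrow> real) \<Rightarrow> 'a \<Rightarrow> real" where
  "killed_semigroup \<F> P X c t f x = (\<integral>\<omega>. f (X t \<omega>) * indicator (alive \<F> X c t) \<omega> \<partial>P x)"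

text \<open>\<open>\<mu> P\<^sub>t\<close> and the law of \<open>X\<^sub>t\<close> conditioned on survival\<close>

definition killed_law :: "'w measure \<Rightarrow> ('a::metric_space \<Rightarrow> 'w measure) \<Rightarrow> (real \<Rightarrow> 'w \<Rightarrow> 'a)
    \<Rightarrow> 'a \<Rightarrow> 'a measure \<Rightarrow> real \<Rightarrow> 'a measure" where
  "killed_law \<F> P X c \<mu> t = distr (restrict_space (path_law P \<mu>) (alive \<F> X c t)) borel (X t)"

definition conditional_law :: "'w measure \<Rightarrow> ('a::metric_space \<Rightarrow> 'w measure) \<Rightarrow> (real \<Rightarrow> 'w \<Rightarrow> 'a)
    \<Rightarrow> 'a \<Rightarrow> 'a measure \<Rightarrow> real \<Rightarrow> 'a measure" where
  "conditional_law \<F> P X c \<mu> t = distr (uniform_measure (path_law P \<mu>) (alive \<F> X c t)) borel (X t)"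

definition quasi_stationary :: "'w measure \<Rightarrow> ('a::metric_space \<Rightarrow> 'w measure) \<Rightarrow> (real \<Rightarrow> 'w \<Rightarrow> 'a)
    \<Rightarrow> 'a \<Rightarrow> 'a measure \<Rightarrow> bool" where
  "quasi_stationary \<F> P X c \<alpha> \<longleftrightarrow>
     prob_on_E c \<alpha> \<and> (\<forall>t\<ge>0. conditional_law \<F> P X c \<alpha> t = \<alpha>)"

text \<open>
  The pointwise generator. The integrability clause says that \<open>P\<^sub>t f(x)\<close> is defined for small \<open>t\<close>,
  which the totalised integral does not enforce.
\<close>

definition generator_domain :: "'w measure \<Rightarrow> ('a::metric_space \<Rightarrow> 'w measure)
    \<Rightarrow> (real \<Rightarrow> 'w \<Rightarrow> 'a) \<Rightarrow> 'a \<Rightarrow> ('a \<Rightarrow> real) set" where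
  "generator_domain \<F> P X c =
     {f \<in> borel_measurable borel. \<forall>x. x \<noteq> c \<longrightarrow>
        (\<forall>\<^sub>F t in at_right 0. integrable (P x) (\<lambda>\<omega>. f (X t \<omega>) * indicator (alive \<F> X c t) \<omega>)) \<and>
        (\<exists>l. ((\<lambda>t. (killed_semigroup \<F> P X c t f x - f x) / t) \<longlongrightarrow> l) (at_right 0))}"

definition generator :: "'w measure \<Rightarrow> ('a \<Rightarrow> 'w measure) \<Rightarrow> (real \<Rightarrow> 'w \<Rightarrow> 'a)
    \<Rightarrow> 'a \<Rightarrow> ('a \<Rightarrow> real) \<Rightarrow> 'a \<Rightarrow> real" where
  "generator \<F> P X c f x = Lim (at_right 0) (\<lambda>t. (killed_semigroup \<F> P X c t f x - f x) / t)"

text \<open>\<open>f \<circ> \<mu>\<close>, meaningful when \<open>\<mu>(f)\<close> is finite and positive\<close>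

definition reweight :: "('a \<Rightarrow> real) \<Rightarrow> 'a measure \<Rightarrow> 'a measure" where
  "reweight f \<mu> = density \<mu> (\<lambda>x. ennreal (f x) / (\<integral>\<^sup>+y. ennreal (f y) \<partial>\<mu>))"

definition Var :: "'a measure \<Rightarrow> ('a \<Rightarrow> real) \<Rightarrow> real" where
  "Var \<pi> f = (\<integral>x. (f x - (\<integral>y. f y \<partial>\<pi>))\<^sup>2 \<partial>\<pi>)"

definition ennreal_sqrt :: "ennreal \<Rightarrow> ennreal" where
  "ennreal_sqrt u = (if u = \<infinity> then \<infinity> else ennreal (sqrt (enn2real u)))"

definition chi2 :: "'a measure \<Rightarrow> 'a measure \<Rightarrow> ennreal" where
  "chi2 \<mu> \<nu> =
     (if absolutely_continuous \<nu> \<mu>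
      then ennreal_sqrt (\<integral>\<^sup>+x. ennreal ((enn2real (RN_deriv \<nu> \<mu> x) - 1)\<^sup>2) \<partial>\<nu>)
      else \<infinity>)"

text \<open>
  Couplings live on the Borel \<open>\<sigma>\<close>-algebra of the product space, which makes the distance
  measurable even if the space is not separable; in the separable case this is the product
  \<open>\<sigma>\<close>-algebra.
\<close>

definition couplings :: "'a::metric_space measure \<Rightarrow> 'a measure \<Rightarrow> ('a \<times> 'a) measure set" where
  "couplings \<mu> \<nu> = {\<gamma>. prob_space \<gamma> \<and> sets \<gamma> = sets borel \<and>
     distr \<gamma> borel fst = \<mu> \<and> distr \<gamma> borel snd = \<nu>}"

definition W1 :: "'a::metric_space measure \<Rightarrow> 'a measure \<Rightarrow> ennreal" where
  "W1 \<mu> \<nu> = (INF \<gamma>\<in>couplings \<mu> \<nu>. \<integral>\<^sup>+z. ennreal (dist (fst z) (snd z)) \<partial>\<gamma>)"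

end

theory Submission
  imports Defs
begin

text \<open>The Doob transform \<open>Q\<^sub>t f = e\<^bsup>\<lambda>t\<^esup> P\<^sub>t(f \<eta>) / \<eta>\<close> is a conservative Markov semigroup with stationary law
  \<open>\<pi> = \<eta> \<circ> \<alpha>\<close>, and the Poincare inequality says that the Dirichlet form of its generator dominates the
  variance. Differentiating \<open>\<integral>(Q\<^sub>t f)\<^sup>2 d\<pi>\<close> gives contraction at rate \<open>e\<^bsup>-t/C\<^esup>\<close> on centred functions.
  As the generator is only a pointwise limit, this is done first for orbits averaged twice in time,
  which are continuously differentiable at every point; the averaging is then removed.
  By duality the density \<open>k\<close> of \<open>(\<eta> \<circ> \<mu>) Q\<^sub>t\<close> with respect to \<open>\<pi>\<close> satisfies
  \<open>\<integral>\<psi> \<bar>k - 1\<bar> d\<alpha> \<le> \<chi>\<^sub>2(\<eta> \<circ> \<mu> | \<eta> \<circ> \<alpha>) e\<^bsup>-t/C\<^esup> \<alpha>(\<psi>\<^sup>2/\<eta>)\<^bsup>1/2\<^esup>\<close>. The conditional law of \<open>X\<^sub>t\<close> is \<open>\<alpha>\<close> with density \<open>k / \<alpha>(k)\<close>,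
  and a maximal coupling bounds its Wasserstein distance to \<open>\<alpha>\<close> by a weighted total variation
  distance. Once the bound above is below \<open>1/2\<close>, so that \<open>\<alpha>(k) \<ge> 1/2\<close>, this gives \<open>a = b = 2\<close>.\<close>

section \<open>Averages of functions of time\<close>

text \<open>The semigroup \<open>doob\<close> is assumed neither reversible nor strongly continuous,
  and this shapes the argument. Without reversibility, decay is available for functions but not
  directly for densities; hence the duality, tested against the sign of \<open>k - 1\<close> times
  \<psi>/\<eta>. The square of \<psi>/\<eta> has \<pi>-integral \<alpha>(\<psi>^2/\<eta>), which is
  how this quantity enters the bound. Without strong continuity, an orbit may be irregular in time
  at a given point, while the Poincare hypothesis speaks of functions whose difference quotients
  converge at every point. One average makes each path \<open>\<lambda>t. \<Phi> t x\<close>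
  continuous, the next one differentiable with a difference quotient as derivative; and since
  averages of orbits are again orbits, the hypothesis can be applied at every time. Working with
  bounded functions only keeps f \<eta> in the domain of the killed generator, because \<eta> itself
  is integrable under the killed kernel. The unbounded weight \<psi>/\<eta> is reached by
  truncation.\<close>

abbreviation unit_uniform :: "real measure" where
  "unit_uniform \<equiv> uniform_measure lborel {0..1}"

lemma prob_space_unit_uniform: "prob_space unit_uniform"
  by (rule prob_space_uniform_measure) auto

lemma unit_uniform_eq_density: "unit_uniform = density lborel (\<lambda>u. ennreal (indicator {0..1} u))"
  unfolding uniform_measure_def by (intro density_cong) (auto split: split_indicator)

lemma integral_unit_uniform:
  fixes f :: "real \<Rightarrow> real"
  assumes [measurable]: "f \<in> borel_measurable borel"
  shows "(\<integral>u. f u \<partial>unit_uniform) = (\<integral>u. f u * indicator {0..1} u \<partial>lborel)"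
  unfolding unit_uniform_eq_density by (subst integral_density) (auto simp: mult.commute)

text \<open>The window [-1, 2] contains every translate of the unit interval by at most 1, so the
  bound does not depend on the shift. This makes the approximation error in
  \<open>translation_continuous\<close> uniform along the sequence of shifts.\<close>

lemma nn_integral_unit_uniform_translate_le:
  fixes g :: "real \<Rightarrow> ennreal"
  assumes [measurable]: "g \<in> borel_measurable borel" and "\<bar>e\<bar> \<le> 1"
  shows "(\<integral>\<^sup>+u. g (u + e) \<partial>unit_uniform) \<le> (\<integral>\<^sup>+u. g u * indicator {-1..2} u \<partial>lborel)"
proof -
  have "(\<integral>\<^sup>+u. g (u + e) \<partial>unit_uniform) = (\<integral>\<^sup>+u. g (u + e) * indicator {0..1} u \<partial>lborel)"
    by (subst nn_integral_uniform_measure) (auto simp: divide_ennreal_def)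
  also have "\<dots> \<le> (\<integral>\<^sup>+u. g (u + e) * indicator {-1..2} (u + e) \<partial>lborel)"
    using assms(2) by (intro nn_integral_mono) (auto split: split_indicator)
  also have "\<dots> = (\<integral>\<^sup>+u. g u * indicator {-1..2} u \<partial>lborel)"
    using nn_integral_real_affine[of "\<lambda>u. g u * indicator {-1..2} u" 1 e] by (simp add: add.commute)
  finally show ?thesis .
qed

text \<open>Measurability in the sense of \<open>measurable_on\<close> already provides continuous
  functions converging off a negligible set. Clipping them to [-B, B] keeps the continuity and the
  limit, as \<open>g\<close> takes its values there, and makes dominated convergence
  available.\<close>

lemma bounded_borel_approx_continuous:
  fixes g :: "real \<Rightarrow> real"
  assumes [measurable]: "g \<in> borel_measurable borel" and B: "\<And>t. \<bar>g t\<bar> \<le> B"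
  obtains h where "\<And>n. continuous_on UNIV (h n)" "\<And>n t. \<bar>h n t\<bar> \<le> B"
    "AE t in lborel. (\<lambda>n. h n t) \<longlonglongrightarrow> g t"
proof -
  have "g measurable_on UNIV"
    by (intro lebesgue_measurable_imp_measurable_on measurable_completion) auto
  then obtain N h where N: "negligible N" and h: "\<And>n. continuous_on UNIV (h n)"
    and lim: "\<And>x. x \<notin> N \<Longrightarrow> (\<lambda>n. h n x) \<longlonglongrightarrow> g x"
    by (auto simp: measurable_on_def)
  define h' where "h' n x = max (- B) (min B (h n x))" for n x
  have B0: "0 \<le> B" using B[of 0] by linarith
  have "AE t in lebesgue. t \<notin> N"
    using N by (simp add: negligible_iff_null_sets AE_not_in)
  then have "AE t in lborel. t \<notin> N"
    by (simp add: AE_completion_iff)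
  then have "AE t in lborel. (\<lambda>n. h' n t) \<longlonglongrightarrow> g t"
  proof eventually_elim
    case (elim t)
    have "(\<lambda>n. h' n t) \<longlonglongrightarrow> max (- B) (min B (g t))"
      unfolding h'_def by (intro tendsto_intros lim elim)
    then show ?case using B[of t] by (simp add: abs_le_iff min_def max_def split: if_splits)
  qed
  moreover have "continuous_on UNIV (h' n)" for n
    unfolding h'_def by (intro continuous_intros h)
  moreover have "\<bar>h' n t\<bar> \<le> B" for n t
    unfolding h'_def using B0 by auto
  ultimately show ?thesis using that by blast
qed

text \<open>A three-term estimate: \<open>g\<close> is replaced by a continuous \<open>h N\<close>
  that is close to it in L1 on [-1, 2], the translates of \<open>h N\<close> converge pointwise, and
  the two replacement errors are at most \<open>?J N\<close> whatever the shift. Orbits of the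
  semigroup are only known to be measurable in time, so their regularity has to come from
  here.\<close>

lemma translation_continuous:
  fixes g :: "real \<Rightarrow> real"
  assumes g[measurable]: "g \<in> borel_measurable borel" and B: "\<And>t. \<bar>g t\<bar> \<le> B"
    and e: "e \<longlonglongrightarrow> 0"
  shows "(\<lambda>n. \<integral>u. \<bar>g (u + e n) - g u\<bar> \<partial>unit_uniform) \<longlonglongrightarrow> 0"
proof (rule LIMSEQ_I)
  fix \<epsilon> :: real assume \<epsilon>: "0 < \<epsilon>"
  interpret U: prob_space unit_uniform by (rule prob_space_unit_uniform)
  obtain h where hc: "\<And>n. continuous_on UNIV (h n)" and hB: "\<And>n t. \<bar>h n t\<bar> \<le> B"
    and lim: "AE t in lborel. (\<lambda>n. h n t) \<longlonglongrightarrow> g t"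
    using bounded_borel_approx_continuous[OF g B] by metis
  have [measurable]: "h n \<in> borel_measurable borel" for n
    using hc by (rule borel_measurable_continuous_onI)
  have B0: "0 \<le> B" using B[of 0] by linarith
  have int: "integrable unit_uniform f" if "f \<in> borel_measurable borel" "\<And>u. \<bar>f u\<bar> \<le> C" for f :: "real \<Rightarrow> real" and C
    using that by (intro U.integrable_const_bound[of _ C]) auto
  let ?J = "\<lambda>n. \<integral>u. \<bar>h n u - g u\<bar> * indicator {-1..2} u \<partial>lborel"
  have intJ: "integrable lborel (\<lambda>u. \<bar>h n u - g u\<bar> * indicator {-1..2} u)" for n
  proof (rule Bochner_Integration.integrable_bound)
    show "integrable lborel (\<lambda>u::real. 2 * B * indicator {-1..2} u)" by simp
    show "AE u in lborel. norm (\<bar>h n u - g u\<bar> * indicator {-1..2} u) \<le> norm (2 * B * indicator {-1..2} u)"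
      using hB[of n] B B0 by (intro AE_I2) (auto simp: abs_le_iff split: split_indicator, smt+)
  qed simp
  have "?J \<longlonglongrightarrow> (\<integral>u. 0 \<partial>(lborel::real measure))"
  proof (rule integral_dominated_convergence[where w = "\<lambda>u. 2 * B * indicator {-1..2} u"])
    show "integrable lborel (\<lambda>u::real. 2 * B * indicator {-1..2} u)" by simp
    show "AE u in lborel. (\<lambda>n. \<bar>h n u - g u\<bar> * indicator {-1..2} u) \<longlonglongrightarrow> 0"
      using lim
    proof eventually_elim
      case (elim u)
      then have "(\<lambda>n. \<bar>h n u - g u\<bar> * indicator {-1..2} u) \<longlonglongrightarrow> \<bar>g u - g u\<bar> * indicator {-1..2} u"
        by (intro tendsto_intros)
      then show ?case by simp
    qed
    show "AE u in lborel. norm (\<bar>h n u - g u\<bar> * indicator {-1..2} u) \<le> 2 * B * indicator {-1..2} u" for n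
      using hB[of n] B B0 by (intro AE_I2) (auto simp: abs_le_iff split: split_indicator, smt+)
  qed simp_all
  then have "?J \<longlonglongrightarrow> 0" by simp
  then obtain N where N: "?J N < \<epsilon> / 3"
    using order_tendstoD(2)[OF \<open>?J \<longlonglongrightarrow> 0\<close>, of "\<epsilon> / 3"] \<epsilon>
    unfolding eventually_sequentially by (metis divide_pos_pos order_refl zero_less_numeral)
  have J: "(\<integral>u. \<bar>h N (u + d) - g (u + d)\<bar> \<partial>unit_uniform) \<le> ?J N" if "\<bar>d\<bar> \<le> 1" for d
  proof -
    have "ennreal (\<integral>u. \<bar>h N (u + d) - g (u + d)\<bar> \<partial>unit_uniform)
        = (\<integral>\<^sup>+u. ennreal \<bar>h N (u + d) - g (u + d)\<bar> \<partial>unit_uniform)"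
      by (rule nn_integral_eq_integral[symmetric], rule int[of _ "2 * B"])
        (use hB[of N] B in \<open>auto simp: abs_le_iff, smt+\<close>)
    also have "\<dots> \<le> (\<integral>\<^sup>+u. ennreal \<bar>h N u - g u\<bar> * indicator {-1..2} u \<partial>lborel)"
      using that by (intro nn_integral_unit_uniform_translate_le) auto
    also have "\<dots> = (\<integral>\<^sup>+u. ennreal (\<bar>h N u - g u\<bar> * indicator {-1..2} u) \<partial>lborel)"
      by (intro nn_integral_cong) (auto split: split_indicator)
    also have "\<dots> = ennreal (?J N)"
      by (rule nn_integral_eq_integral[OF intJ]) auto
    finally show ?thesis by (subst (asm) ennreal_le_iff) (auto intro!: integral_nonneg_AE)
  qed
  have "(\<lambda>n. \<integral>u. \<bar>h N (u + e n) - h N u\<bar> \<partial>unit_uniform) \<longlonglongrightarrow> (\<integral>u. 0 \<partial>unit_uniform)"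
  proof (rule integral_dominated_convergence[where w = "\<lambda>_. 2 * B"])
    show "AE u in unit_uniform. (\<lambda>n. \<bar>h N (u + e n) - h N u\<bar>) \<longlonglongrightarrow> 0"
    proof (intro AE_I2)
      fix u
      have "(\<lambda>n. h N (u + e n)) \<longlonglongrightarrow> h N (u + 0)"
        by (rule isCont_tendsto_compose[where g = "h N"])
          (use hc[of N] tendsto_add[OF tendsto_const e, of u] in \<open>auto simp: continuous_on_eq_continuous_at\<close>)
      then have "(\<lambda>n. \<bar>h N (u + e n) - h N u\<bar>) \<longlonglongrightarrow> \<bar>h N (u + 0) - h N u\<bar>"
        by (intro tendsto_intros)
      then show "(\<lambda>n. \<bar>h N (u + e n) - h N u\<bar>) \<longlonglongrightarrow> 0" by simp
    qed
    show "AE u in unit_uniform. norm \<bar>h N (u + e n) - h N u\<bar> \<le> 2 * B" for n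
      using hB[of N] by (intro AE_I2) (auto simp: abs_le_iff, smt+)
  qed auto
  then have "(\<lambda>n. \<integral>u. \<bar>h N (u + e n) - h N u\<bar> \<partial>unit_uniform) \<longlonglongrightarrow> 0" by simp
  then have "\<forall>\<^sub>F n in sequentially. (\<integral>u. \<bar>h N (u + e n) - h N u\<bar> \<partial>unit_uniform) < \<epsilon> / 3"
    using \<epsilon> by (auto dest!: order_tendstoD(2)[where a = "\<epsilon> / 3"])
  moreover have "\<forall>\<^sub>F n in sequentially. \<bar>e n\<bar> < 1"
    using tendsto_rabs_zero[OF e] by (rule order_tendstoD(2)) simp
  ultimately have "\<forall>\<^sub>F n in sequentially. norm ((\<integral>u. \<bar>g (u + e n) - g u\<bar> \<partial>unit_uniform) - 0) < \<epsilon>"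
  proof eventually_elim
    case (elim n)
    have 1: "integrable unit_uniform (\<lambda>u. \<bar>h N (u + d) - g (u + d)\<bar>)" for d
      by (rule int[of _ "2 * B"]) (use hB[of N] B in \<open>auto simp: abs_le_iff, smt+\<close>)
    have 2: "integrable unit_uniform (\<lambda>u. \<bar>h N (u + e n) - h N u\<bar>)"
      by (rule int[of _ "2 * B"]) (use hB[of N] in \<open>auto simp: abs_le_iff, smt+\<close>)
    have 3: "integrable unit_uniform (\<lambda>u. \<bar>g (u + e n) - g u\<bar>)"
      by (rule int[of _ "2 * B"]) (use B in \<open>auto simp: abs_le_iff, smt+\<close>)
    have "(\<integral>u. \<bar>g (u + e n) - g u\<bar> \<partial>unit_uniform) \<le>
      (\<integral>u. \<bar>h N (u + e n) - g (u + e n)\<bar> + \<bar>h N (u + e n) - h N u\<bar> + \<bar>h N (u + 0) - g (u + 0)\<bar> \<partial>unit_uniform)"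
      by (intro integral_mono 3 Bochner_Integration.integrable_add 1 2) auto
    also have "\<dots> = (\<integral>u. \<bar>h N (u + e n) - g (u + e n)\<bar> \<partial>unit_uniform)
       + (\<integral>u. \<bar>h N (u + e n) - h N u\<bar> \<partial>unit_uniform) + (\<integral>u. \<bar>h N (u + 0) - g (u + 0)\<bar> \<partial>unit_uniform)"
      by (simp add: Bochner_Integration.integral_add Bochner_Integration.integrable_add 1 2 1[of 0, simplified])
    also have "\<dots> < \<epsilon>"
      using J[of "e n"] J[of 0] elim N by (simp add: field_simps)
    finally show ?case by simp
  qed
  then show "\<exists>no. \<forall>n\<ge>no. norm ((\<integral>u. \<bar>g (u + e n) - g u\<bar> \<partial>unit_uniform) - 0) < \<epsilon>"
    by (simp add: eventually_sequentially)
qed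

text \<open>Moving the base point from \<open>t\<close> to \<open>X n\<close> amounts to translating
  the variable of \<open>\<lambda>u. g (t + r * u)\<close> by \<open>(X n - t) / r\<close>.\<close>

lemma average_continuous:
  fixes g :: "real \<Rightarrow> real"
  assumes g[measurable]: "g \<in> borel_measurable borel" and B: "\<And>t. \<bar>g t\<bar> \<le> B" and r: "0 < r"
  shows "isCont (\<lambda>t. \<integral>u. g (t + r * u) \<partial>unit_uniform) t"
  unfolding isCont_def
proof (subst tendsto_at_iff_sequentially, intro allI impI)
  interpret U: prob_space unit_uniform by (rule prob_space_unit_uniform)
  fix X assume "X \<longlonglongrightarrow> t"
  then have "(\<lambda>n. X n - t) \<longlonglongrightarrow> 0"
    using tendsto_diff[OF _ tendsto_const, of X t sequentially t] by simp
  then have e: "(\<lambda>n. (X n - t) / r) \<longlonglongrightarrow> 0"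
    using r by (auto intro: tendsto_divide_zero)
  have *: "(\<lambda>n. \<integral>u. \<bar>g (t + r * (u + (X n - t) / r)) - g (t + r * u)\<bar> \<partial>unit_uniform) \<longlonglongrightarrow> 0"
    by (rule translation_continuous[OF _ _ e, where B = B]) (use B in auto)
  have int: "integrable unit_uniform (\<lambda>u. g (s + r * u))" for s
    using B by (intro U.integrable_const_bound[of _ B]) auto
  have "norm ((\<integral>u. g (X n + r * u) \<partial>unit_uniform) - (\<integral>u. g (t + r * u) \<partial>unit_uniform))
     \<le> (\<integral>u. \<bar>g (t + r * (u + (X n - t) / r)) - g (t + r * u)\<bar> \<partial>unit_uniform)" for n
  proof -
    have "(\<integral>u. g (X n + r * u) \<partial>unit_uniform) - (\<integral>u. g (t + r * u) \<partial>unit_uniform)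
      = (\<integral>u. g (X n + r * u) - g (t + r * u) \<partial>unit_uniform)"
      by (intro Bochner_Integration.integral_diff[symmetric] int)
    also have "norm \<dots> \<le> (\<integral>u. norm (g (X n + r * u) - g (t + r * u)) \<partial>unit_uniform)"
      by (rule integral_norm_bound)
    finally show ?thesis using r by (simp add: distrib_left add.commute)
  qed
  then have "(\<lambda>n. (\<integral>u. g (X n + r * u) \<partial>unit_uniform) - (\<integral>u. g (t + r * u) \<partial>unit_uniform)) \<longlonglongrightarrow> 0"
    by (intro Lim_null_comparison[OF _ *]) auto
  then show "((\<lambda>t. \<integral>u. g (t + r * u) \<partial>unit_uniform) \<circ> X) \<longlonglongrightarrow> (\<integral>u. g (t + r * u) \<partial>unit_uniform)"
    unfolding comp_def by (subst (asm) LIM_zero_iff)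
qed

text \<open>With an antiderivative \<open>G\<close> of \<open>g\<close> the average is
  \<open>(G (t + r) - G t) / r\<close>, which is differentiated directly.\<close>

lemma average_has_derivative:
  fixes g :: "real \<Rightarrow> real"
  assumes g: "\<And>t. isCont g t" and r: "0 < r"
  shows "((\<lambda>t. \<integral>u. g (t + r * u) \<partial>unit_uniform) has_real_derivative (g (t + r) - g t) / r) (at t)"
proof -
  obtain G where G: "(G has_real_derivative g x) (at x)" for x
    using einterval_antiderivative[of "-\<infinity>" \<infinity> g] g
    by (auto simp: has_real_derivative_iff_has_vector_derivative)
  have [measurable]: "g \<in> borel_measurable borel"
    using g by (intro borel_measurable_continuous_onI) (simp add: continuous_on_eq_continuous_at)
  have "(\<integral>u. g (s + r * u) \<partial>unit_uniform) = (G (s + r) - G s) / r" for s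
  proof -
    have "(\<integral>u. g (s + r * u) \<partial>unit_uniform) = (\<integral>u. g (s + r * u) * indicator {0..1} u \<partial>lborel)"
      by (intro integral_unit_uniform) measurable
    also have "\<dots> = (\<lambda>u. G (s + r * u) / r) 1 - (\<lambda>u. G (s + r * u) / r) 0"
    proof (rule integral_FTC_Icc_real)
      show "((\<lambda>u. G (s + r * u) / r) has_real_derivative g (s + r * u)) (at u)" for u
        using r by (auto intro!: derivative_eq_intros DERIV_chain2[OF G])
      show "isCont (\<lambda>u. g (s + r * u)) u" for u
        by (intro isCont_o2[OF _ g] continuous_intros)
    qed simp
    finally show ?thesis by (simp add: diff_divide_distrib)
  qed
  moreover have "((\<lambda>s. (G (s + r) - G s) / r) has_real_derivative (g (t + r) - g t) / r) (at t)"
    using r by (auto intro!: derivative_eq_intros DERIV_chain2[OF G])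
  ultimately show ?thesis by simp
qed

section \<open>Orbits of a measurable Markov semigroup\<close>

text \<open>Both the integrand and the measure depend on \<open>x\<close>. Pushing
  \<open>L x\<close> to the product along \<open>Pair x\<close> moves this dependence entirely into
  the measure, where measurability of integration over \<open>subprob_algebra\<close>
  applies.\<close>

lemma integral_kernel_measurable:
  fixes f :: "'a \<Rightarrow> 'b \<Rightarrow> real"
  assumes f[measurable]: "(\<lambda>(x, y). f x y) \<in> borel_measurable (N \<Otimes>\<^sub>M M)"
    and L: "L \<in> N \<rightarrow>\<^sub>M prob_algebra M"
  shows "(\<lambda>x. \<integral>y. f x y \<partial>L x) \<in> borel_measurable N"
proof -
  note [measurable] = measurable_prob_algebraD[OF L]
  have D: "(\<lambda>x. distr (L x) (N \<Otimes>\<^sub>M M) (Pair x)) \<in> N \<rightarrow>\<^sub>M subprob_algebra (N \<Otimes>\<^sub>M M)"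
    by (rule measurable_distr2[where M = M]) auto
  have "(\<lambda>x. integral\<^sup>L (distr (L x) (N \<Otimes>\<^sub>M M) (Pair x)) (\<lambda>(x, y). f x y)) \<in> borel_measurable N"
    by (rule measurable_compose[OF D integral_measurable_subprob_algebra]) measurable
  moreover have "integral\<^sup>L (distr (L x) (N \<Otimes>\<^sub>M M) (Pair x)) (\<lambda>(x, y). f x y) = (\<integral>y. f x y \<partial>L x)"
    if x: "x \<in> space N" for x
  proof -
    have [measurable_cong]: "sets (L x) = sets M"
      using measurable_space[OF L x] by (simp add: space_prob_algebra)
    show ?thesis using x by (subst integral_distr) auto
  qed
  ultimately show ?thesis
    by (rule measurable_cong[THEN iffD1, rotated]) auto
qed

text \<open>The difference of the two sides is the variance of \<open>f\<close>.\<close>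

lemma (in prob_space) square_integral_le:
  fixes f :: "'a \<Rightarrow> real"
  assumes [measurable]: "f \<in> borel_measurable M" and B: "\<And>x. x \<in> space M \<Longrightarrow> \<bar>f x\<bar> \<le> B"
  shows "(\<integral>x. f x \<partial>M)\<^sup>2 \<le> (\<integral>x. (f x)\<^sup>2 \<partial>M)"
proof -
  have "integrable M f"
    using B by (intro integrable_const_bound[of _ B]) auto
  moreover have "integrable M (\<lambda>x. (f x)\<^sup>2)"
    using power_mono[OF B, of _ 2] by (intro integrable_const_bound[of _ "B\<^sup>2"]) auto
  ultimately have "variance f = (\<integral>x. (f x)\<^sup>2 \<partial>M) - (\<integral>x. f x \<partial>M)\<^sup>2"
    by (rule variance_eq)
  then show ?thesis using variance_positive[of f] by linarith
qed

lemma (in pair_prob_space) Fubini_bounded: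
  fixes f :: "'a \<Rightarrow> 'b \<Rightarrow> real"
  assumes "(\<lambda>(x, y). f x y) \<in> borel_measurable (M1 \<Otimes>\<^sub>M M2)"
    and "\<And>x y. x \<in> space M1 \<Longrightarrow> y \<in> space M2 \<Longrightarrow> \<bar>f x y\<bar> \<le> B"
  shows "(\<integral>y. \<integral>x. f x y \<partial>M1 \<partial>M2) = (\<integral>x. \<integral>y. f x y \<partial>M2 \<partial>M1)"
proof (rule Fubini_integral)
  show "integrable (M1 \<Otimes>\<^sub>M M2) (\<lambda>(x, y). f x y)"
    using assms(2) by (intro P.integrable_const_bound[OF _ assms(1), of B] AE_I2) (auto simp: space_pair_measure)
qed

text \<open>Time ranges over all reals so that joint measurability can be stated on
  \<open>borel\<close>; the laws concern nonnegative times. \<open>K 0 x\<close> may differ from the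
  point mass at \<open>x\<close>, and continuity in time is absent.\<close>

locale stationary_semigroup =
  fixes M :: "'a measure" and \<pi> :: "'a measure" and K :: "real \<Rightarrow> 'a \<Rightarrow> 'a measure"
  assumes kernel: "(\<lambda>(t, x). K t x) \<in> borel \<Otimes>\<^sub>M M \<rightarrow>\<^sub>M prob_algebra M"
    and semigroup: "\<lbrakk>x \<in> space M; 0 \<le> s; 0 \<le> t\<rbrakk> \<Longrightarrow> K (s + t) x = K s x \<bind> K t"
    and prob_space_stationary: "prob_space \<pi>"
    and sets_stationary[measurable_cong]: "sets \<pi> = sets M"
    and stationary: "0 \<le> t \<Longrightarrow> \<pi> \<bind> K t = \<pi>"
begin

sublocale prob_space \<pi> by (rule prob_space_stationary)

lemma space_stationary [simp]: "space \<pi> = space M"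
  by (rule sets_eq_imp_space_eq[OF sets_stationary])

lemma kernel_time: "K t \<in> M \<rightarrow>\<^sub>M prob_algebra M"
proof -
  have "(\<lambda>x. case (t, x) of (t, x) \<Rightarrow> K t x) \<in> M \<rightarrow>\<^sub>M prob_algebra M"
    by (rule measurable_compose[OF _ kernel]) simp
  then show ?thesis by simp
qed

lemma prob_space_kernel: "x \<in> space M \<Longrightarrow> prob_space (K t x)"
  and sets_kernel: "x \<in> space M \<Longrightarrow> sets (K t x) = sets M"
  using measurable_space[OF kernel_time, of x t] by (auto simp: space_prob_algebra)

lemma space_kernel: "x \<in> space M \<Longrightarrow> space (K t x) = space M"
  by (rule sets_eq_imp_space_eq[OF sets_kernel])

lemma integral_kernel_measurable_time:
  fixes f :: "'a \<Rightarrow> real"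
  assumes [measurable]: "f \<in> borel_measurable M"
  shows "(\<lambda>x. \<integral>y. f y \<partial>K t x) \<in> borel_measurable M"
  by (rule integral_kernel_measurable[OF _ kernel_time]) measurable

lemma abs_integral_kernel_le:
  fixes f :: "'a \<Rightarrow> real"
  assumes [measurable]: "f \<in> borel_measurable M" and B: "\<And>x. x \<in> space M \<Longrightarrow> \<bar>f x\<bar> \<le> B"
    and x: "x \<in> space M"
  shows "\<bar>\<integral>y. f y \<partial>K t x\<bar> \<le> B"
proof -
  interpret Kx: prob_space "K t x" by (rule prob_space_kernel[OF x])
  have [measurable]: "f \<in> borel_measurable (K t x)"
    using assms(1) by (simp cong: measurable_cong_sets add: sets_kernel[OF x])
  have i: "integrable (K t x) f"
    using B by (intro Kx.integrable_const_bound[of _ B]) (auto simp: space_kernel[OF x])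
  have "\<bar>\<integral>y. f y \<partial>K t x\<bar> \<le> (\<integral>y. \<bar>f y\<bar> \<partial>K t x)"
    by (rule integral_abs_bound)
  also have "\<dots> \<le> (\<integral>y. B \<partial>K t x)"
    using i B by (intro integral_mono) (auto simp: space_kernel[OF x])
  finally show ?thesis by (simp add: Kx.prob_space)
qed

lemma integral_kernel_kernel:
  fixes f :: "'a \<Rightarrow> real"
  assumes [measurable]: "f \<in> borel_measurable M" and B: "\<And>x. x \<in> space M \<Longrightarrow> \<bar>f x\<bar> \<le> B"
    and x: "x \<in> space M" and "0 \<le> s" "0 \<le> t"
  shows "(\<integral>y. \<integral>z. f z \<partial>K t y \<partial>K s x) = (\<integral>z. f z \<partial>K (s + t) x)"
proof -
  interpret Kx: prob_space "K s x" by (rule prob_space_kernel[OF x])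
  have "K t \<in> K s x \<rightarrow>\<^sub>M subprob_algebra M"
    using measurable_prob_algebraD[OF kernel_time] by (simp cong: measurable_cong_sets add: sets_kernel[OF x])
  moreover have "AE y in K s x. emeasure (K t y) (space (K t y)) \<le> ennreal 1"
    by (intro AE_I2) (auto simp: space_kernel[OF x] prob_space.emeasure_space_1[OF prob_space_kernel])
  ultimately have "integral\<^sup>L (K s x \<bind> K t) f = (\<integral>y. \<integral>z. f z \<partial>K t y \<partial>K s x)"
    using B by (intro integral_bind[where K = M and B' = 1]) (auto intro: Kx.finite_measure_axioms)
  then show ?thesis using assms by (simp add: semigroup)
qed

lemma integral_stationary:
  fixes f :: "'a \<Rightarrow> real"
  assumes [measurable]: "f \<in> borel_measurable M" and B: "\<And>x. x \<in> space M \<Longrightarrow> \<bar>f x\<bar> \<le> B"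
    and "0 \<le> t"
  shows "(\<integral>x. \<integral>y. f y \<partial>K t x \<partial>\<pi>) = (\<integral>x. f x \<partial>\<pi>)"
proof -
  have "K t \<in> \<pi> \<rightarrow>\<^sub>M subprob_algebra M"
    using measurable_prob_algebraD[OF kernel_time] by (simp cong: measurable_cong_sets add: sets_stationary)
  moreover have "AE y in \<pi>. emeasure (K t y) (space (K t y)) \<le> ennreal 1"
    by (intro AE_I2) (auto simp: prob_space.emeasure_space_1[OF prob_space_kernel])
  ultimately have "integral\<^sup>L (\<pi> \<bind> K t) f = (\<integral>x. \<integral>y. f y \<partial>K t x \<partial>\<pi>)"
    using B by (intro integral_bind[where K = M and B' = 1]) (auto intro: finite_measure_axioms)
  then show ?thesis using assms by (simp add: stationary)
qed

lemma integrable_bounded: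
  fixes f :: "'a \<Rightarrow> real"
  assumes "f \<in> borel_measurable M" and "\<And>x. x \<in> space M \<Longrightarrow> \<bar>f x\<bar> \<le> B"
  shows "integrable \<pi> f"
  using assms by (intro integrable_const_bound[of _ B]) (auto cong: measurable_cong_sets simp: sets_stationary)

text \<open>Jointly measurable bounded orbits \<open>\<Phi> t = K\<^sub>t \<Phi>\<^sub>0\<close> of the semigroup. Time averages of orbits
  are again orbits: this is how orbits are smoothed until the pointwise generator applies to them.\<close>

definition flow :: "(real \<Rightarrow> 'a \<Rightarrow> real) \<Rightarrow> real \<Rightarrow> bool" where
  "flow \<Phi> B \<longleftrightarrow> (\<lambda>(t, x). \<Phi> t x) \<in> borel_measurable (borel \<Otimes>\<^sub>M M) \<and>
    (\<forall>t. \<forall>x\<in>space M. \<bar>\<Phi> t x\<bar> \<le> B) \<and>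
    (\<forall>s\<ge>0. \<forall>t\<ge>0. \<forall>x\<in>space M. (\<integral>y. \<Phi> t y \<partial>K s x) = \<Phi> (s + t) x)"

lemma flow_measurable: "flow \<Phi> B \<Longrightarrow> (\<lambda>(t, x). \<Phi> t x) \<in> borel_measurable (borel \<Otimes>\<^sub>M M)"
  and flow_bound: "flow \<Phi> B \<Longrightarrow> x \<in> space M \<Longrightarrow> \<bar>\<Phi> t x\<bar> \<le> B"
  and flow_evolve: "flow \<Phi> B \<Longrightarrow> x \<in> space M \<Longrightarrow> 0 \<le> s \<Longrightarrow> 0 \<le> t \<Longrightarrow> (\<integral>y. \<Phi> t y \<partial>K s x) = \<Phi> (s + t) x"
  by (auto simp: flow_def)

lemma flow_measurable_time: "flow \<Phi> B \<Longrightarrow> \<Phi> t \<in> borel_measurable M"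
  using measurable_compose[OF measurable_Pair1'[of t borel M] flow_measurable, of \<Phi> B] by simp

lemma flow_measurable_space: "flow \<Phi> B \<Longrightarrow> x \<in> space M \<Longrightarrow> (\<lambda>t. \<Phi> t x) \<in> borel_measurable borel"
  using measurable_compose[OF measurable_Pair2'[of x M borel] flow_measurable, of \<Phi> B] by simp

lemma flow_kernel:
  fixes F :: "'a \<Rightarrow> real"
  assumes F[measurable]: "F \<in> borel_measurable M" and B: "\<And>x. x \<in> space M \<Longrightarrow> \<bar>F x\<bar> \<le> B"
  shows "flow (\<lambda>t x. \<integral>y. F y \<partial>K t x) B"
  unfolding flow_def
proof (intro conjI allI ballI impI)
  have "(\<lambda>p. \<integral>y. F y \<partial>(case p of (t, x) \<Rightarrow> K t x)) \<in> borel_measurable (borel \<Otimes>\<^sub>M M)"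
    by (rule integral_kernel_measurable[OF _ kernel]) measurable
  then show "(\<lambda>(t, x). \<integral>y. F y \<partial>K t x) \<in> borel_measurable (borel \<Otimes>\<^sub>M M)"
    by (simp add: case_prod_beta')
qed (use abs_integral_kernel_le[OF F B] integral_kernel_kernel[OF F B] in auto)

lemma flow_shift:
  assumes \<Phi>: "flow \<Phi> B" and "0 \<le> e"
  shows "flow (\<lambda>t. \<Phi> (t + e)) B"
proof -
  note [measurable] = flow_measurable[OF \<Phi>]
  have "(\<lambda>(t, x). \<Phi> (t + e) x) \<in> borel_measurable (borel \<Otimes>\<^sub>M M)" by measurable
  then show ?thesis
    using assms by (auto simp: flow_def add.assoc)
qed

lemma flow_diff:
  assumes \<Phi>: "flow \<Phi> B" and \<Psi>: "flow \<Psi> B'"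
  shows "flow (\<lambda>t x. \<Phi> t x - \<Psi> t x) (B + B')"
  unfolding flow_def
proof (intro conjI allI ballI impI)
  note [measurable] = flow_measurable[OF \<Phi>] flow_measurable[OF \<Psi>]
  show "(\<lambda>(t, x). \<Phi> t x - \<Psi> t x) \<in> borel_measurable (borel \<Otimes>\<^sub>M M)" by measurable
  show "\<bar>\<Phi> t x - \<Psi> t x\<bar> \<le> B + B'" if "x \<in> space M" for t x
    using flow_bound[OF \<Phi> that, of t] flow_bound[OF \<Psi> that, of t] by linarith
  show "(\<integral>y. \<Phi> t y - \<Psi> t y \<partial>K s x) = \<Phi> (s + t) x - \<Psi> (s + t) x"
    if x: "x \<in> space M" and st: "0 \<le> s" "0 \<le> t" for s t x
  proof -
    interpret Kx: prob_space "K s x" by (rule prob_space_kernel[OF x])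
    have int: "integrable (K s x) (\<Phi> t)" if "flow \<Phi> B" for \<Phi> B
      using flow_bound[OF that] flow_measurable_time[OF that]
      by (intro Kx.integrable_const_bound[of _ B])
        (auto simp: space_kernel[OF x] sets_kernel[OF x] cong: measurable_cong_sets)
    show ?thesis
      by (subst Bochner_Integration.integral_diff[OF int[OF \<Phi>] int[OF \<Psi>]])
        (simp add: flow_evolve[OF \<Phi> x st] flow_evolve[OF \<Psi> x st])
  qed
qed

text \<open>The average over [t, t + r] is an integral against a probability measure on the unit
  interval. Hence the bound \<open>B\<close> survives, and the action of \<open>K s\<close> passes
  under the average by Fubini.\<close>

lemma flow_average:
  assumes \<Phi>: "flow \<Phi> B" and r: "0 \<le> r"
  shows "flow (\<lambda>t x. \<integral>u. \<Phi> (t + r * u) x \<partial>unit_uniform) B"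
  unfolding flow_def
proof (intro conjI allI ballI impI)
  interpret U: prob_space unit_uniform by (rule prob_space_unit_uniform)
  note [measurable] = flow_measurable[OF \<Phi>]
  have "(\<lambda>p. \<integral>u. \<Phi> (fst p + r * u) (snd p) \<partial>unit_uniform) \<in> borel_measurable (borel \<Otimes>\<^sub>M M)"
    by measurable
  then show "(\<lambda>(t, x). \<integral>u. \<Phi> (t + r * u) x \<partial>unit_uniform) \<in> borel_measurable (borel \<Otimes>\<^sub>M M)"
    by (simp add: case_prod_beta')
  show "\<bar>\<integral>u. \<Phi> (t + r * u) x \<partial>unit_uniform\<bar> \<le> B" if x: "x \<in> space M" for t x
  proof -
    have [measurable]: "(\<lambda>u. \<Phi> u x) \<in> borel_measurable borel" by (rule flow_measurable_space[OF \<Phi> x])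
    have "\<bar>\<integral>u. \<Phi> (t + r * u) x \<partial>unit_uniform\<bar> \<le> (\<integral>u. \<bar>\<Phi> (t + r * u) x\<bar> \<partial>unit_uniform)"
      by (rule integral_abs_bound)
    also have "\<dots> \<le> (\<integral>u. B \<partial>unit_uniform)"
      using flow_bound[OF \<Phi> x] order_trans[OF abs_ge_zero flow_bound[OF \<Phi> x]]
      by (intro integral_mono U.integrable_const_bound[of _ B]) auto
    finally show ?thesis by (simp add: U.prob_space)
  qed
  show "(\<integral>y. \<integral>u. \<Phi> (t + r * u) y \<partial>unit_uniform \<partial>K s x) = (\<integral>u. \<Phi> (s + t + r * u) x \<partial>unit_uniform)"
    if x: "x \<in> space M" and st: "0 \<le> s" "0 \<le> t" for s t x
  proof -
    interpret Kx: prob_space "K s x" by (rule prob_space_kernel[OF x])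
    interpret P: pair_prob_space unit_uniform "K s x" ..
    note [measurable_cong] = sets_kernel[OF x]
    have "(\<integral>y. \<integral>u. \<Phi> (t + r * u) y \<partial>unit_uniform \<partial>K s x) = (\<integral>u. \<integral>y. \<Phi> (t + r * u) y \<partial>K s x \<partial>unit_uniform)"
      using flow_bound[OF \<Phi>] by (intro P.Fubini_bounded[of _ B]) (auto simp: space_kernel[OF x])
    also have "\<dots> = (\<integral>u. \<Phi> (s + t + r * u) x \<partial>unit_uniform)"
    proof (rule integral_cong_AE)
      \<comment> \<open>The evolution law needs \<open>t + r * u\<close> to be nonnegative, which
        holds for \<open>u\<close> in the unit interval and therefore almost surely.\<close>
      show "AE u in unit_uniform. (\<integral>y. \<Phi> (t + r * u) y \<partial>K s x) = \<Phi> (s + t + r * u) x"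
        using flow_evolve[OF \<Phi> x st(1)] st r by (intro AE_uniform_measureI AE_I2) (auto simp: add.assoc)
      show "(\<lambda>u. \<integral>y. \<Phi> (t + r * u) y \<partial>K s x) \<in> borel_measurable unit_uniform"
        by measurable
      show "(\<lambda>u. \<Phi> (s + t + r * u) x) \<in> borel_measurable unit_uniform"
        using flow_measurable_space[OF \<Phi> x] by measurable
    qed
    finally show ?thesis .
  qed
qed

section \<open>Contraction of orbits under the stationary law\<close>

lemma flow_integral_const:
  assumes \<Phi>: "flow \<Phi> B" and "0 \<le> t"
  shows "(\<integral>x. \<Phi> t x \<partial>\<pi>) = (\<integral>x. \<Phi> 0 x \<partial>\<pi>)"
proof -
  have "(\<integral>x. \<Phi> t x \<partial>\<pi>) = (\<integral>x. \<integral>y. \<Phi> 0 y \<partial>K t x \<partial>\<pi>)"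
    using flow_evolve[OF \<Phi>, of _ t 0] assms(2) by (intro Bochner_Integration.integral_cong) auto
  also have "\<dots> = (\<integral>x. \<Phi> 0 x \<partial>\<pi>)"
    by (rule integral_stationary[OF flow_measurable_time[OF \<Phi>] flow_bound[OF \<Phi>] assms(2)])
  finally show ?thesis .
qed

text \<open>From \<open>s\<close> to \<open>t\<close> the orbit evolves by the kernel
  \<open>K (t - s)\<close>. The absolute value of an average is at most the average of absolute
  values, and stationarity removes the kernel once integrated.\<close>

lemma flow_abs_decreasing:
  assumes \<Phi>: "flow \<Phi> B" and "0 \<le> s" "s \<le> t"
  shows "(\<integral>x. \<bar>\<Phi> t x\<bar> \<partial>\<pi>) \<le> (\<integral>x. \<bar>\<Phi> s x\<bar> \<partial>\<pi>)"
proof -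
  note [measurable] = flow_measurable_time[OF \<Phi>]
  have b: "\<bar>\<bar>\<Phi> s x\<bar>\<bar> \<le> B" if "x \<in> space M" for s x
    using flow_bound[OF \<Phi> that] by simp
  have "(\<integral>x. \<bar>\<Phi> t x\<bar> \<partial>\<pi>) \<le> (\<integral>x. \<integral>y. \<bar>\<Phi> s y\<bar> \<partial>K (t - s) x \<partial>\<pi>)"
  proof (rule integral_mono)
    show "integrable \<pi> (\<lambda>x. \<bar>\<Phi> t x\<bar>)"
      using b by (intro integrable_bounded[of _ B]) auto
    show "integrable \<pi> (\<lambda>x. \<integral>y. \<bar>\<Phi> s y\<bar> \<partial>K (t - s) x)"
      using b by (intro integrable_bounded[of _ B] integral_kernel_measurable_time abs_integral_kernel_le) auto
    show "\<bar>\<Phi> t x\<bar> \<le> (\<integral>y. \<bar>\<Phi> s y\<bar> \<partial>K (t - s) x)" if "x \<in> space \<pi>" for x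
      using flow_evolve[OF \<Phi>, of x "t - s" s] that assms(2,3) integral_abs_bound[of "K (t - s) x" "\<Phi> s"] by simp
  qed
  also have "\<dots> = (\<integral>x. \<bar>\<Phi> s x\<bar> \<partial>\<pi>)"
    using assms b by (intro integral_stationary[of _ B]) auto
  finally show ?thesis .
qed

text \<open>As for \<open>flow_abs_decreasing\<close>, with Jensen for the square in place of the
  triangle inequality.\<close>

lemma flow_square_decreasing:
  assumes \<Phi>: "flow \<Phi> B" and "0 \<le> s" "s \<le> t"
  shows "(\<integral>x. (\<Phi> t x)\<^sup>2 \<partial>\<pi>) \<le> (\<integral>x. (\<Phi> s x)\<^sup>2 \<partial>\<pi>)"
proof -
  note [measurable] = flow_measurable_time[OF \<Phi>]
  have b: "\<bar>(\<Phi> s x)\<^sup>2\<bar> \<le> B\<^sup>2" if "x \<in> space M" for s x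
    using power_mono[OF flow_bound[OF \<Phi> that, of s], of 2] by simp
  have "(\<integral>x. (\<Phi> t x)\<^sup>2 \<partial>\<pi>) \<le> (\<integral>x. \<integral>y. (\<Phi> s y)\<^sup>2 \<partial>K (t - s) x \<partial>\<pi>)"
  proof (rule integral_mono)
    show "integrable \<pi> (\<lambda>x. (\<Phi> t x)\<^sup>2)"
      using b by (intro integrable_bounded[of _ "B\<^sup>2"]) auto
    show "integrable \<pi> (\<lambda>x. \<integral>y. (\<Phi> s y)\<^sup>2 \<partial>K (t - s) x)"
      using b by (intro integrable_bounded[of _ "B\<^sup>2"] integral_kernel_measurable_time abs_integral_kernel_le) auto
    show "(\<Phi> t x)\<^sup>2 \<le> (\<integral>y. (\<Phi> s y)\<^sup>2 \<partial>K (t - s) x)" if "x \<in> space \<pi>" for x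
    proof -
      have x: "x \<in> space M" using that by simp
      interpret Kx: prob_space "K (t - s) x" by (rule prob_space_kernel[OF x])
      note [measurable_cong] = sets_kernel[OF x]
      have "(\<integral>y. \<Phi> s y \<partial>K (t - s) x)\<^sup>2 \<le> (\<integral>y. (\<Phi> s y)\<^sup>2 \<partial>K (t - s) x)"
        using flow_bound[OF \<Phi>] by (intro Kx.square_integral_le[of _ B]) (auto simp: space_kernel[OF x])
      then show ?thesis
        using flow_evolve[OF \<Phi> x, of "t - s" s] assms(2,3) by simp
    qed
  qed
  also have "\<dots> = (\<integral>x. (\<Phi> s x)\<^sup>2 \<partial>\<pi>)"
    using assms b by (intro integral_stationary[of _ "B\<^sup>2"]) auto
  finally show ?thesis .
qed

lemma flow_average_integral_eq:
  assumes \<Phi>: "flow \<Phi> B" and r: "0 \<le> r"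
  shows "(\<integral>x. \<integral>u. \<Phi> (0 + r * u) x \<partial>unit_uniform \<partial>\<pi>) = (\<integral>x. \<Phi> 0 x \<partial>\<pi>)"
proof -
  interpret U: prob_space unit_uniform by (rule prob_space_unit_uniform)
  interpret P: pair_prob_space unit_uniform \<pi> ..
  note [measurable] = flow_measurable[OF \<Phi>]
  have "(\<integral>x. \<integral>u. \<Phi> (0 + r * u) x \<partial>unit_uniform \<partial>\<pi>) = (\<integral>u. \<integral>x. \<Phi> (0 + r * u) x \<partial>\<pi> \<partial>unit_uniform)"
    using flow_bound[OF \<Phi>] by (intro P.Fubini_bounded[of _ B]) auto
  also have "\<dots> = (\<integral>u. (\<integral>x. \<Phi> 0 x \<partial>\<pi>) \<partial>unit_uniform)"
    using r by (intro integral_cong_AE AE_uniform_measureI AE_I2 impI flow_integral_const[OF \<Phi>]) auto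
  finally show ?thesis by (simp add: U.prob_space)
qed

text \<open>Jensen in \<open>u\<close>, an exchange of integrals, and monotonicity of the mean
  square in time. Averages need not converge to the orbit at time 0; in \<open>decay\<close> this
  inequality is what replaces convergence there.\<close>

lemma flow_average_square_le:
  assumes \<Phi>: "flow \<Phi> B" and r: "0 \<le> r"
  shows "(\<integral>x. (\<integral>u. \<Phi> (0 + r * u) x \<partial>unit_uniform)\<^sup>2 \<partial>\<pi>) \<le> (\<integral>x. (\<Phi> 0 x)\<^sup>2 \<partial>\<pi>)"
proof -
  interpret U: prob_space unit_uniform by (rule prob_space_unit_uniform)
  interpret P: pair_prob_space unit_uniform \<pi> ..
  note [measurable] = flow_measurable[OF \<Phi>]
  have b: "\<bar>(\<Phi> s x)\<^sup>2\<bar> \<le> B\<^sup>2" if "x \<in> space M" for s x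
    using power_mono[OF flow_bound[OF \<Phi> that, of s], of 2] by simp
  have sq: "(\<integral>u. (\<Phi> (r * u) x)\<^sup>2 \<partial>unit_uniform) \<le> B\<^sup>2" if "x \<in> space M" for x
  proof -
    have [measurable]: "(\<lambda>s. \<Phi> s x) \<in> borel_measurable borel"
      by (rule flow_measurable_space[OF \<Phi> that])
    have "(\<integral>u. (\<Phi> (r * u) x)\<^sup>2 \<partial>unit_uniform) \<le> (\<integral>u. B\<^sup>2 \<partial>unit_uniform)"
      using b[OF that] by (intro integral_mono U.integrable_const_bound[of _ "B\<^sup>2"]) auto
    then show ?thesis by (simp add: U.prob_space)
  qed
  have A: "flow (\<lambda>t x. \<integral>u. \<Phi> (t + r * u) x \<partial>unit_uniform) B"
    by (rule flow_average[OF \<Phi> r])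
  have "(\<integral>x. (\<integral>u. \<Phi> (0 + r * u) x \<partial>unit_uniform)\<^sup>2 \<partial>\<pi>) \<le> (\<integral>x. \<integral>u. (\<Phi> (r * u) x)\<^sup>2 \<partial>unit_uniform \<partial>\<pi>)"
  proof (rule integral_mono)
    show "integrable \<pi> (\<lambda>x. (\<integral>u. \<Phi> (0 + r * u) x \<partial>unit_uniform)\<^sup>2)"
      using flow_measurable_time[OF A, of 0] power_mono[where n = 2, OF flow_bound[OF A, of _ 0]]
      by (intro integrable_bounded[of _ "B\<^sup>2"]) auto
    show "integrable \<pi> (\<lambda>x. \<integral>u. (\<Phi> (r * u) x)\<^sup>2 \<partial>unit_uniform)"
      using sq by (intro integrable_bounded[of _ "B\<^sup>2"]) auto
    show "(\<integral>u. \<Phi> (0 + r * u) x \<partial>unit_uniform)\<^sup>2 \<le> (\<integral>u. (\<Phi> (r * u) x)\<^sup>2 \<partial>unit_uniform)" if "x \<in> space \<pi>" for x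
    proof -
      have x: "x \<in> space M" using that by simp
      have [measurable]: "(\<lambda>s. \<Phi> s x) \<in> borel_measurable borel"
        by (rule flow_measurable_space[OF \<Phi> x])
      show ?thesis using flow_bound[OF \<Phi> x] by (simp, intro U.square_integral_le[of _ B]) auto
    qed
  qed
  also have "\<dots> = (\<integral>u. \<integral>x. (\<Phi> (r * u) x)\<^sup>2 \<partial>\<pi> \<partial>unit_uniform)"
    using b by (intro P.Fubini_bounded[of _ "B\<^sup>2"]) auto
  also have "\<dots> \<le> (\<integral>u. (\<integral>x. (\<Phi> 0 x)\<^sup>2 \<partial>\<pi>) \<partial>unit_uniform)"
  proof (rule integral_mono_AE)
    show "AE u in unit_uniform. (\<integral>x. (\<Phi> (r * u) x)\<^sup>2 \<partial>\<pi>) \<le> (\<integral>x. (\<Phi> 0 x)\<^sup>2 \<partial>\<pi>)"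
      using flow_square_decreasing[OF \<Phi>, of 0] r by (intro AE_uniform_measureI AE_I2) auto
    have "\<bar>\<integral>x. (\<Phi> (r * u) x)\<^sup>2 \<partial>\<pi>\<bar> \<le> B\<^sup>2" for u
    proof -
      note [measurable] = flow_measurable_time[OF \<Phi>]
      have "(\<integral>x. (\<Phi> (r * u) x)\<^sup>2 \<partial>\<pi>) \<le> (\<integral>x. B\<^sup>2 \<partial>\<pi>)"
        using b by (intro integral_mono integrable_bounded[of _ "B\<^sup>2"]) auto
      then show ?thesis using prob_space by simp
    qed
    then show "integrable unit_uniform (\<lambda>u. \<integral>x. (\<Phi> (r * u) x)\<^sup>2 \<partial>\<pi>)"
      by (intro U.integrable_const_bound[of _ "B\<^sup>2"]) auto
  qed simp
  finally show ?thesis by (simp add: U.prob_space)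
qed

text \<open>No strong continuity at time \<open>0\<close> is assumed; for positive times it comes for free, because
  \<open>e \<mapsto> \<integral>\<bar>\<Phi> (T + e) - \<Phi> T\<bar> d\<pi>\<close> is nonincreasing in \<open>T\<close>, hence at most its average over
  earlier times, and translation of measurable functions is continuous in the mean.\<close>

lemma flow_L1_continuous:
  assumes \<Phi>: "flow \<Phi> B" and T: "0 < T" and e: "e \<longlonglongrightarrow> 0" and e_nonneg: "\<And>n. 0 \<le> e n"
  shows "(\<lambda>n. \<integral>x. \<bar>\<Phi> (T + e n) x - \<Phi> T x\<bar> \<partial>\<pi>) \<longlonglongrightarrow> 0"
proof -
  interpret U: prob_space unit_uniform by (rule prob_space_unit_uniform)
  interpret P: pair_prob_space unit_uniform \<pi> ..
  note [measurable] = flow_measurable[OF \<Phi>] flow_measurable_time[OF \<Phi>]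
  define W where "W n x = (\<integral>u. \<bar>\<Phi> (T * u + e n) x - \<Phi> (T * u) x\<bar> \<partial>unit_uniform)" for n x
  have b: "\<bar>\<Phi> s x - \<Phi> s' x\<bar> \<le> 2 * B" if "x \<in> space M" for s s' x
    using flow_bound[OF \<Phi> that, of s] flow_bound[OF \<Phi> that, of s'] by linarith
  have "(\<lambda>n. \<integral>x. W n x \<partial>\<pi>) \<longlonglongrightarrow> (\<integral>x. 0 \<partial>\<pi>)"
  proof (rule integral_dominated_convergence[where w = "\<lambda>_. 2 * B"])
    show "AE x in \<pi>. (\<lambda>n. W n x) \<longlonglongrightarrow> 0"
    proof (intro AE_I2)
      fix x assume "x \<in> space \<pi>"
      then have x: "x \<in> space M" by simp
      have [measurable]: "(\<lambda>s. \<Phi> s x) \<in> borel_measurable borel"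
        by (rule flow_measurable_space[OF \<Phi> x])
      \<comment> \<open>For fixed \<open>x\<close> the time interval from 0 to \<open>T\<close> is
        rescaled to the unit interval, so a lapse \<open>e n\<close> becomes a translation of
        \<open>u\<close> by \<open>e n / T\<close>.\<close>
      have "(\<lambda>n. e n / T) \<longlonglongrightarrow> 0" by (rule tendsto_divide_zero[OF e])
      then have "(\<lambda>n. \<integral>u. \<bar>\<Phi> (T * (u + e n / T)) x - \<Phi> (T * u) x\<bar> \<partial>unit_uniform) \<longlonglongrightarrow> 0"
        by (intro translation_continuous[of "\<lambda>u. \<Phi> (T * u) x" B]) (use flow_bound[OF \<Phi> x] in auto)
      then show "(\<lambda>n. W n x) \<longlonglongrightarrow> 0"
        using T by (simp add: W_def distrib_left)
    qed
    show "AE x in \<pi>. norm (W n x) \<le> 2 * B" for n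
    proof (intro AE_I2)
      fix x assume "x \<in> space \<pi>"
      then have x: "x \<in> space M" by simp
      have [measurable]: "(\<lambda>s. \<Phi> s x) \<in> borel_measurable borel"
        by (rule flow_measurable_space[OF \<Phi> x])
      have "W n x \<le> (\<integral>u. 2 * B \<partial>unit_uniform)"
        unfolding W_def using b[OF x] order_trans[OF abs_ge_zero b[OF x]] by (intro integral_mono U.integrable_const_bound[of _ "2 * B"]) auto
      then show "norm (W n x) \<le> 2 * B"
        by (simp add: U.prob_space W_def)
    qed
    show "W n \<in> borel_measurable \<pi>" for n
      unfolding W_def by measurable
  qed auto
  then have W: "(\<lambda>n. \<integral>x. W n x \<partial>\<pi>) \<longlonglongrightarrow> 0" by simp
  have "norm (\<integral>x. \<bar>\<Phi> (T + e n) x - \<Phi> T x\<bar> \<partial>\<pi>) \<le> (\<integral>x. W n x \<partial>\<pi>)" for n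
  proof -
    \<comment> \<open>The increment of an orbit over a fixed nonnegative lapse is itself an orbit,
      so its L1 norm at time \<open>T\<close> is at most the one at the earlier time
      \<open>T * u\<close>.\<close>
    have fl: "flow (\<lambda>t x. \<Phi> (t + e n) x - \<Phi> t x) (B + B)"
      by (rule flow_diff[OF flow_shift[OF \<Phi> e_nonneg] \<Phi>])
    have "(\<integral>x. \<bar>\<Phi> (T + e n) x - \<Phi> T x\<bar> \<partial>\<pi>) = (\<integral>u. (\<integral>x. \<bar>\<Phi> (T + e n) x - \<Phi> T x\<bar> \<partial>\<pi>) \<partial>unit_uniform)"
      by (simp add: U.prob_space)
    also have "\<dots> \<le> (\<integral>u. (\<integral>x. \<bar>\<Phi> (T * u + e n) x - \<Phi> (T * u) x\<bar> \<partial>\<pi>) \<partial>unit_uniform)"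
    proof (rule integral_mono_AE)
      have "(\<integral>x. \<bar>\<Phi> (T * u + e n) x - \<Phi> (T * u) x\<bar> \<partial>\<pi>) \<le> 2 * B" for u
      proof -
        have "(\<integral>x. \<bar>\<Phi> (T * u + e n) x - \<Phi> (T * u) x\<bar> \<partial>\<pi>) \<le> (\<integral>x. 2 * B \<partial>\<pi>)"
          using b by (intro integral_mono integrable_bounded[of "\<lambda>x. \<bar>\<Phi> (T * u + e n) x - \<Phi> (T * u) x\<bar>" "2 * B"]) auto
        also have "\<dots> = 2 * B" using prob_space by simp
        finally show ?thesis .
      qed
      then show "integrable unit_uniform (\<lambda>u. \<integral>x. \<bar>\<Phi> (T * u + e n) x - \<Phi> (T * u) x\<bar> \<partial>\<pi>)"
        by (intro U.integrable_const_bound[of _ "2 * B"]) auto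
      show "AE u in unit_uniform. (\<integral>x. \<bar>\<Phi> (T + e n) x - \<Phi> T x\<bar> \<partial>\<pi>) \<le> (\<integral>x. \<bar>\<Phi> (T * u + e n) x - \<Phi> (T * u) x\<bar> \<partial>\<pi>)"
      proof (intro AE_uniform_measureI AE_I2 impI)
        fix u :: real assume "u \<in> {0..1}"
        then show "(\<integral>x. \<bar>\<Phi> (T + e n) x - \<Phi> T x\<bar> \<partial>\<pi>) \<le> (\<integral>x. \<bar>\<Phi> (T * u + e n) x - \<Phi> (T * u) x\<bar> \<partial>\<pi>)"
          using flow_abs_decreasing[OF fl, of "T * u" T] T by (simp add: mult_left_le)
      qed simp
    qed simp
    also have "\<dots> = (\<integral>x. W n x \<partial>\<pi>)"
      unfolding W_def using b by (intro P.Fubini_bounded[of _ "2 * B", symmetric]) auto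
    finally show ?thesis by simp
  qed
  then show ?thesis by (intro Lim_null_comparison[OF always_eventually W]) blast
qed

end

section \<open>Exponential decay from the Poincare inequality\<close>

lemma Cauchy_Schwarz_integral:
  fixes f g :: "'a \<Rightarrow> real"
  assumes [measurable]: "f \<in> borel_measurable M" "g \<in> borel_measurable M"
    and f: "integrable M (\<lambda>x. (f x)\<^sup>2)" and g: "integrable M (\<lambda>x. (g x)\<^sup>2)"
  shows "\<bar>\<integral>x. f x * g x \<partial>M\<bar> \<le> sqrt (\<integral>x. (f x)\<^sup>2 \<partial>M) * sqrt (\<integral>x. (g x)\<^sup>2 \<partial>M)"
proof -
  have fg: "integrable M (\<lambda>x. f x * g x)"
  proof (rule Bochner_Integration.integrable_bound[OF Bochner_Integration.integrable_add[OF f g]])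
    have "\<bar>f x * g x\<bar> \<le> (f x)\<^sup>2 + (g x)\<^sup>2" for x
    proof -
      have "0 \<le> \<bar>f x * g x\<bar>" by simp
      moreover have "2 * \<bar>f x * g x\<bar> \<le> (f x)\<^sup>2 + (g x)\<^sup>2"
        using sum_squares_bound[of "\<bar>f x\<bar>" "\<bar>g x\<bar>"] by (simp add: abs_mult)
      ultimately show ?thesis by linarith
    qed
    then show "AE x in M. norm (f x * g x) \<le> norm ((f x)\<^sup>2 + (g x)\<^sup>2)" by simp
  qed measurable
  have sq: "(\<integral>\<^sup>+x. (ennreal \<bar>h x\<bar>)\<^sup>2 \<partial>M) = ennreal (\<integral>x. (h x)\<^sup>2 \<partial>M)"
    if "integrable M (\<lambda>x. (h x)\<^sup>2)" for h :: "'a \<Rightarrow> real"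
    using that by (subst nn_integral_eq_integral[symmetric]) (auto simp: ennreal_power)
  have "(\<integral>\<^sup>+x. ennreal \<bar>f x\<bar> * ennreal \<bar>g x\<bar> \<partial>M) = (\<integral>\<^sup>+x. ennreal \<bar>f x * g x\<bar> \<partial>M)"
    by (intro nn_integral_cong) (simp add: abs_mult ennreal_mult)
  also have "\<dots> = ennreal (\<integral>x. \<bar>f x * g x\<bar> \<partial>M)"
    using fg by (intro nn_integral_eq_integral) auto
  finally have "(ennreal (\<integral>x. \<bar>f x * g x\<bar> \<partial>M))\<^sup>2 \<le> ennreal (\<integral>x. (f x)\<^sup>2 \<partial>M) * ennreal (\<integral>x. (g x)\<^sup>2 \<partial>M)"
    using Cauchy_Schwarz_nn_integral[of "\<lambda>x. ennreal \<bar>f x\<bar>" M "\<lambda>x. ennreal \<bar>g x\<bar>"] by (simp add: sq f g)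
  then have "ennreal ((\<integral>x. \<bar>f x * g x\<bar> \<partial>M)\<^sup>2) \<le> ennreal ((\<integral>x. (f x)\<^sup>2 \<partial>M) * (\<integral>x. (g x)\<^sup>2 \<partial>M))"
    by (simp add: ennreal_power ennreal_mult)
  then have "(\<integral>x. \<bar>f x * g x\<bar> \<partial>M)\<^sup>2 \<le> (\<integral>x. (f x)\<^sup>2 \<partial>M) * (\<integral>x. (g x)\<^sup>2 \<partial>M)"
    by (subst (asm) ennreal_le_iff) auto
  then have "(\<integral>x. \<bar>f x * g x\<bar> \<partial>M) \<le> sqrt (\<integral>x. (f x)\<^sup>2 \<partial>M) * sqrt (\<integral>x. (g x)\<^sup>2 \<partial>M)"
    by (simp add: real_le_rsqrt flip: real_sqrt_mult)
  then show ?thesis using integral_abs_bound[of M "\<lambda>x. f x * g x"] by linarith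
qed

lemma prob_space_density_nn_integral:
  assumes "prob_space (density M h)" "h \<in> borel_measurable M"
  shows "(\<integral>\<^sup>+x. h x \<partial>M) = 1"
proof -
  have "(\<integral>\<^sup>+x. h x \<partial>M) = (\<integral>\<^sup>+x. h x * indicator (space M) x \<partial>M)"
    by (intro nn_integral_cong) auto
  also have "\<dots> = emeasure (density M h) (space M)"
    using assms(2) by (subst emeasure_density) auto
  finally show ?thesis using prob_space.emeasure_space_1[OF assms(1)] by simp
qed

lemma prob_space_density_integral:
  fixes h :: "'a \<Rightarrow> real"
  assumes "prob_space (density M (\<lambda>x. ennreal (h x)))" "h \<in> borel_measurable M" "\<And>x. 0 \<le> h x"
  shows "integrable M h" "(\<integral>x. h x \<partial>M) = 1"
  using prob_space_density_nn_integral[OF assms(1)] assms(2,3) nn_integral_eq_integrable[of h M 1] by auto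

text \<open>The generator stays implicit: \<open>g\<close> is its value at \<open>f\<close>, given
  as a pointwise right limit. Bounds on \<open>f\<close> and \<open>g\<close> take the place of a
  domain and make both integrals meaningful.\<close>

locale poincare_semigroup = stationary_semigroup +
  fixes C :: real
  assumes C_pos: "0 < C"
    and poincare:
      "\<lbrakk>f \<in> borel_measurable M; g \<in> borel_measurable M;
        \<And>x. x \<in> space M \<Longrightarrow> \<bar>f x\<bar> \<le> B; \<And>x. x \<in> space M \<Longrightarrow> \<bar>g x\<bar> \<le> B';
        \<And>x. x \<in> space M \<Longrightarrow> ((\<lambda>t. ((\<integral>y. f y \<partial>K t x) - f x) / t) \<longlongrightarrow> g x) (at_right 0)\<rbrakk>
       \<Longrightarrow> (\<integral>x. (f x - (\<integral>y. f y \<partial>\<pi>))\<^sup>2 \<partial>\<pi>) \<le> - C * (\<integral>x. f x * g x \<partial>\<pi>)"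
begin

text \<open>Gronwall in integrated form: \<open>exp (2 * s / C)\<close> times the mean square has
  nonpositive derivative, by the Poincare inequality for \<open>\<Phi> s\<close> at every time
  \<open>s\<close>. The fundamental theorem of calculus is used at each point \<open>x\<close> and
  integrated afterwards, so nothing is differentiated under the integral sign.\<close>

lemma decay_smooth:
  assumes \<Phi>: "flow \<Phi> B" and mean: "(\<integral>x. \<Phi> 0 x \<partial>\<pi>) = 0" and t: "0 \<le> t"
    and D_measurable: "(\<lambda>(t, x). D t x) \<in> borel_measurable (borel \<Otimes>\<^sub>M M)"
    and D_bound: "\<And>s x. x \<in> space M \<Longrightarrow> \<bar>D s x\<bar> \<le> B'"
    and D: "\<And>s x. x \<in> space M \<Longrightarrow> ((\<lambda>s. \<Phi> s x) has_real_derivative D s x) (at s)"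
    and D_cont: "\<And>s x. x \<in> space M \<Longrightarrow> isCont (\<lambda>s. D s x) s"
  shows "(\<integral>x. (\<Phi> t x)\<^sup>2 \<partial>\<pi>) \<le> exp (- 2 * t / C) * (\<integral>x. (\<Phi> 0 x)\<^sup>2 \<partial>\<pi>)"
proof -
  interpret U: prob_space unit_uniform by (rule prob_space_unit_uniform)
  interpret P: pair_prob_space unit_uniform \<pi> ..
  note [measurable] = flow_measurable[OF \<Phi>] D_measurable flow_measurable_time[OF \<Phi>]
  have D_time[measurable]: "D s \<in> borel_measurable M" for s
    using measurable_compose[OF measurable_Pair1'[of s borel M] D_measurable] by simp
  have int_sq: "integrable \<pi> (\<lambda>x. (\<Phi> s x)\<^sup>2)" for s
    using power_mono[where n = 2, OF flow_bound[OF \<Phi>]]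
    by (intro integrable_bounded[of _ "B\<^sup>2"]) auto
  have bD: "\<bar>\<Phi> s x * D s x\<bar> \<le> B * B'" if "x \<in> space M" for s x
    using mult_mono[OF flow_bound[OF \<Phi> that, of s] D_bound[OF that, of s]]
      order_trans[OF abs_ge_zero flow_bound[OF \<Phi> that]] by (simp add: abs_mult)
  have int_D: "integrable \<pi> (\<lambda>x. \<Phi> s x * D s x)" for s
    using bD by (intro integrable_bounded[of _ "B * B'"]) auto
  \<comment> \<open>\<open>E s x\<close> is the time derivative of
    \<open>exp (2 * s / C) * (\<Phi> s x)\<^sup>2\<close>.\<close>
  define E where "E s x = exp (2 * s / C) * (2 / C * (\<Phi> s x)\<^sup>2 + 2 * (\<Phi> s x * D s x))" for s x
  have [measurable]: "(\<lambda>(s, x). E s x) \<in> borel_measurable (borel \<Otimes>\<^sub>M M)"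
    unfolding E_def by measurable
  have E_nonpos: "(\<integral>x. E s x \<partial>\<pi>) \<le> 0" if s: "0 \<le> s" for s
  proof -
    have "(\<integral>x. (\<Phi> s x - (\<integral>y. \<Phi> s y \<partial>\<pi>))\<^sup>2 \<partial>\<pi>) \<le> - C * (\<integral>x. \<Phi> s x * D s x \<partial>\<pi>)"
    proof (rule poincare[where B = B and B' = B'])
      fix x assume x: "x \<in> space M"
      \<comment> \<open>Applying \<open>K h\<close> to \<open>\<Phi> s\<close> gives
        \<open>\<Phi> (s + h)\<close>, so the difference quotients of the semigroup at
        \<open>\<Phi> s\<close> are those of the path, and \<open>D s\<close> is the generator at
        \<open>\<Phi> s\<close>.\<close>
      have "((\<lambda>h. (\<Phi> (s + h) x - \<Phi> s x) / h) \<longlongrightarrow> D s x) (at_right 0)"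
        using D[OF x, of s] unfolding DERIV_def by (rule tendsto_within_subset) simp
      moreover have "\<forall>\<^sub>F h in at_right 0. (\<Phi> (s + h) x - \<Phi> s x) / h = ((\<integral>y. \<Phi> s y \<partial>K h x) - \<Phi> s x) / h"
        using flow_evolve[OF \<Phi> x _ s]
        by (auto simp: eventually_at_right_field add.commute intro!: exI[of _ 1])
      ultimately show "((\<lambda>h. ((\<integral>y. \<Phi> s y \<partial>K h x) - \<Phi> s x) / h) \<longlongrightarrow> D s x) (at_right 0)"
        by (rule Lim_transform_eventually)
    qed (use flow_bound[OF \<Phi>] D_bound in auto)
    \<comment> \<open>The mean remains zero along the orbit, so the variance is the second
      moment.\<close>
    then have "(\<integral>x. (\<Phi> s x)\<^sup>2 \<partial>\<pi>) \<le> - C * (\<integral>x. \<Phi> s x * D s x \<partial>\<pi>)"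
      by (simp add: flow_integral_const[OF \<Phi> s] mean)
    then have "2 / C * (\<integral>x. (\<Phi> s x)\<^sup>2 \<partial>\<pi>) + 2 * (\<integral>x. \<Phi> s x * D s x \<partial>\<pi>) \<le> 0"
      using C_pos by (simp add: field_simps)
    moreover have "(\<integral>x. E s x \<partial>\<pi>) = exp (2 * s / C) *
        (2 / C * (\<integral>x. (\<Phi> s x)\<^sup>2 \<partial>\<pi>) + 2 * (\<integral>x. \<Phi> s x * D s x \<partial>\<pi>))"
      unfolding E_def by (simp add: int_sq int_D)
    ultimately show ?thesis by (simp add: mult_nonneg_nonpos)
  qed
  have ftc: "exp (2 * t / C) * (\<Phi> t x)\<^sup>2 - (\<Phi> 0 x)\<^sup>2 = (\<integral>u. t * E (t * u) x \<partial>unit_uniform)"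
    if x: "x \<in> space M" for x
  proof -
    have contE: "isCont (\<lambda>u. t * E (t * u) x) u" for u
      unfolding E_def
      by (intro continuous_intros isCont_o2[OF _ D_cont[OF x]] isCont_o2[OF _ DERIV_isCont[OF D[OF x]]])
        (use C_pos in simp)
    have "(\<integral>u. t * E (t * u) x \<partial>unit_uniform) = (\<integral>u. t * E (t * u) x * indicator {0..1} u \<partial>lborel)"
      using contE by (intro integral_unit_uniform borel_measurable_continuous_onI)
        (simp add: continuous_on_eq_continuous_at)
    also have "\<dots> = (\<lambda>u. exp (2 * (t * u) / C) * (\<Phi> (t * u) x)\<^sup>2) 1 - (\<lambda>u. exp (2 * (t * u) / C) * (\<Phi> (t * u) x)\<^sup>2) 0"
    proof (rule integral_FTC_Icc_real)
      show "((\<lambda>u. exp (2 * (t * u) / C) * (\<Phi> (t * u) x)\<^sup>2) has_real_derivative t * E (t * u) x) (at u)" for u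
        unfolding E_def using C_pos
        by (auto intro!: derivative_eq_intros DERIV_chain2[OF D[OF x]] simp: field_simps power2_eq_square)
    qed (use contE in simp_all)
    finally show ?thesis by simp
  qed
  \<comment> \<open>Outside the unit interval the exponential factor escapes the bound
    \<open>exp (2 * t / C)\<close>. The indicator, which is 1 almost surely under
    \<open>unit_uniform\<close>, makes the integrand bounded everywhere, as
    \<open>Fubini_bounded\<close> demands.\<close>
  have E_bound: "\<bar>t * E (t * u) x * indicator {0..1} u\<bar> \<le> t * (exp (2 * t / C) * (2 / C * B\<^sup>2 + 2 * (B * B')))"
    if x: "x \<in> space M" for u x
  proof (cases "u \<in> {0..1}")
    case u: True
    have "t * u \<le> t" using u t by (simp add: mult_left_le)
    then have "exp (2 * (t * u) / C) \<le> exp (2 * t / C)"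
      using C_pos by (simp add: divide_right_mono)
    moreover have "\<bar>2 / C * (\<Phi> (t * u) x)\<^sup>2 + 2 * (\<Phi> (t * u) x * D (t * u) x)\<bar> \<le> 2 / C * B\<^sup>2 + 2 * (B * B')"
    proof -
      have "\<bar>2 / C * (\<Phi> (t * u) x)\<^sup>2\<bar> \<le> 2 / C * B\<^sup>2"
        using power_mono[OF flow_bound[OF \<Phi> x, of "t * u"], of 2] C_pos by (simp add: abs_mult divide_right_mono)
      then show ?thesis using bD[OF x, of "t * u"] by linarith
    qed
    ultimately have "\<bar>E (t * u) x\<bar> \<le> exp (2 * t / C) * (2 / C * B\<^sup>2 + 2 * (B * B'))"
      unfolding E_def abs_mult by (intro mult_mono) auto
    then show ?thesis using t u by (simp add: abs_mult mult_left_mono)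
  next
    case False
    have "0 \<le> 2 / C * B\<^sup>2 + 2 * (B * B')"
      using C_pos order_trans[OF abs_ge_zero bD[OF x]] by (intro add_nonneg_nonneg) auto
    then show ?thesis using False t by simp
  qed
  have [measurable]: "(\<lambda>u. indicator {0..1} u :: real) \<in> borel_measurable unit_uniform"
    by measurable
  have "exp (2 * t / C) * (\<integral>x. (\<Phi> t x)\<^sup>2 \<partial>\<pi>) - (\<integral>x. (\<Phi> 0 x)\<^sup>2 \<partial>\<pi>)
     = (\<integral>x. exp (2 * t / C) * (\<Phi> t x)\<^sup>2 - (\<Phi> 0 x)\<^sup>2 \<partial>\<pi>)"
    by (simp add: int_sq)
  also have "\<dots> = (\<integral>x. \<integral>u. t * E (t * u) x * indicator {0..1} u \<partial>unit_uniform \<partial>\<pi>)"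
  proof (rule Bochner_Integration.integral_cong[OF refl])
    fix x assume "x \<in> space \<pi>"
    then have x: "x \<in> space M" by simp
    have [measurable]: "(\<lambda>s. E s x) \<in> borel_measurable borel"
      by (rule measurable_compose[OF measurable_Pair2'[OF x], of "\<lambda>(s, x). E s x" borel borel, simplified]) measurable
    show "exp (2 * t / C) * (\<Phi> t x)\<^sup>2 - (\<Phi> 0 x)\<^sup>2 = (\<integral>u. t * E (t * u) x * indicator {0..1} u \<partial>unit_uniform)"
      unfolding ftc[OF x] by (intro integral_cong_AE AE_uniform_measureI) (auto split: split_indicator)
  qed
  also have "\<dots> = (\<integral>u. \<integral>x. t * E (t * u) x * indicator {0..1} u \<partial>\<pi> \<partial>unit_uniform)"
    using E_bound by (intro P.Fubini_bounded) auto
  also have "\<dots> = (\<integral>u. t * (indicator {0..1} u * (\<integral>x. E (t * u) x \<partial>\<pi>)) \<partial>unit_uniform)"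
    by (intro Bochner_Integration.integral_cong) (auto split: split_indicator)
  also have "\<dots> \<le> 0"
  proof -
    have "0 \<le> (\<integral>u. - (t * (indicator {0..1} u * (\<integral>x. E (t * u) x \<partial>\<pi>))) \<partial>unit_uniform)"
      using E_nonpos t by (intro Bochner_Integration.integral_nonneg) (auto simp: mult_nonneg_nonpos split: split_indicator)
    then show ?thesis by simp
  qed
  finally have "exp (2 * t / C) * (\<integral>x. (\<Phi> t x)\<^sup>2 \<partial>\<pi>) \<le> (\<integral>x. (\<Phi> 0 x)\<^sup>2 \<partial>\<pi>)" by simp
  then have "exp (- 2 * t / C) * (exp (2 * t / C) * (\<integral>x. (\<Phi> t x)\<^sup>2 \<partial>\<pi>)) \<le> exp (- 2 * t / C) * (\<integral>x. (\<Phi> 0 x)\<^sup>2 \<partial>\<pi>)"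
    by (intro mult_left_mono) auto
  then show ?thesis by (simp add: mult.assoc[symmetric] exp_add[symmetric])
qed

text \<open>Averaging over an interval of length \<open>r n\<close> makes the paths continuously
  differentiable with derivative at most \<open>2 * B / r n\<close>. This bound blows up as
  \<open>r n\<close> tends to 0, but the decay estimate does not contain it, so dominated
  convergence gives the limit.\<close>

lemma decay_continuous:
  assumes \<Phi>: "flow \<Phi> B" and mean: "(\<integral>x. \<Phi> 0 x \<partial>\<pi>) = 0" and t: "0 \<le> t"
    and cont: "\<And>s x. x \<in> space M \<Longrightarrow> isCont (\<lambda>s. \<Phi> s x) s"
  shows "(\<integral>x. (\<Phi> t x)\<^sup>2 \<partial>\<pi>) \<le> exp (- 2 * t / C) * (\<integral>x. (\<Phi> 0 x)\<^sup>2 \<partial>\<pi>)"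
proof -
  interpret U: prob_space unit_uniform by (rule prob_space_unit_uniform)
  note [measurable] = flow_measurable[OF \<Phi>] flow_measurable_time[OF \<Phi>]
  define r where "r n = 1 / real (Suc n)" for n
  have r: "0 < r n" for n by (simp add: r_def)
  have r0: "r \<longlonglongrightarrow> 0" unfolding r_def using LIMSEQ_inverse_real_of_nat by (simp add: inverse_eq_divide)
  define \<Psi> where "\<Psi> n t x = (\<integral>u. \<Phi> (t + r n * u) x \<partial>unit_uniform)" for n t x
  have \<Psi>: "flow (\<Psi> n) B" for n
    unfolding \<Psi>_def using r[of n] by (intro flow_average[OF \<Phi>]) simp
  note [measurable] = flow_measurable[OF \<Psi>] flow_measurable_time[OF \<Psi>]
  have decay: "(\<integral>x. (\<Psi> n t x)\<^sup>2 \<partial>\<pi>) \<le> exp (- 2 * t / C) * (\<integral>x. (\<Psi> n 0 x)\<^sup>2 \<partial>\<pi>)" for n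
  proof (rule decay_smooth[OF \<Psi> _ t, where D = "\<lambda>s x. (\<Phi> (s + r n) x - \<Phi> s x) / r n" and B' = "2 * B / r n"])
    show "(\<integral>x. \<Psi> n 0 x \<partial>\<pi>) = 0"
      unfolding \<Psi>_def using flow_average_integral_eq[OF \<Phi>, of "r n"] r[of n] mean by simp
    show "\<bar>(\<Phi> (s + r n) x - \<Phi> s x) / r n\<bar> \<le> 2 * B / r n" if "x \<in> space M" for s x
      using flow_bound[OF \<Phi> that, of s] flow_bound[OF \<Phi> that, of "s + r n"] r[of n]
      by (simp add: abs_le_iff divide_right_mono field_simps)
    show "((\<lambda>s. \<Psi> n s x) has_real_derivative (\<Phi> (s + r n) x - \<Phi> s x) / r n) (at s)" if "x \<in> space M" for s x
      unfolding \<Psi>_def by (rule average_has_derivative[OF cont[OF that] r])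
    show "isCont (\<lambda>s. (\<Phi> (s + r n) x - \<Phi> s x) / r n) s" if "x \<in> space M" for s x
      by (intro continuous_intros isCont_o2[OF _ cont[OF that]] cont[OF that]) (use r[of n] in simp)
  qed measurable
  have lim: "(\<lambda>n. \<Psi> n s x) \<longlonglongrightarrow> \<Phi> s x" if x: "x \<in> space M" for s x
  proof -
    have [measurable]: "(\<lambda>s. \<Phi> s x) \<in> borel_measurable borel"
      by (rule flow_measurable_space[OF \<Phi> x])
    have "(\<lambda>n. \<Psi> n s x) \<longlonglongrightarrow> (\<integral>u. \<Phi> s x \<partial>unit_uniform)"
      unfolding \<Psi>_def
    proof (rule integral_dominated_convergence[where w = "\<lambda>_. B"])
      show "AE u in unit_uniform. (\<lambda>n. \<Phi> (s + r n * u) x) \<longlonglongrightarrow> \<Phi> s x"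
      proof (intro AE_I2)
        fix u
        have "(\<lambda>n. s + r n * u) \<longlonglongrightarrow> s + 0 * u" by (intro tendsto_intros r0)
        then show "(\<lambda>n. \<Phi> (s + r n * u) x) \<longlonglongrightarrow> \<Phi> s x"
          by (intro isCont_tendsto_compose[OF cont[OF x]]) simp
      qed
    qed (use flow_bound[OF \<Phi> x] in auto)
    then show ?thesis by (simp add: U.prob_space)
  qed
  have lim_sq: "(\<lambda>n. \<integral>x. (\<Psi> n s x)\<^sup>2 \<partial>\<pi>) \<longlonglongrightarrow> (\<integral>x. (\<Phi> s x)\<^sup>2 \<partial>\<pi>)" for s
  proof (rule integral_dominated_convergence[where w = "\<lambda>_. B\<^sup>2"])
    show "AE x in \<pi>. (\<lambda>n. (\<Psi> n s x)\<^sup>2) \<longlonglongrightarrow> (\<Phi> s x)\<^sup>2"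
      by (intro AE_I2 tendsto_intros lim) simp
    show "AE x in \<pi>. norm ((\<Psi> n s x)\<^sup>2) \<le> B\<^sup>2" for n
      using power_mono[where n = 2, OF flow_bound[OF \<Psi>]] by (intro AE_I2) auto
  qed auto
  show ?thesis
    by (rule LIMSEQ_le[OF lim_sq tendsto_mult[OF tendsto_const lim_sq]]) (use decay in blast)
qed

text \<open>Averages of an arbitrary orbit have continuous paths, so \<open>decay_continuous\<close>
  applies to them. They need not converge at each point; at a time \<open>t > 0\<close> they
  converge in L1 by \<open>flow_L1_continuous\<close>, and at time 0 an upper bound on their mean
  square is enough.\<close>

lemma decay:
  assumes \<Phi>: "flow \<Phi> B" and mean: "(\<integral>x. \<Phi> 0 x \<partial>\<pi>) = 0" and t: "0 \<le> t"
  shows "(\<integral>x. (\<Phi> t x)\<^sup>2 \<partial>\<pi>) \<le> exp (- 2 * t / C) * (\<integral>x. (\<Phi> 0 x)\<^sup>2 \<partial>\<pi>)"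
proof (cases "t = 0")
  case False
  then have t0: "0 < t" using t by simp
  interpret U: prob_space unit_uniform by (rule prob_space_unit_uniform)
  interpret P: pair_prob_space unit_uniform \<pi> ..
  note [measurable] = flow_measurable[OF \<Phi>] flow_measurable_time[OF \<Phi>]
  define r where "r n = 1 / real (Suc n)" for n
  have r: "0 < r n" for n by (simp add: r_def)
  have r0: "r \<longlonglongrightarrow> 0" unfolding r_def using LIMSEQ_inverse_real_of_nat by (simp add: inverse_eq_divide)
  define \<Psi> where "\<Psi> n t x = (\<integral>u. \<Phi> (t + r n * u) x \<partial>unit_uniform)" for n t x
  have \<Psi>: "flow (\<Psi> n) B" for n
    unfolding \<Psi>_def using r[of n] by (intro flow_average[OF \<Phi>]) simp
  note [measurable] = flow_measurable_time[OF \<Psi>]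
  have b: "\<bar>\<Phi> s x - \<Phi> s' x\<bar> \<le> 2 * B" if "x \<in> space M" for s s' x
    using flow_bound[OF \<Phi> that, of s] flow_bound[OF \<Phi> that, of s'] by linarith
  have int_sq: "integrable \<pi> (\<lambda>x. (\<Theta> s x)\<^sup>2)" if "flow \<Theta> B" for \<Theta> s
    using power_mono[where n = 2, OF flow_bound[OF that]] flow_measurable_time[OF that]
    by (intro integrable_bounded[of _ "B\<^sup>2"]) auto
  have \<Psi>_decay: "(\<integral>x. (\<Psi> n t x)\<^sup>2 \<partial>\<pi>) \<le> exp (- 2 * t / C) * (\<integral>x. (\<Phi> 0 x)\<^sup>2 \<partial>\<pi>)" for n
  proof -
    have "(\<integral>x. (\<Psi> n t x)\<^sup>2 \<partial>\<pi>) \<le> exp (- 2 * t / C) * (\<integral>x. (\<Psi> n 0 x)\<^sup>2 \<partial>\<pi>)"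
    proof (rule decay_continuous[OF \<Psi> _ t])
      show "(\<integral>x. \<Psi> n 0 x \<partial>\<pi>) = 0"
        unfolding \<Psi>_def using flow_average_integral_eq[OF \<Phi>, of "r n"] r[of n] mean by simp
      show "isCont (\<lambda>s. \<Psi> n s x) s" if "x \<in> space M" for s x
        unfolding \<Psi>_def
        by (rule average_continuous[OF flow_measurable_space[OF \<Phi> that] flow_bound[OF \<Phi> that] r])
    qed
    also have "\<dots> \<le> exp (- 2 * t / C) * (\<integral>x. (\<Phi> 0 x)\<^sup>2 \<partial>\<pi>)"
      unfolding \<Psi>_def using flow_average_square_le[OF \<Phi>, of "r n"] r[of n] by (intro mult_left_mono) auto
    finally show ?thesis .
  qed
  define V where "V n = (\<integral>u. (\<integral>x. \<bar>\<Phi> (t + r n * u) x - \<Phi> t x\<bar> \<partial>\<pi>) \<partial>unit_uniform)" for n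
  have L1_le: "(\<integral>x. \<bar>\<Phi> s x - \<Phi> s' x\<bar> \<partial>\<pi>) \<le> 2 * B" for s s'
  proof -
    have "(\<integral>x. \<bar>\<Phi> s x - \<Phi> s' x\<bar> \<partial>\<pi>) \<le> (\<integral>x. 2 * B \<partial>\<pi>)"
      using b by (intro integral_mono integrable_bounded[of "\<lambda>x. \<bar>\<Phi> s x - \<Phi> s' x\<bar>" "2 * B"]) auto
    also have "\<dots> = 2 * B" using prob_space by simp
    finally show ?thesis .
  qed
  have "V \<longlonglongrightarrow> (\<integral>u. 0 \<partial>unit_uniform)"
    unfolding V_def
  proof (rule integral_dominated_convergence[where w = "\<lambda>_. 2 * B"])
    show "AE u in unit_uniform. (\<lambda>n. \<integral>x. \<bar>\<Phi> (t + r n * u) x - \<Phi> t x\<bar> \<partial>\<pi>) \<longlonglongrightarrow> 0"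
    proof (intro AE_uniform_measureI AE_I2 impI)
      fix u :: real assume u: "u \<in> {0..1}"
      have "(\<lambda>n. r n * u) \<longlonglongrightarrow> 0 * u" by (intro tendsto_intros r0)
      then show "(\<lambda>n. \<integral>x. \<bar>\<Phi> (t + r n * u) x - \<Phi> t x\<bar> \<partial>\<pi>) \<longlonglongrightarrow> 0"
        using u r by (intro flow_L1_continuous[OF \<Phi> t0]) (auto intro: mult_nonneg_nonneg less_imp_le)
    qed simp
    show "AE u in unit_uniform. norm (\<integral>x. \<bar>\<Phi> (t + r n * u) x - \<Phi> t x\<bar> \<partial>\<pi>) \<le> 2 * B" for n
      by (intro AE_I2) (simp add: L1_le)
  qed auto
  then have V: "V \<longlonglongrightarrow> 0" by simp
  \<comment> \<open>Since a^2 - b^2 = (a + b)(a - b) and both functions are bounded by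
    \<open>B\<close>, closeness in L1 controls the mean squares.\<close>
  have diff: "(\<integral>x. (\<Phi> t x)\<^sup>2 \<partial>\<pi>) - (\<integral>x. (\<Psi> n t x)\<^sup>2 \<partial>\<pi>) \<le> 2 * B * V n" for n
  proof -
    have "(\<integral>x. (\<Phi> t x)\<^sup>2 \<partial>\<pi>) - (\<integral>x. (\<Psi> n t x)\<^sup>2 \<partial>\<pi>) = (\<integral>x. (\<Phi> t x)\<^sup>2 - (\<Psi> n t x)\<^sup>2 \<partial>\<pi>)"
      by (simp add: int_sq[OF \<Phi>] int_sq[OF \<Psi>])
    also have "\<dots> \<le> (\<integral>x. 2 * B * (\<integral>u. \<bar>\<Phi> (t + r n * u) x - \<Phi> t x\<bar> \<partial>unit_uniform) \<partial>\<pi>)"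
    proof (rule integral_mono)
      show "integrable \<pi> (\<lambda>x. (\<Phi> t x)\<^sup>2 - (\<Psi> n t x)\<^sup>2)"
        by (simp add: int_sq[OF \<Phi>] int_sq[OF \<Psi>])
      have le: "(\<integral>u. \<bar>\<Phi> (t + r n * u) x - \<Phi> t x\<bar> \<partial>unit_uniform) \<le> 2 * B" if x: "x \<in> space M" for x
      proof -
        note [measurable] = flow_measurable_space[OF \<Phi> x]
        have "(\<integral>u. \<bar>\<Phi> (t + r n * u) x - \<Phi> t x\<bar> \<partial>unit_uniform) \<le> (\<integral>u. 2 * B \<partial>unit_uniform)"
          using b[OF x] by (intro integral_mono U.integrable_const_bound[of "\<lambda>u. \<bar>\<Phi> (t + r n * u) x - \<Phi> t x\<bar>" "2 * B"]) auto
        then show ?thesis using U.prob_space by simp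
      qed
      show "integrable \<pi> (\<lambda>x. 2 * B * (\<integral>u. \<bar>\<Phi> (t + r n * u) x - \<Phi> t x\<bar> \<partial>unit_uniform))"
        using le by (intro integrable_mult_right integrable_bounded[of _ "2 * B"]) auto
      fix x assume "x \<in> space \<pi>"
      then have x: "x \<in> space M" by simp
      note [measurable] = flow_measurable_space[OF \<Phi> x]
      have i: "integrable unit_uniform (\<lambda>u. \<Phi> (t + r n * u) x)"
        using flow_bound[OF \<Phi> x] by (intro U.integrable_const_bound[of _ B]) auto
      have "\<Psi> n t x - \<Phi> t x = (\<integral>u. \<Phi> (t + r n * u) x - \<Phi> t x \<partial>unit_uniform)"
        unfolding \<Psi>_def using i U.prob_space by simp
      then have d: "\<bar>\<Psi> n t x - \<Phi> t x\<bar> \<le> (\<integral>u. \<bar>\<Phi> (t + r n * u) x - \<Phi> t x\<bar> \<partial>unit_uniform)"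
        using integral_abs_bound[of unit_uniform "\<lambda>u. \<Phi> (t + r n * u) x - \<Phi> t x"] by simp
      have s: "\<bar>\<Psi> n t x + \<Phi> t x\<bar> \<le> 2 * B"
        using flow_bound[OF \<Phi> x, of t] flow_bound[OF \<Psi>[of n] x, of t] by linarith
      have "(\<Phi> t x)\<^sup>2 - (\<Psi> n t x)\<^sup>2 = - ((\<Psi> n t x + \<Phi> t x) * (\<Psi> n t x - \<Phi> t x))"
        by (simp add: power2_eq_square algebra_simps)
      also have "\<dots> \<le> \<bar>\<Psi> n t x + \<Phi> t x\<bar> * \<bar>\<Psi> n t x - \<Phi> t x\<bar>"
        by (simp only: flip: abs_mult)
      also have "\<dots> \<le> 2 * B * (\<integral>u. \<bar>\<Phi> (t + r n * u) x - \<Phi> t x\<bar> \<partial>unit_uniform)"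
        using order_trans[OF abs_ge_zero s] by (intro mult_mono d s) auto
      finally show "(\<Phi> t x)\<^sup>2 - (\<Psi> n t x)\<^sup>2 \<le> 2 * B * (\<integral>u. \<bar>\<Phi> (t + r n * u) x - \<Phi> t x\<bar> \<partial>unit_uniform)" .
    qed
    also have "\<dots> = 2 * B * V n"
    proof -
      have "(\<integral>x. (\<integral>u. \<bar>\<Phi> (t + r n * u) x - \<Phi> t x\<bar> \<partial>unit_uniform) \<partial>\<pi>) = V n"
        unfolding V_def using b by (intro P.Fubini_bounded[of _ "2 * B"]) auto
      then show ?thesis by simp
    qed
    finally show ?thesis .
  qed
  have "(\<integral>x. (\<Phi> t x)\<^sup>2 \<partial>\<pi>) \<le> exp (- 2 * t / C) * (\<integral>x. (\<Phi> 0 x)\<^sup>2 \<partial>\<pi>) + 2 * B * 0"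
  proof (rule LIMSEQ_le[OF tendsto_const tendsto_add[OF tendsto_const tendsto_mult[OF tendsto_const V]]])
    have "(\<integral>x. (\<Phi> t x)\<^sup>2 \<partial>\<pi>) \<le> exp (- 2 * t / C) * (\<integral>x. (\<Phi> 0 x)\<^sup>2 \<partial>\<pi>) + 2 * B * V n" for n
      using diff[of n] \<Psi>_decay[of n] by linarith
    then show "\<exists>N. \<forall>n\<ge>N. (\<integral>x. (\<Phi> t x)\<^sup>2 \<partial>\<pi>) \<le> exp (- 2 * t / C) * (\<integral>x. (\<Phi> 0 x)\<^sup>2 \<partial>\<pi>) + 2 * B * V n"
      by blast
  qed
  then show ?thesis by simp
qed simp

text \<open>Integrating \<open>F\<close> against \<open>\<nu> \<bind> K t\<close> is integrating the
  evolved function against \<nu>, and evolved centred functions decay by \<open>decay\<close>.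
  Centring \<open>F\<close> and replacing \<open>g\<close> by \<open>g - 1\<close> are free because
  of total masses and stationarity; Cauchy-Schwarz then separates \<open>g - 1\<close> from the
  decaying orbit.\<close>

lemma density_duality_bounded:
  fixes F g k :: "'a \<Rightarrow> real"
  assumes F[measurable]: "F \<in> borel_measurable M" and F_bound: "\<And>x. x \<in> space M \<Longrightarrow> \<bar>F x\<bar> \<le> B"
    and t: "0 \<le> t"
    and \<nu>: "prob_space \<nu>" and g[measurable]: "g \<in> borel_measurable M" and g_nonneg: "\<And>x. 0 \<le> g x"
    and \<nu>_eq: "\<nu> = density \<pi> (\<lambda>x. ennreal (g x))"
    and g_sq: "integrable \<pi> (\<lambda>x. (g x - 1)\<^sup>2)"
    and k[measurable]: "k \<in> borel_measurable M" and k_nonneg: "\<And>x. 0 \<le> k x"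
    and k_eq: "\<nu> \<bind> K t = density \<pi> (\<lambda>x. ennreal (k x))"
  shows "\<bar>\<integral>x. F x * (k x - 1) \<partial>\<pi>\<bar> \<le> sqrt (\<integral>x. (g x - 1)\<^sup>2 \<partial>\<pi>) * exp (- t / C) * sqrt (\<integral>x. (F x)\<^sup>2 \<partial>\<pi>)"
proof -
  interpret \<nu>: prob_space \<nu> by (rule \<nu>)
  have sets_\<nu>[measurable_cong]: "sets \<nu> = sets M" unfolding \<nu>_eq by (simp add: sets_stationary)
  have space_\<nu>: "space \<nu> = space M" by (rule sets_eq_imp_space_eq[OF sets_\<nu>])
  have K\<nu>: "K t \<in> \<nu> \<rightarrow>\<^sub>M subprob_algebra M"
    using measurable_prob_algebraD[OF kernel_time] by (simp cong: measurable_cong_sets add: sets_\<nu>)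
  have \<nu>K: "prob_space (\<nu> \<bind> K t)"
    using sets_\<nu> \<nu> by (intro prob_space_bind'[OF _ kernel_time]) (auto simp: space_prob_algebra)
  have [measurable]: "g \<in> borel_measurable \<pi>" "k \<in> borel_measurable \<pi>"
    by measurable
  have g1: "integrable \<pi> g" "(\<integral>x. g x \<partial>\<pi>) = 1"
    using prob_space_density_integral[of \<pi> g] g_nonneg \<nu> unfolding \<nu>_eq by auto
  have k1: "integrable \<pi> k" "(\<integral>x. k x \<partial>\<pi>) = 1"
    using prob_space_density_integral[of \<pi> k] k_nonneg \<nu>K unfolding k_eq by auto
  define m where "m = (\<integral>x. F x \<partial>\<pi>)"
  define F0 where "F0 x = F x - m" for x
  have [measurable]: "F0 \<in> borel_measurable M" unfolding F0_def by measurable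
  have intF: "integrable \<pi> F" using F_bound by (intro integrable_bounded[of _ B]) auto
  have F0_bound: "\<bar>F0 x\<bar> \<le> B + \<bar>m\<bar>" if "x \<in> space M" for x
    using F_bound[OF that] unfolding F0_def by linarith
  define \<Phi> where "\<Phi> t x = (\<integral>y. F0 y \<partial>K t x)" for t x
  have \<Phi>: "flow \<Phi> (B + \<bar>m\<bar>)"
    unfolding \<Phi>_def using F0_bound by (intro flow_kernel) auto
  note [measurable] = flow_measurable_time[OF \<Phi>]
  have intF0: "(\<integral>x. F0 x \<partial>\<pi>) = 0"
    unfolding F0_def using intF prob_space by (simp add: m_def)
  have stat: "(\<integral>x. \<Phi> s x \<partial>\<pi>) = 0" if "0 \<le> s" for s
    unfolding \<Phi>_def using integral_stationary[of F0, OF _ F0_bound that] intF0 by simp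
  have bounded_mult: "integrable \<pi> (\<lambda>x. h x * f x)"
    if "integrable \<pi> f" "h \<in> borel_measurable M" "\<And>x. x \<in> space M \<Longrightarrow> \<bar>h x\<bar> \<le> B'" for f h :: "'a \<Rightarrow> real" and B'
  proof (rule Bochner_Integration.integrable_bound)
    show "integrable \<pi> (\<lambda>x. B' * f x)" using that by simp
    show "(\<lambda>x. h x * f x) \<in> borel_measurable \<pi>"
      using that(1,2) by (auto cong: measurable_cong_sets simp: sets_stationary)
    show "AE x in \<pi>. norm (h x * f x) \<le> norm (B' * f x)"
      using that(3) by (intro AE_I2) (simp add: abs_mult mult_right_mono order_trans[OF _ abs_ge_self])
  qed
  have intF0k: "integrable \<pi> (\<lambda>x. F0 x * k x)"
    by (rule bounded_mult[OF k1(1) _ F0_bound]) auto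
  \<comment> \<open>The terms in \<open>m\<close> cancel: \<open>k\<close> has integral 1 and
    \<open>m\<close> is the integral of \<open>F\<close>.\<close>
  have "(\<integral>x. F x * (k x - 1) \<partial>\<pi>) = (\<integral>x. F0 x * k x \<partial>\<pi>)"
  proof -
    have "(\<integral>x. F x * (k x - 1) \<partial>\<pi>) = (\<integral>x. F0 x * k x + m * k x - F x \<partial>\<pi>)"
      by (intro Bochner_Integration.integral_cong) (auto simp: F0_def algebra_simps)
    also have "\<dots> = (\<integral>x. F0 x * k x \<partial>\<pi>)"
      using intF0k k1 intF by (simp add: m_def)
    finally show ?thesis .
  qed
  also have "\<dots> = (\<integral>x. F0 x \<partial>(\<nu> \<bind> K t))"
    unfolding k_eq using k_nonneg by (subst integral_density) (auto simp: mult.commute)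
  also have "\<dots> = (\<integral>x. \<Phi> t x \<partial>\<nu>)"
  proof -
    have "AE x in \<nu>. emeasure (K t x) (space (K t x)) \<le> ennreal 1"
      by (intro AE_I2) (auto simp: space_\<nu> prob_space.emeasure_space_1[OF prob_space_kernel])
    then show ?thesis
      unfolding \<Phi>_def using F0_bound K\<nu>
      by (intro integral_bind[where K = M and B' = 1 and B = "B + \<bar>m\<bar>"]) (auto intro: \<nu>.finite_measure_axioms)
  qed
  also have "\<dots> = (\<integral>x. \<Phi> t x * g x \<partial>\<pi>)"
    unfolding \<nu>_eq using g_nonneg by (subst integral_density) (auto simp: mult.commute)
  \<comment> \<open>\<open>\<Phi> t\<close> has \<pi>-mean zero, so subtracting 1 from
    \<open>g\<close> changes nothing.\<close>
  also have "\<dots> = (\<integral>x. (g x - 1) * \<Phi> t x \<partial>\<pi>)"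
  proof -
    have "integrable \<pi> (\<lambda>x. \<Phi> t x * g x)"
      by (rule bounded_mult[OF g1(1) _ flow_bound[OF \<Phi>]]) auto
    moreover have "integrable \<pi> (\<Phi> t)"
      by (rule integrable_bounded[OF _ flow_bound[OF \<Phi>]]) auto
    ultimately have "(\<integral>x. \<Phi> t x * g x - \<Phi> t x \<partial>\<pi>) = (\<integral>x. \<Phi> t x * g x \<partial>\<pi>)"
      using stat[OF t] by simp
    moreover have "(\<integral>x. (g x - 1) * \<Phi> t x \<partial>\<pi>) = (\<integral>x. \<Phi> t x * g x - \<Phi> t x \<partial>\<pi>)"
      by (intro Bochner_Integration.integral_cong) (simp_all add: algebra_simps)
    ultimately show ?thesis by simp
  qed
  finally have eq: "(\<integral>x. F x * (k x - 1) \<partial>\<pi>) = (\<integral>x. (g x - 1) * \<Phi> t x \<partial>\<pi>)" .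
  have b0: "\<bar>F0 x\<bar>\<^sup>2 \<le> (B + \<bar>m\<bar>)\<^sup>2" "\<bar>F x\<bar>\<^sup>2 \<le> B\<^sup>2" "\<bar>\<Phi> s x\<bar>\<^sup>2 \<le> (B + \<bar>m\<bar>)\<^sup>2" if "x \<in> space M" for x s
    by (rule power_mono[OF F0_bound[OF that]], simp, rule power_mono[OF F_bound[OF that]], simp,
        rule power_mono[OF flow_bound[OF \<Phi> that]], simp)
  have intF2: "integrable \<pi> (\<lambda>x. (F x)\<^sup>2)"
    using b0(2) by (intro integrable_bounded[of _ "B\<^sup>2"]) auto
  have "(\<integral>x. (\<Phi> t x)\<^sup>2 \<partial>\<pi>) \<le> exp (- 2 * t / C) * (\<integral>x. (F0 x)\<^sup>2 \<partial>\<pi>)"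
  proof -
    have "(\<integral>x. (\<Phi> t x)\<^sup>2 \<partial>\<pi>) \<le> exp (- 2 * t / C) * (\<integral>x. (\<Phi> 0 x)\<^sup>2 \<partial>\<pi>)"
      by (rule decay[OF \<Phi> stat t]) simp
    \<comment> \<open>\<open>\<Phi> 0\<close> is \<open>F0\<close> evolved by \<open>K 0\<close>,
      which may differ from the identity; Jensen and stationarity still compare the mean
      squares.\<close>
    also have "(\<integral>x. (\<Phi> 0 x)\<^sup>2 \<partial>\<pi>) \<le> (\<integral>x. \<integral>y. (F0 y)\<^sup>2 \<partial>K 0 x \<partial>\<pi>)"
    proof (rule integral_mono)
      show "integrable \<pi> (\<lambda>x. (\<Phi> 0 x)\<^sup>2)"
        using b0(3) by (intro integrable_bounded[of _ "(B + \<bar>m\<bar>)\<^sup>2"]) auto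
      show "integrable \<pi> (\<lambda>x. \<integral>y. (F0 y)\<^sup>2 \<partial>K 0 x)"
        using b0(1) by (intro integrable_bounded[of _ "(B + \<bar>m\<bar>)\<^sup>2"] integral_kernel_measurable_time abs_integral_kernel_le) auto
      fix x assume "x \<in> space \<pi>"
      then have x: "x \<in> space M" by simp
      interpret Kx: prob_space "K 0 x" by (rule prob_space_kernel[OF x])
      note [measurable_cong] = sets_kernel[OF x]
      show "(\<Phi> 0 x)\<^sup>2 \<le> (\<integral>y. (F0 y)\<^sup>2 \<partial>K 0 x)"
        unfolding \<Phi>_def using F0_bound by (intro Kx.square_integral_le[of _ "B + \<bar>m\<bar>"]) (auto simp: space_kernel[OF x])
    qed
    also have "\<dots> = (\<integral>x. (F0 x)\<^sup>2 \<partial>\<pi>)"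
      using b0(1) by (intro integral_stationary[of _ "(B + \<bar>m\<bar>)\<^sup>2"]) auto
    finally show ?thesis by simp
  qed
  also have "(\<integral>x. (F0 x)\<^sup>2 \<partial>\<pi>) \<le> (\<integral>x. (F x)\<^sup>2 \<partial>\<pi>)"
  proof -
    have "(\<integral>x. (F0 x)\<^sup>2 \<partial>\<pi>) = (\<integral>x. (F x)\<^sup>2 - 2 * m * F x + m\<^sup>2 \<partial>\<pi>)"
      by (intro Bochner_Integration.integral_cong) (auto simp: F0_def power2_eq_square algebra_simps)
    also have "\<dots> = (\<integral>x. (F x)\<^sup>2 \<partial>\<pi>) - m\<^sup>2"
      using intF2 intF prob_space by (simp add: m_def power2_eq_square)
    finally show ?thesis by simp
  qed
  finally have "(\<integral>x. (\<Phi> t x)\<^sup>2 \<partial>\<pi>) \<le> exp (- 2 * t / C) * (\<integral>x. (F x)\<^sup>2 \<partial>\<pi>)" by simp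
  then have "sqrt (\<integral>x. (\<Phi> t x)\<^sup>2 \<partial>\<pi>) \<le> sqrt (exp (- t / C) * exp (- t / C) * (\<integral>x. (F x)\<^sup>2 \<partial>\<pi>))"
    by (simp add: exp_add[symmetric])
  then have "sqrt (\<integral>x. (\<Phi> t x)\<^sup>2 \<partial>\<pi>) \<le> exp (- t / C) * sqrt (\<integral>x. (F x)\<^sup>2 \<partial>\<pi>)"
    by (simp add: real_sqrt_mult)
  then have "sqrt (\<integral>x. (g x - 1)\<^sup>2 \<partial>\<pi>) * sqrt (\<integral>x. (\<Phi> t x)\<^sup>2 \<partial>\<pi>)
      \<le> sqrt (\<integral>x. (g x - 1)\<^sup>2 \<partial>\<pi>) * (exp (- t / C) * sqrt (\<integral>x. (F x)\<^sup>2 \<partial>\<pi>))"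
    by (intro mult_left_mono) auto
  moreover have "\<bar>\<integral>x. (g x - 1) * \<Phi> t x \<partial>\<pi>\<bar> \<le> sqrt (\<integral>x. (g x - 1)\<^sup>2 \<partial>\<pi>) * sqrt (\<integral>x. (\<Phi> t x)\<^sup>2 \<partial>\<pi>)"
    using b0(3) by (intro Cauchy_Schwarz_integral g_sq integrable_bounded[of "\<lambda>x. (\<Phi> t x)\<^sup>2" "(B + \<bar>m\<bar>)\<^sup>2"]) auto
  ultimately show ?thesis unfolding eq by (simp add: mult.assoc)
qed

text \<open>The test function \<open>sgn (k x - 1) * w x\<close> turns the pairing with
  \<open>k - 1\<close> into a weighted L1 norm. As it may be unbounded, \<open>w\<close> is cut at
  level \<open>n\<close>, where its mean square is at most that of \<open>w\<close>, and Fatou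
  removes the cut.\<close>

lemma density_duality:
  fixes w g k :: "'a \<Rightarrow> real"
  assumes w[measurable]: "w \<in> borel_measurable M" and w_nonneg: "\<And>x. 0 \<le> w x"
    and w_sq: "integrable \<pi> (\<lambda>x. (w x)\<^sup>2)"
    and t: "0 \<le> t"
    and \<nu>: "prob_space \<nu>" and g: "g \<in> borel_measurable M" and g_nonneg: "\<And>x. 0 \<le> g x"
    and \<nu>_eq: "\<nu> = density \<pi> (\<lambda>x. ennreal (g x))"
    and g_sq: "integrable \<pi> (\<lambda>x. (g x - 1)\<^sup>2)"
    and k[measurable]: "k \<in> borel_measurable M" and k_nonneg: "\<And>x. 0 \<le> k x"
    and k_eq: "\<nu> \<bind> K t = density \<pi> (\<lambda>x. ennreal (k x))"
  shows "(\<integral>\<^sup>+x. ennreal (w x * \<bar>k x - 1\<bar>) \<partial>\<pi>)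
    \<le> ennreal (sqrt (\<integral>x. (g x - 1)\<^sup>2 \<partial>\<pi>) * exp (- t / C) * sqrt (\<integral>x. (w x)\<^sup>2 \<partial>\<pi>))"
proof -
  let ?c = "sqrt (\<integral>x. (g x - 1)\<^sup>2 \<partial>\<pi>) * exp (- t / C)"
  define F where "F n x = sgn (k x - 1) * min (w x) (real n)" for n x
  have [measurable]: "F n \<in> borel_measurable M" for n unfolding F_def by measurable
  have F_abs: "\<bar>F n x\<bar> \<le> min (w x) (real n)" for n x
    using w_nonneg[of x] by (auto simp: F_def abs_mult sgn_if)
  have F_mult: "F n x * (k x - 1) = min (w x) (real n) * \<bar>k x - 1\<bar>" for n x
    by (auto simp: F_def sgn_if)
  have F_sq: "(F n x)\<^sup>2 \<le> (w x)\<^sup>2" for n x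
    using power_mono[OF order_trans[OF F_abs min.cobounded1], of n x 2] by simp
  have k_int: "integrable \<pi> k"
  proof -
    have "prob_space (\<nu> \<bind> K t)"
    proof (rule prob_space_bind'[OF _ kernel_time])
      show "\<nu> \<in> space (prob_algebra M)"
        using \<nu> unfolding \<nu>_eq by (simp add: space_prob_algebra sets_stationary)
    qed
    then show ?thesis
      using prob_space_density_integral(1)[of \<pi> k] k_nonneg by (simp add: k_eq)
  qed
  have bound: "(\<integral>\<^sup>+x. ennreal (min (w x) (real n) * \<bar>k x - 1\<bar>) \<partial>\<pi>) \<le> ennreal (?c * sqrt (\<integral>x. (w x)\<^sup>2 \<partial>\<pi>))" for n
  proof -
    have Fn: "\<bar>F n x\<bar> \<le> real n" for x using F_abs[of n x] by simp
    have int: "integrable \<pi> (\<lambda>x. F n x * (k x - 1))"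
    proof (rule Bochner_Integration.integrable_bound)
      show "integrable \<pi> (\<lambda>x. real n * (k x - 1))" using k_int by simp
      show "AE x in \<pi>. norm (F n x * (k x - 1)) \<le> norm (real n * (k x - 1))"
        using Fn by (intro AE_I2) (auto simp: abs_mult intro!: mult_right_mono)
    qed measurable
    have "(\<integral>\<^sup>+x. ennreal (min (w x) (real n) * \<bar>k x - 1\<bar>) \<partial>\<pi>) = ennreal (\<integral>x. F n x * (k x - 1) \<partial>\<pi>)"
      unfolding F_mult[symmetric]
      by (rule nn_integral_eq_integral[OF int]) (auto simp: F_mult w_nonneg)
    also have "(\<integral>x. F n x * (k x - 1) \<partial>\<pi>) \<le> ?c * sqrt (\<integral>x. (F n x)\<^sup>2 \<partial>\<pi>)"
      by (rule order_trans[OF abs_ge_self density_duality_bounded[OF _ Fn t \<nu> g g_nonneg \<nu>_eq g_sq k k_nonneg k_eq]]) measurable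
    also have "\<dots> \<le> ?c * sqrt (\<integral>x. (w x)\<^sup>2 \<partial>\<pi>)"
    proof (intro mult_left_mono real_sqrt_le_mono integral_mono)
      show "integrable \<pi> (\<lambda>x. (F n x)\<^sup>2)"
        using power_mono[OF Fn, where n = 2] by (intro integrable_bounded[of _ "(real n)\<^sup>2"]) auto
    qed (use F_sq w_sq in auto)
    finally show ?thesis by (simp add: ennreal_leI)
  qed
  have "(\<integral>\<^sup>+x. ennreal (w x * \<bar>k x - 1\<bar>) \<partial>\<pi>)
      = (\<integral>\<^sup>+x. liminf (\<lambda>n. ennreal (min (w x) (real n) * \<bar>k x - 1\<bar>)) \<partial>\<pi>)"
  proof (rule nn_integral_cong)
    fix x
    obtain N :: nat where N: "w x \<le> real N" using real_arch_simple by blast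
    have "\<forall>\<^sub>F n in sequentially. ennreal (w x * \<bar>k x - 1\<bar>) = ennreal (min (w x) (real n) * \<bar>k x - 1\<bar>)"
      using N by (intro eventually_sequentiallyI[of N]) (simp add: min_def)
    then have "(\<lambda>n. ennreal (min (w x) (real n) * \<bar>k x - 1\<bar>)) \<longlonglongrightarrow> ennreal (w x * \<bar>k x - 1\<bar>)"
      by (rule tendsto_eventually[OF eventually_mono]) simp
    then show "ennreal (w x * \<bar>k x - 1\<bar>) = liminf (\<lambda>n. ennreal (min (w x) (real n) * \<bar>k x - 1\<bar>))"
      by (simp add: lim_imp_Liminf)
  qed
  also have "\<dots> \<le> liminf (\<lambda>n. \<integral>\<^sup>+x. ennreal (min (w x) (real n) * \<bar>k x - 1\<bar>) \<partial>\<pi>)"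
    by (rule nn_integral_liminf) measurable
  also have "\<dots> \<le> ennreal (?c * sqrt (\<integral>x. (w x)\<^sup>2 \<partial>\<pi>))"
    by (rule order_trans[OF Liminf_mono[OF always_eventually[OF allI[OF bound]]]]) (simp add: Liminf_const)
  finally show ?thesis .
qed

end

section \<open>Coupling with a density\<close>

text \<open>In a non-separable space the product \<open>\<sigma>\<close>-algebra may be smaller than the Borel sets of the product.
  Borel sections of open sets have lower semicontinuous measure, so iterated integration still is.\<close>

lemma emeasure_section_lower_semicontinuous:
  fixes q :: "'a::metric_space measure" and A :: "('a \<times> 'a) set"
  assumes sets_q[measurable_cong]: "sets q = sets borel" and A: "open A"
  shows "open {x. a < emeasure q (Pair x -` A)}"
  unfolding open_dist
proof (intro ballI)
  fix x assume "x \<in> {x. a < emeasure q (Pair x -` A)}"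
  then have x: "a < emeasure q (Pair x -` A)" by simp
  show "\<exists>e>0. \<forall>y. dist y x < e \<longrightarrow> y \<in> {x. a < emeasure q (Pair x -` A)}"
  \<comment> \<open>\<open>infdist\<close> to the empty set is 0 by convention, so measuring the
    distance to the complement of \<open>A\<close> requires that complement to be nonempty.\<close>
  proof (cases "A = UNIV")
    case True
    then show ?thesis using x by (intro exI[of _ 1]) simp
  next
    case False
    then have ne: "- A \<noteq> {}" by auto
    \<comment> \<open>The points \<open>y\<close> for which \<open>(x, y)\<close> keeps distance at
      least 1/(n + 1) from the complement of \<open>A\<close>. These closed sets increase to the
      section at \<open>x\<close>, and the n-th one lies in the section at every point closer to
      \<open>x\<close> than 1/(n + 1). A single \<open>n\<close> of large enough mass thus settles a
      whole neighbourhood of \<open>x\<close>.\<close>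
    define C where "C n = {y. inverse (real (Suc n)) \<le> infdist (x, y) (- A)}" for n
    have C_closed: "closed (C n)" for n
      unfolding C_def by (intro closed_Collect_le continuous_intros)
    have [measurable]: "C n \<in> sets q" for n
      using borel_closed[OF C_closed] by (simp add: sets_q)
    have "(\<Union>n. C n) = Pair x -` A"
    proof (intro equalityI subsetI)
      fix y assume "y \<in> (\<Union>n. C n)"
      then obtain n where "inverse (real (Suc n)) \<le> infdist (x, y) (- A)" by (auto simp: C_def)
      moreover have "0 < inverse (real (Suc n))" by simp
      ultimately have "infdist (x, y) (- A) \<noteq> 0" by linarith
      then show "y \<in> Pair x -` A"
        using in_closed_iff_infdist_zero[of "- A" "(x, y)"] A ne by auto
    next
      fix y assume "y \<in> Pair x -` A"
      then have "0 < infdist (x, y) (- A)"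
        using in_closed_iff_infdist_zero[of "- A" "(x, y)"] A ne infdist_nonneg[of "(x, y)" "- A"]
        by (auto simp: less_le)
      then obtain n where "inverse (real (Suc n)) < infdist (x, y) (- A)"
        using reals_Archimedean by blast
      then show "y \<in> (\<Union>n. C n)" by (auto simp: C_def intro: less_imp_le)
    qed
    moreover have "incseq C"
    proof (intro incseq_SucI subsetI)
      fix n y assume y: "y \<in> C n"
      have "inverse (real (Suc (Suc n))) \<le> inverse (real (Suc n))"
        by (intro le_imp_inverse_le) auto
      then show "y \<in> C (Suc n)" using y unfolding C_def by (blast intro: order_trans)
    qed
    ultimately have "(SUP n. emeasure q (C n)) = emeasure q (Pair x -` A)"
      by (subst SUP_emeasure_incseq) auto
    with x have "a < (SUP n. emeasure q (C n))" by simp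
    then obtain n where n: "a < emeasure q (C n)" unfolding less_SUP_iff by blast
    have "C n \<subseteq> Pair y -` A" if "dist y x < inverse (real (Suc n))" for y
    proof
      fix z assume "z \<in> C n"
      then have z: "inverse (real (Suc n)) \<le> infdist (x, z) (- A)" by (simp add: C_def)
      show "z \<in> Pair y -` A"
      proof (rule ccontr)
        assume "z \<notin> Pair y -` A"
        then have "infdist (x, z) (- A) \<le> dist (x, z) (y, z)" by (intro infdist_le) auto
        also have "\<dots> = dist y x" by (simp add: dist_Pair_Pair dist_commute)
        finally show False using z that by linarith
      qed
    qed
    moreover have "Pair y -` A \<in> sets q" for y
    proof -
      have "open (Pair y -` A)" by (intro open_vimage[OF A] continuous_intros)
      then show ?thesis by (simp add: sets_q)
    qed
    ultimately have "a < emeasure q (Pair y -` A)" if "dist y x < inverse (real (Suc n))" for y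
      using less_le_trans[OF n emeasure_mono] that by blast
    then show ?thesis by (intro exI[of _ "inverse (real (Suc n))"]) auto
  qed
qed

text \<open>Open sets form an intersection-stable generator of the Borel sets, and on them the
  section measures are lower semicontinuous. The kernel supplies the redrawn part of the coupling in
  \<open>W1_density_le\<close>.\<close>

lemma measurable_distr_Pair:
  fixes q :: "'a::metric_space measure"
  assumes q: "prob_space q" and sets_q[measurable_cong]: "sets q = sets borel"
  shows "(\<lambda>x. distr q (borel :: ('a \<times> 'a) measure) (Pair x)) \<in> borel \<rightarrow>\<^sub>M prob_algebra borel"
proof -
  have [measurable]: "Pair x \<in> q \<rightarrow>\<^sub>M borel" for x :: 'a
  proof -
    have "Pair x \<in> borel \<rightarrow>\<^sub>M borel"
      by (intro borel_measurable_continuous_onI continuous_intros)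
    then show ?thesis by (simp cong: measurable_cong_sets add: sets_q)
  qed
  show ?thesis
  proof (rule measurable_prob_algebra_generated[where G = "{S. open S}" and \<Omega> = UNIV])
    show "sets borel = sigma_sets UNIV {S::('a \<times> 'a) set. open S}"
      unfolding borel_def by (simp add: sets_measure_of)
    show "Int_stable {S::('a \<times> 'a) set. open S}"
      by (auto simp: Int_stable_def)
    show "prob_space (distr q borel (Pair x))" for x :: 'a
      by (rule prob_space.prob_space_distr[OF q]) measurable
    show "(\<lambda>x. emeasure (distr q borel (Pair x)) A) \<in> borel_measurable borel"
      if "A \<in> {S. open S}" for A :: "('a \<times> 'a) set"
    proof (rule borel_measurableI_greater)
      have space_q: "space q = UNIV" using sets_eq_imp_space_eq[OF sets_q] by simp
      have eq: "emeasure (distr q borel (Pair x)) A = emeasure q (Pair x -` A)" for x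
        using that by (subst emeasure_distr) (auto simp: space_q)
      show "{x \<in> space borel. a < emeasure (distr q borel (Pair x)) A} \<in> sets borel" for a
        unfolding eq using emeasure_section_lower_semicontinuous[OF sets_q, of A a] that
        by (simp add: borel_open)
    qed
  qed auto
qed

text \<open>Comparing a uniform variable with \<theta> is a biased coin: a mixture of two kernels
  then arises from a measurable case distinction and a \<open>bind\<close>.\<close>

lemma nn_integral_unit_uniform_threshold:
  assumes "0 \<le> \<theta>" "\<theta> \<le> 1"
  shows "(\<integral>\<^sup>+u. (if u \<le> \<theta> then a else b) \<partial>unit_uniform) = ennreal \<theta> * a + ennreal (1 - \<theta>) * b"
proof -
  have "(\<integral>\<^sup>+u. (if u \<le> \<theta> then a else b) \<partial>unit_uniform)
      = (\<integral>\<^sup>+u. a * indicator {..\<theta>} u + b * indicator {\<theta><..} u \<partial>unit_uniform)"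
    by (intro nn_integral_cong) (auto split: split_indicator)
  also have "\<dots> = a * emeasure unit_uniform {..\<theta>} + b * emeasure unit_uniform {\<theta><..}"
    by (subst nn_integral_add) (auto simp: nn_integral_cmult)
  also have "emeasure unit_uniform {..\<theta>} = ennreal \<theta>"
  proof -
    have "{0..1} \<inter> {..\<theta>} = {0..\<theta>}" using assms by auto
    then show ?thesis using assms by (simp add: divide_ennreal_def)
  qed
  also have "emeasure unit_uniform {\<theta><..} = ennreal (1 - \<theta>)"
  proof -
    have "{0..1} \<inter> {\<theta><..} = {\<theta><..1}" using assms by auto
    then show ?thesis using assms by (simp add: divide_ennreal_def)
  qed
  finally show ?thesis by (simp add: mult.commute)
qed

text \<open>The maximal coupling: a point drawn from the density \<open>h\<close> is kept with probability \<open>min 1 (1 / h)\<close>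
  and otherwise replaced by a draw from the normalised deficit \<open>(1 - h)\<^sup>+\<close>.\<close>

lemma W1_density_le:
  fixes \<alpha> :: "'a::metric_space measure" and h :: "'a \<Rightarrow> real" and x\<^sub>0 :: 'a
  assumes \<alpha>: "prob_space \<alpha>" and sets_\<alpha>[measurable_cong]: "sets \<alpha> = sets borel"
    and h[measurable]: "h \<in> borel_measurable borel" and h_nonneg: "\<And>x. 0 \<le> h x"
    and p: "prob_space (density \<alpha> (\<lambda>x. ennreal (h x)))"
  shows "W1 (density \<alpha> (\<lambda>x. ennreal (h x))) \<alpha> \<le> (\<integral>\<^sup>+x. ennreal (dist x x\<^sub>0 * \<bar>h x - 1\<bar>) \<partial>\<alpha>)"
proof -
  interpret prob_space \<alpha> by (rule \<alpha>)
  have space_\<alpha>[simp]: "space \<alpha> = UNIV" using sets_eq_imp_space_eq[OF sets_\<alpha>] by simp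
  define p where "p = density \<alpha> (\<lambda>x. ennreal (h x))"
  have sets_p[measurable_cong]: "sets p = sets borel" by (simp add: p_def sets_\<alpha>)
  \<comment> \<open>\<open>Q\<close>, \<open>N\<close> and \<open>m\<close> are the excess of
    \<open>h\<close> over 1, its deficit, and the part common to \<open>h\<close> and 1. Excess and
    deficit have the same mass \<delta>, because \<open>h\<close> and 1 both integrate to 1.\<close>
  define Q where "Q x = ennreal (max 0 (h x - 1))" for x
  define N where "N x = ennreal (max 0 (1 - h x))" for x
  define m where "m x = ennreal (min 1 (h x))" for x
  have [measurable]: "Q \<in> borel_measurable borel" "N \<in> borel_measurable borel" "m \<in> borel_measurable borel"
    unfolding Q_def N_def m_def by measurable
  have mQ: "m x + Q x = ennreal (h x)" and mN: "m x + N x = 1" for x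
    using h_nonneg[of x] by (auto simp: m_def Q_def N_def min_def max_def simp flip: ennreal_plus ennreal_1)
  have [measurable]: "(\<lambda>x. ennreal (h x)) \<in> borel_measurable \<alpha>" by measurable
  have h1: "(\<integral>\<^sup>+x. ennreal (h x) \<partial>\<alpha>) = 1"
    by (rule prob_space_density_nn_integral[OF p]) measurable
  define \<delta> where "\<delta> = (\<integral>\<^sup>+x. N x \<partial>\<alpha>)"
  have "(\<integral>\<^sup>+x. m x \<partial>\<alpha>) + (\<integral>\<^sup>+x. Q x \<partial>\<alpha>) = 1"
    using h1 by (subst nn_integral_add[symmetric]) (auto simp: mQ)
  moreover have mN1: "(\<integral>\<^sup>+x. m x \<partial>\<alpha>) + \<delta> = 1"
    unfolding \<delta>_def using emeasure_space_1 by (subst nn_integral_add[symmetric]) (auto simp: mN)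
  ultimately have \<delta>_Q: "(\<integral>\<^sup>+x. Q x \<partial>\<alpha>) = \<delta>"
    by (metis ennreal_add_left_cancel ennreal_add_eq_top ennreal_one_neq_top)
  have \<delta>_fin: "\<delta> \<noteq> \<infinity>" using mN1 by (metis ennreal_add_eq_top ennreal_one_neq_top infinity_ennreal_def)
  have diag[measurable]: "(\<lambda>x. (x, x)) \<in> borel \<rightarrow>\<^sub>M (borel :: ('a \<times> 'a) measure)"
    and fst[measurable]: "fst \<in> (borel :: ('a \<times> 'a) measure) \<rightarrow>\<^sub>M borel"
    and snd[measurable]: "snd \<in> (borel :: ('a \<times> 'a) measure) \<rightarrow>\<^sub>M borel"
    by (intro borel_measurable_continuous_onI continuous_intros)+
  have [measurable]: "(\<lambda>z::'a \<times> 'a. dist (fst z) (snd z)) \<in> borel_measurable borel"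
    by (intro borel_measurable_continuous_onI continuous_intros)
  then have d: "(\<lambda>z::'a \<times> 'a. ennreal (dist (fst z) (snd z))) \<in> borel_measurable borel"
    by (rule measurable_compose[OF _ measurable_ennreal])
  have d1[measurable]: "(\<lambda>x::'a. dist x x\<^sub>0) \<in> borel_measurable borel"
    by (intro borel_measurable_continuous_onI continuous_intros)
  show ?thesis
  \<comment> \<open>If there is no deficit to normalise, \<open>h\<close> is 1 almost everywhere and
    the diagonal coupling has cost 0.\<close>
  proof (cases "\<delta> = 0")
    case True
    then have "AE x in \<alpha>. N x = 0" "AE x in \<alpha>. Q x = 0"
      using \<delta>_Q nn_integral_0_iff_AE[of N \<alpha>] nn_integral_0_iff_AE[of Q \<alpha>] by (simp_all add: \<delta>_def)
    then have "AE x in \<alpha>. ennreal (h x) = 1"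
    proof eventually_elim
      case (elim x)
      then show ?case using mQ[of x] mN[of x] by simp
    qed
    then have "p = density \<alpha> (\<lambda>x. 1)"
      unfolding p_def by (intro density_cong) auto
    then have p_\<alpha>: "p = \<alpha>" by (simp add: density_1)
    have "distr \<alpha> borel (\<lambda>x. (x, x)) \<in> couplings \<alpha> \<alpha>"
      unfolding couplings_def
      by (auto intro!: prob_space_distr simp: distr_distr comp_def distr_id2 sets_\<alpha>)
    then have "W1 \<alpha> \<alpha> \<le> (\<integral>\<^sup>+z. ennreal (dist (fst z) (snd z)) \<partial>distr \<alpha> borel (\<lambda>x. (x, x)))"
      unfolding W1_def by (rule INF_lower)
    also have "\<dots> = 0" by (subst nn_integral_distr) auto
    finally show ?thesis using p_\<alpha> by (simp add: p_def)
  next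
    case False
    define q where "q = density \<alpha> (\<lambda>x. N x / \<delta>)"
    have sets_q[measurable_cong]: "sets q = sets borel" by (simp add: q_def sets_\<alpha>)
    have q: "prob_space q"
    proof
      have "emeasure q (space q) = (\<integral>\<^sup>+x. N x / \<delta> \<partial>\<alpha>)"
        unfolding q_def by (subst emeasure_density) auto
      also have "\<dots> = 1"
        using False \<delta>_fin by (simp add: nn_integral_divide ennreal_divide_self less_top flip: \<delta>_def)
      finally show "emeasure q (space q) = 1" .
    qed
    \<comment> \<open>Where \<open>h x = 0\<close> the quotient is 0 by convention and so is
      \<open>\<theta> x\<close>; the identities that express \<open>m x\<close> and
      \<open>Q x\<close> as \<open>h x * \<theta> x\<close> and
      \<open>h x * (1 - \<theta> x)\<close> hold there too.\<close>
    define \<theta> where "\<theta> x = min 1 (1 / h x)" for x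
    have [measurable]: "\<theta> \<in> borel_measurable borel" unfolding \<theta>_def by measurable
    have \<theta>: "0 \<le> \<theta> x" "\<theta> x \<le> 1" for x using h_nonneg[of x] by (auto simp: \<theta>_def)
    define R where "R x u = (if u \<le> \<theta> x then return borel (x, x) else distr q borel (Pair x))" for x u
    have R: "(\<lambda>(x, u). R x u) \<in> borel \<Otimes>\<^sub>M borel \<rightarrow>\<^sub>M prob_algebra borel"
    proof -
      note [measurable] = measurable_distr_Pair[OF q sets_q]
      have [measurable]: "(\<lambda>x::'a. return borel (x, x)) \<in> borel \<rightarrow>\<^sub>M prob_algebra borel"
        by (rule measurable_compose[OF diag measurable_return_prob_space])
      show ?thesis unfolding R_def case_prod_beta' by measurable
    qed
    define L where "L x = unit_uniform \<bind> R x" for x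
    have U: "(\<lambda>x. unit_uniform) \<in> (borel :: 'a measure) \<rightarrow>\<^sub>M prob_algebra borel"
      by (intro measurable_const) (simp add: space_prob_algebra prob_space_unit_uniform)
    have L: "L \<in> borel \<rightarrow>\<^sub>M prob_algebra borel"
      unfolding L_def by (rule measurable_bind_prob_space2[OF U R])
    have R1: "R x \<in> borel \<rightarrow>\<^sub>M prob_algebra borel" for x
      using measurable_compose[OF measurable_Pair1' R, of x] by simp
    define \<gamma> where "\<gamma> = p \<bind> L"
    have p_space: "p \<in> space (prob_algebra borel)"
      using p by (simp add: space_prob_algebra sets_p p_def[symmetric])
    have \<gamma>_prob: "prob_space \<gamma>"
      unfolding \<gamma>_def by (rule prob_space_bind'[OF p_space L])
    have \<gamma>_sets: "sets \<gamma> = sets borel"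
      unfolding \<gamma>_def by (rule sets_bind'[OF p_space L])
    \<comment> \<open>The common part stays on the diagonal and the excess at \<open>x\<close> is
      paired with a draw from \<open>q\<close>. Both marginals and the transport cost are read off
      this formula.\<close>
    have \<gamma>: "(\<integral>\<^sup>+z. F z \<partial>\<gamma>) = (\<integral>\<^sup>+x. m x * F (x, x) + Q x * (\<integral>\<^sup>+y. F (x, y) \<partial>q) \<partial>\<alpha>)"
      if F[measurable]: "F \<in> borel_measurable borel" for F :: "'a \<times> 'a \<Rightarrow> ennreal"
    proof -
      have Pair[measurable]: "Pair x \<in> q \<rightarrow>\<^sub>M borel" for x :: 'a
      proof -
        have "Pair x \<in> borel \<rightarrow>\<^sub>M borel"
          by (intro borel_measurable_continuous_onI continuous_intros)
        then show ?thesis by (simp cong: measurable_cong_sets add: sets_q)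
      qed
      have inner: "(\<integral>\<^sup>+z. F z \<partial>L x) = ennreal (\<theta> x) * F (x, x) + ennreal (1 - \<theta> x) * (\<integral>\<^sup>+y. F (x, y) \<partial>q)" for x
      proof -
        have "(\<integral>\<^sup>+z. F z \<partial>L x) = (\<integral>\<^sup>+u. \<integral>\<^sup>+z. F z \<partial>R x u \<partial>unit_uniform)"
          unfolding L_def using measurable_prob_algebraD[OF R1]
          by (intro nn_integral_bind[of _ borel]) (auto cong: measurable_cong_sets)
        also have "\<dots> = (\<integral>\<^sup>+u. (if u \<le> \<theta> x then F (x, x) else \<integral>\<^sup>+y. F (x, y) \<partial>q) \<partial>unit_uniform)"
          by (intro nn_integral_cong) (auto simp: R_def nn_integral_return nn_integral_distr)
        finally show ?thesis using nn_integral_unit_uniform_threshold[OF \<theta>] by simp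
      qed
      have "(\<lambda>x. \<integral>\<^sup>+z. F z \<partial>distr q borel (Pair x)) \<in> borel_measurable borel"
        by (rule measurable_compose[OF measurable_prob_algebraD[OF measurable_distr_Pair[OF q sets_q]]
              nn_integral_measurable_subprob_algebra[OF F]])
      then have [measurable]: "(\<lambda>x. \<integral>\<^sup>+y. F (x, y) \<partial>q) \<in> borel_measurable borel"
        by (simp add: nn_integral_distr)
      have [measurable]: "(\<lambda>x. F (x, x)) \<in> borel_measurable borel"
        by (rule measurable_compose[OF diag F])
      have "(\<integral>\<^sup>+z. F z \<partial>\<gamma>) = (\<integral>\<^sup>+x. \<integral>\<^sup>+z. F z \<partial>L x \<partial>p)"
        unfolding \<gamma>_def using measurable_prob_algebraD[OF L]
        by (intro nn_integral_bind[of _ borel]) (auto cong: measurable_cong_sets simp: sets_p)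
      also have "\<dots> = (\<integral>\<^sup>+x. ennreal (h x) * (ennreal (\<theta> x) * F (x, x) + ennreal (1 - \<theta> x) * (\<integral>\<^sup>+y. F (x, y) \<partial>q)) \<partial>\<alpha>)"
        unfolding inner p_def by (subst nn_integral_density) auto
      also have "\<dots> = (\<integral>\<^sup>+x. m x * F (x, x) + Q x * (\<integral>\<^sup>+y. F (x, y) \<partial>q) \<partial>\<alpha>)"
      proof (rule nn_integral_cong)
        fix x
        have "h x * \<theta> x = min 1 (h x)" "h x * (1 - \<theta> x) = max 0 (h x - 1)"
          using h_nonneg[of x] by (cases "h x = 0"; auto simp: \<theta>_def min_def max_def field_simps)+
        then have "ennreal (h x) * ennreal (\<theta> x) = m x" "ennreal (h x) * ennreal (1 - \<theta> x) = Q x"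
          using h_nonneg[of x] \<theta>[of x] by (simp_all add: m_def Q_def flip: ennreal_mult)
        then show "ennreal (h x) * (ennreal (\<theta> x) * F (x, x) + ennreal (1 - \<theta> x) * (\<integral>\<^sup>+y. F (x, y) \<partial>q))
            = m x * F (x, x) + Q x * (\<integral>\<^sup>+y. F (x, y) \<partial>q)"
          by (simp add: distrib_left flip: mult.assoc)
      qed
      finally show ?thesis .
    qed
    have Q_div: "\<delta> * (N x / \<delta>) = N x" for x
      using False \<delta>_fin by (simp add: ennreal_times_divide mult.commute[of \<delta>] mult_divide_eq_ennreal)
    have nn_q: "(\<integral>\<^sup>+y. f y \<partial>q) * \<delta> = (\<integral>\<^sup>+y. N y * f y \<partial>\<alpha>)"
      if [measurable]: "f \<in> borel_measurable borel" for f
    proof -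
      have "(\<integral>\<^sup>+y. f y \<partial>q) * \<delta> = (\<integral>\<^sup>+y. \<delta> * ((N y / \<delta>) * f y) \<partial>\<alpha>)"
        unfolding q_def by (subst nn_integral_density) (auto simp: nn_integral_cmult mult.commute)
      then show ?thesis by (simp add: Q_div flip: mult.assoc)
    qed
    have "\<gamma> \<in> couplings p \<alpha>"
      unfolding couplings_def
    proof (intro CollectI conjI measure_eqI)
      fix A assume "A \<in> sets (distr \<gamma> borel fst)"
      then have [measurable]: "A \<in> sets borel" by simp
      have "emeasure (distr \<gamma> borel fst) A = (\<integral>\<^sup>+z. indicator A (fst z) \<partial>\<gamma>)"
        by (subst nn_integral_distr[symmetric, where T = fst and M' = borel and f = "indicator A"])
          (auto simp: \<gamma>_sets cong: measurable_cong_sets)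
      also have "\<dots> = (\<integral>\<^sup>+x. m x * indicator A x + Q x * (\<integral>\<^sup>+y. indicator A x \<partial>q) \<partial>\<alpha>)"
        by (subst \<gamma>) auto
      also have "\<dots> = (\<integral>\<^sup>+x. ennreal (h x) * indicator A x \<partial>\<alpha>)"
        using prob_space.emeasure_space_1[OF q] by (intro nn_integral_cong) (simp add: distrib_right flip: mQ)
      also have "\<dots> = emeasure p A"
        unfolding p_def by (subst emeasure_density) auto
      finally show "emeasure (distr \<gamma> borel fst) A = emeasure p A" .
    next
      fix A assume "A \<in> sets (distr \<gamma> borel snd)"
      then have [measurable]: "A \<in> sets borel" by simp
      have "emeasure (distr \<gamma> borel snd) A = (\<integral>\<^sup>+z. indicator A (snd z) \<partial>\<gamma>)"
        by (subst nn_integral_distr[symmetric, where T = snd and M' = borel and f = "indicator A"])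
          (auto simp: \<gamma>_sets cong: measurable_cong_sets)
      also have "\<dots> = (\<integral>\<^sup>+x. m x * indicator A x + Q x * (\<integral>\<^sup>+y. indicator A y \<partial>q) \<partial>\<alpha>)"
        by (subst \<gamma>) auto
      also have "\<dots> = (\<integral>\<^sup>+x. m x * indicator A x \<partial>\<alpha>) + \<delta> * (\<integral>\<^sup>+y. indicator A y \<partial>q)"
        by (subst nn_integral_add) (auto simp: nn_integral_multc \<delta>_Q)
      also have "\<dots> = (\<integral>\<^sup>+x. m x * indicator A x + N x * indicator A x \<partial>\<alpha>)"
        using nn_q[of "indicator A"] by (subst nn_integral_add) (auto simp: mult.commute)
      also have "\<dots> = emeasure \<alpha> A"
        by (simp add: mN flip: distrib_right)
      finally show "emeasure (distr \<gamma> borel snd) A = emeasure \<alpha> A" .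
    qed (use \<gamma>_prob \<gamma>_sets sets_p sets_\<alpha> in auto)
    then have "W1 p \<alpha> \<le> (\<integral>\<^sup>+z. ennreal (dist (fst z) (snd z)) \<partial>\<gamma>)"
      unfolding W1_def by (rule INF_lower)
    also have "\<dots> = (\<integral>\<^sup>+x. Q x * (\<integral>\<^sup>+y. ennreal (dist x y) \<partial>q) \<partial>\<alpha>)"
      unfolding \<gamma>[OF d] by simp
    \<comment> \<open>The triangle inequality through \<open>x\<^sub>0\<close> separates the two
      points of a pair: excess and deficit each pay their own distance to \<open>x\<^sub>0\<close>,
      and their sum is \<open>\<bar>h x - 1\<bar>\<close>.\<close>
    also have "\<dots> \<le> (\<integral>\<^sup>+x. Q x * ennreal (dist x x\<^sub>0) + Q x * (\<integral>\<^sup>+y. ennreal (dist y x\<^sub>0) \<partial>q) \<partial>\<alpha>)"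
    proof (rule nn_integral_mono)
      fix x
      have "(\<integral>\<^sup>+y. ennreal (dist x y) \<partial>q) \<le> (\<integral>\<^sup>+y. ennreal (dist x x\<^sub>0) + ennreal (dist y x\<^sub>0) \<partial>q)"
        by (intro nn_integral_mono) (simp add: dist_triangle2 flip: ennreal_plus)
      also have "\<dots> = ennreal (dist x x\<^sub>0) + (\<integral>\<^sup>+y. ennreal (dist y x\<^sub>0) \<partial>q)"
        using prob_space.emeasure_space_1[OF q] by (subst nn_integral_add) auto
      finally show "Q x * (\<integral>\<^sup>+y. ennreal (dist x y) \<partial>q)
          \<le> Q x * ennreal (dist x x\<^sub>0) + Q x * (\<integral>\<^sup>+y. ennreal (dist y x\<^sub>0) \<partial>q)"
        by (simp add: mult_left_mono flip: distrib_left)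
    qed
    also have "\<dots> = (\<integral>\<^sup>+x. Q x * ennreal (dist x x\<^sub>0) \<partial>\<alpha>) + \<delta> * (\<integral>\<^sup>+y. ennreal (dist y x\<^sub>0) \<partial>q)"
      by (subst nn_integral_add) (auto simp: nn_integral_multc \<delta>_Q)
    also have "\<dots> = (\<integral>\<^sup>+x. Q x * ennreal (dist x x\<^sub>0) + N x * ennreal (dist x x\<^sub>0) \<partial>\<alpha>)"
      using nn_q[of "\<lambda>y. ennreal (dist y x\<^sub>0)"] by (subst nn_integral_add) (auto simp: mult.commute)
    also have "\<dots> = (\<integral>\<^sup>+x. ennreal (dist x x\<^sub>0 * \<bar>h x - 1\<bar>) \<partial>\<alpha>)"
    proof (rule nn_integral_cong)
      fix x
      have "Q x + N x = ennreal \<bar>h x - 1\<bar>"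
        by (auto simp: Q_def N_def max_def)
      then show "Q x * ennreal (dist x x\<^sub>0) + N x * ennreal (dist x x\<^sub>0) = ennreal (dist x x\<^sub>0 * \<bar>h x - 1\<bar>)"
        by (simp add: ennreal_mult mult.commute flip: distrib_right)
    qed
    finally show ?thesis by (simp add: p_def)
  qed
qed

section \<open>The absorbed process\<close>

context absorbed_markov_process
begin

lemma prob_space_path: "prob_space (P x)"
  and sets_path: "sets (P x) = sets \<F>"
  using measurable_space[OF kernel, of x] by (auto simp: space_prob_algebra)

lemma space_path: "space (P x) = space \<F>"
  by (rule sets_eq_imp_space_eq[OF sets_path])

lemma coordinate_measurable:
  assumes "0 \<le> t"
  shows "X t \<in> \<F> \<rightarrow>\<^sub>M borel"
proof -
  have "(\<lambda>\<omega>. (t, \<omega>)) \<in> \<F> \<rightarrow>\<^sub>M restrict_space borel {0..} \<Otimes>\<^sub>M \<F>"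
    using assms by (intro measurable_Pair1') (simp add: space_restrict_space)
  from measurable_compose[OF this jointly_measurable] show ?thesis by simp
qed

lemma lifetime_le: "X t \<omega> = c \<Longrightarrow> 0 \<le> t \<Longrightarrow> lifetime X c \<omega> \<le> ereal t"
  unfolding lifetime_def by (intro Inf_lower) auto

text \<open>Absorption makes survival up to time \<open>t\<close> visible in \<open>X t\<close>
  alone, so killed quantities become integrals over \<open>- {c}\<close> against the law of
  \<open>X t\<close>.\<close>

lemma alive_eq:
  assumes "0 \<le> t"
  shows "alive \<F> X c t = {\<omega> \<in> space \<F>. X t \<omega> \<noteq> c}"
proof -
  have "ereal t < lifetime X c \<omega> \<longleftrightarrow> X t \<omega> \<noteq> c" if "\<omega> \<in> space \<F>" for \<omega>
    using absorbing[OF that assms] lifetime_le[OF _ assms, of \<omega>] by (meson not_le)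
  then show ?thesis by (auto simp: alive_def)
qed

text \<open>Negative times are treated as time 0, which makes the kernel jointly measurable over all
  real times; the semigroup built from it needs this.\<close>

definition transition :: "real \<Rightarrow> 'a \<Rightarrow> 'a measure" where
  "transition t x = distr (P x) borel (X (max 0 t))"

lemma sets_transition [simp, measurable_cong]: "sets (transition t x) = sets borel"
  by (simp add: transition_def)

lemma space_transition [simp]: "space (transition t x) = UNIV"
  by (simp add: transition_def)

lemma transition_measurable: "(\<lambda>(t, x). transition t x) \<in> borel \<Otimes>\<^sub>M borel \<rightarrow>\<^sub>M prob_algebra borel"
proof -
  have "(\<lambda>z. (max (0::real) (fst (fst z)), snd z)) \<in> (borel \<Otimes>\<^sub>M borel) \<Otimes>\<^sub>M \<F> \<rightarrow>\<^sub>M restrict_space borel {0..} \<Otimes>\<^sub>M \<F>"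
    by (intro measurable_Pair measurable_restrict_space2) auto
  from measurable_compose[OF this jointly_measurable]
  have X: "(\<lambda>(p, \<omega>). X (max 0 (fst p)) \<omega>) \<in> (borel \<Otimes>\<^sub>M borel) \<Otimes>\<^sub>M \<F> \<rightarrow>\<^sub>M borel"
    by (simp add: case_prod_beta')
  have "(\<lambda>p. P (snd p)) \<in> borel \<Otimes>\<^sub>M borel \<rightarrow>\<^sub>M prob_algebra \<F>"
    by (rule measurable_compose[OF measurable_snd kernel])
  from measurable_distr_prob_space2[OF this X]
  show ?thesis by (simp add: transition_def case_prod_beta')
qed

lemma transition_kernel: "transition t \<in> borel \<rightarrow>\<^sub>M prob_algebra borel"
  using measurable_compose[OF measurable_Pair1'[of t borel borel] transition_measurable] by simp

lemma prob_space_transition: "prob_space (transition t x)"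
  using measurable_space[OF transition_kernel, of x t] by (simp add: space_prob_algebra)

lemma measure_transition_measurable:
  "A \<in> sets borel \<Longrightarrow> (\<lambda>y. measure (transition t y) A) \<in> borel_measurable borel"
  and emeasure_transition_measurable:
  "A \<in> sets borel \<Longrightarrow> (\<lambda>y. emeasure (transition t y) A) \<in> borel_measurable borel"
  by (rule measurable_compose[OF transition_kernel measurable_measure_prob_algebra],
      assumption,
      rule measurable_compose[OF measurable_prob_algebraD[OF transition_kernel] measurable_emeasure_subprob_algebra])

lemma X_measurable_path [measurable]: "0 \<le> t \<Longrightarrow> X t \<in> P x \<rightarrow>\<^sub>M borel"
  using coordinate_measurable by (simp cong: measurable_cong_sets add: sets_path)

text \<open>The expectation of both sides of the Markov property at time \<open>s\<close>. That a
  conditional expectation preserves the integral presupposes that the natural filtration is a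
  subalgebra of the path space, which is checked at the outset.\<close>

lemma chapman_kolmogorov:
  assumes s: "0 \<le> s" and t: "0 \<le> t"
  shows "transition (s + t) x = transition s x \<bind> transition t"
proof (rule measure_eqI)
  have ts: "transition s x \<in> space (prob_algebra borel)"
    by (simp add: space_prob_algebra prob_space_transition)
  show "sets (transition (s + t) x) = sets (transition s x \<bind> transition t)"
    by (simp add: sets_bind'[OF ts transition_kernel])
  fix A assume "A \<in> sets (transition (s + t) x)"
  then have A[measurable]: "A \<in> sets borel" by simp
  interpret Px: prob_space "P x" by (rule prob_space_path)
  have "subalgebra (P x) (natural_filtration \<F> X s)"
    unfolding subalgebra_def natural_filtration_def
  proof (intro conjI)
    let ?G = "{X r -` B \<inter> space \<F> |r B. 0 \<le> r \<and> r \<le> s \<and> B \<in> sets borel}"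
    have "?G \<subseteq> sets \<F>"
      using measurable_sets[OF coordinate_measurable] by auto
    moreover from this have "?G \<subseteq> Pow (space \<F>)" by auto
    ultimately show "space (sigma (space \<F>) ?G) = space (P x)"
      by (simp add: space_path space_measure_of)
    show "sets (sigma (space \<F>) ?G) \<subseteq> sets (P x)"
      using \<open>?G \<subseteq> sets \<F>\<close> \<open>?G \<subseteq> Pow (space \<F>)\<close>
      by (simp add: sets_measure_of sets_path sets.sigma_sets_subset)
  qed
  then interpret finite_measure_subalgebra "P x" "natural_filtration \<F> X s"
    by (simp add: finite_measure_subalgebra_def finite_measure_subalgebra_axioms_def Px.finite_measure_axioms)
  have m: "measure (P y) {\<omega> \<in> space \<F>. X t \<omega> \<in> A} = measure (transition t y) A" for y
    using t by (simp add: transition_def measure_distr space_path vimage_def Int_def conj_commute)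
  have st: "0 \<le> s + t" using s t by simp
  note [measurable] = X_measurable_path[OF st, of x]
  have B: "{\<omega> \<in> space (P x). X (s + t) \<omega> \<in> A} \<in> sets (P x)"
    by measurable
  have "measure (transition (s + t) x) A = measure (P x) {\<omega> \<in> space (P x). X (s + t) \<omega> \<in> A}"
    using s t by (simp add: transition_def measure_distr vimage_def Int_def conj_commute)
  also have "\<dots> = (\<integral>\<omega>. indicator {\<omega> \<in> space (P x). X (s + t) \<omega> \<in> A} \<omega> \<partial>P x)"
    using B by simp
  also have "\<dots> = (\<integral>\<omega>. indicator {\<omega>. X (s + t) \<omega> \<in> A} \<omega> \<partial>P x)"
    by (intro Bochner_Integration.integral_cong) (auto split: split_indicator)
  also have "\<dots> = (\<integral>\<omega>. real_cond_exp (P x) (natural_filtration \<F> X s) (indicator {\<omega>. X (s + t) \<omega> \<in> A}) \<omega> \<partial>P x)"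
  proof (rule real_cond_exp_int(2)[symmetric])
    have "integrable (P x) (indicator {\<omega> \<in> space (P x). X (s + t) \<omega> \<in> A} :: _ \<Rightarrow> real)"
      using B by (simp add: Px.emeasure_eq_measure)
    then show "integrable (P x) (indicator {\<omega>. X (s + t) \<omega> \<in> A} :: _ \<Rightarrow> real)"
      by (rule Bochner_Integration.integrable_cong[THEN iffD1, OF refl, rotated]) (auto split: split_indicator)
  qed
  also have "\<dots> = (\<integral>\<omega>. measure (transition t (X s \<omega>)) A \<partial>P x)"
  proof (rule integral_cong_AE)
    show "AE \<omega> in P x. real_cond_exp (P x) (natural_filtration \<F> X s) (indicator {\<omega>. X (s + t) \<omega> \<in> A}) \<omega>
        = measure (transition t (X s \<omega>)) A"
      using markov[OF s t A, of x] by (simp add: m)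
    show "(\<lambda>\<omega>. measure (transition t (X s \<omega>)) A) \<in> borel_measurable (P x)"
      by (rule measurable_compose[OF X_measurable_path[OF s] measure_transition_measurable[OF A]])
  qed simp
  also have "ennreal \<dots> = (\<integral>\<^sup>+\<omega>. ennreal (measure (transition t (X s \<omega>)) A) \<partial>P x)"
  proof (rule nn_integral_eq_integral[symmetric])
    show "integrable (P x) (\<lambda>\<omega>. measure (transition t (X s \<omega>)) A)"
      using prob_space.prob_le_1[OF prob_space_transition]
      by (intro Px.integrable_const_bound[of _ 1]
          measurable_compose[OF X_measurable_path[OF s] measure_transition_measurable[OF A]]) auto
  qed auto
  also have "\<dots> = (\<integral>\<^sup>+\<omega>. emeasure (transition t (X s \<omega>)) A \<partial>P x)"
    using prob_space_transition by (simp add: finite_measure.emeasure_eq_measure prob_space.finite_measure)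
  also have "\<dots> = (\<integral>\<^sup>+y. emeasure (transition t y) A \<partial>transition s x)"
    unfolding transition_def[of s x] using s
    by (subst nn_integral_distr) (auto intro!: emeasure_transition_measurable)
  also have "\<dots> = emeasure (transition s x \<bind> transition t) A"
    by (rule emeasure_bind_prob_algebra[OF ts transition_kernel A, symmetric])
  finally show "emeasure (transition (s + t) x) A = emeasure (transition s x \<bind> transition t) A"
    using prob_space_transition by (simp add: finite_measure.emeasure_eq_measure prob_space.finite_measure)
qed

text \<open>A path started at \<open>c\<close> has lifetime 0, hence is absorbed from the
  beginning.\<close>

lemma transition_cemetery: "AE y in transition t c. y = c"
proof -
  have "AE \<omega> in P c. X (max 0 t) \<omega> = c"
    using initial[of c]
  proof (rule AE_mp, intro AE_I2 impI)
    fix \<omega> assume "\<omega> \<in> space (P c)" "X 0 \<omega> = c"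
    then show "X (max 0 t) \<omega> = c"
      using order_trans[OF lifetime_le[of 0 \<omega>], of "ereal (max 0 t)"] absorbing[of \<omega> "max 0 t"]
      by (simp add: space_path)
  qed
  moreover have "{y \<in> space borel. y = c} \<in> sets borel" by simp
  ultimately show ?thesis unfolding transition_def by (subst AE_distr_iff) auto
qed

section \<open>Killed and conditioned laws through the transition kernel\<close>

lemma killed_semigroup_eq:
  assumes t: "0 \<le> t" and [measurable]: "f \<in> borel_measurable borel"
  shows "killed_semigroup \<F> P X c t f x = (\<integral>y. f y * indicator (- {c}) y \<partial>transition t x)"
    and "integrable (P x) (\<lambda>\<omega>. f (X t \<omega>) * indicator (alive \<F> X c t) \<omega>)
      \<longleftrightarrow> integrable (transition t x) (\<lambda>y. f y * indicator (- {c}) y)"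
proof -
  have eq: "f (X t \<omega>) * indicator (alive \<F> X c t) \<omega> = f (X t \<omega>) * indicator (- {c}) (X t \<omega>)"
    if "\<omega> \<in> space (P x)" for \<omega>
    using that t by (auto simp: alive_eq space_path split: split_indicator)
  have "killed_semigroup \<F> P X c t f x = (\<integral>\<omega>. f (X t \<omega>) * indicator (- {c}) (X t \<omega>) \<partial>P x)"
    unfolding killed_semigroup_def by (intro Bochner_Integration.integral_cong refl eq)
  also have "\<dots> = (\<integral>y. f y * indicator (- {c}) y \<partial>transition t x)"
    using t by (simp add: transition_def integral_distr)
  finally show "killed_semigroup \<F> P X c t f x = (\<integral>y. f y * indicator (- {c}) y \<partial>transition t x)" .
  have "integrable (P x) (\<lambda>\<omega>. f (X t \<omega>) * indicator (alive \<F> X c t) \<omega>)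
      \<longleftrightarrow> integrable (P x) (\<lambda>\<omega>. f (X t \<omega>) * indicator (- {c}) (X t \<omega>))"
    by (intro Bochner_Integration.integrable_cong refl eq)
  also have "\<dots> \<longleftrightarrow> integrable (transition t x) (\<lambda>y. f y * indicator (- {c}) y)"
    using t by (simp add: transition_def integrable_distr_eq)
  finally show "integrable (P x) (\<lambda>\<omega>. f (X t \<omega>) * indicator (alive \<F> X c t) \<omega>)
      \<longleftrightarrow> integrable (transition t x) (\<lambda>y. f y * indicator (- {c}) y)" .
qed

context
  fixes \<mu> :: "'a measure" and t :: real
  assumes \<mu>: "prob_space \<mu>" and sets_\<mu>[measurable_cong]: "sets \<mu> = sets borel" and t: "0 \<le> t"
begin

lemma path_law_in_space: "\<mu> \<in> space (prob_algebra borel)"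
  using \<mu> sets_\<mu> by (simp add: space_prob_algebra)

lemma sets_path_law: "sets (path_law P \<mu>) = sets \<F>"
  unfolding path_law_def by (rule sets_bind'[OF path_law_in_space kernel])

lemma space_path_law: "space (path_law P \<mu>) = space \<F>"
  by (rule sets_eq_imp_space_eq[OF sets_path_law])

lemma alive_measurable: "alive \<F> X c t \<in> sets \<F>"
proof -
  have "X t -` (- {c}) \<inter> space \<F> \<in> sets \<F>"
    by (rule measurable_sets[OF coordinate_measurable[OF t]]) auto
  then show ?thesis unfolding alive_eq[OF t] by (simp add: vimage_def Int_def conj_commute)
qed

lemma nn_integral_path_law:
  assumes "f \<in> borel_measurable \<F>"
  shows "(\<integral>\<^sup>+\<omega>. f \<omega> \<partial>path_law P \<mu>) = (\<integral>\<^sup>+x. \<integral>\<^sup>+\<omega>. f \<omega> \<partial>P x \<partial>\<mu>)"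
  unfolding path_law_def
  using measurable_prob_algebraD[OF kernel]
  by (intro nn_integral_bind[OF assms]) (simp cong: measurable_cong_sets add: sets_\<mu>)

lemma nn_integral_killed_law:
  assumes [measurable]: "u \<in> borel_measurable borel"
  shows "(\<integral>\<^sup>+y. u y \<partial>killed_law \<F> P X c \<mu> t)
    = (\<integral>\<^sup>+x. \<integral>\<^sup>+y. u y * indicator (- {c}) y \<partial>transition t x \<partial>\<mu>)"
proof -
  note [measurable_cong] = sets_path_law
  note [measurable] = coordinate_measurable[OF t] alive_measurable
  have "(\<integral>\<^sup>+y. u y \<partial>killed_law \<F> P X c \<mu> t) = (\<integral>\<^sup>+\<omega>. u (X t \<omega>) \<partial>restrict_space (path_law P \<mu>) (alive \<F> X c t))"
    unfolding killed_law_def by (subst nn_integral_distr) (auto intro!: measurable_restrict_space1)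
  also have "\<dots> = (\<integral>\<^sup>+\<omega>. u (X t \<omega>) * indicator (alive \<F> X c t) \<omega> \<partial>path_law P \<mu>)"
    by (subst nn_integral_restrict_space) (auto simp: sets_path_law intro!: alive_measurable sets.Int)
  also have "\<dots> = (\<integral>\<^sup>+x. \<integral>\<^sup>+\<omega>. u (X t \<omega>) * indicator (alive \<F> X c t) \<omega> \<partial>P x \<partial>\<mu>)"
    by (rule nn_integral_path_law) measurable
  also have "\<dots> = (\<integral>\<^sup>+x. \<integral>\<^sup>+\<omega>. u (X t \<omega>) * indicator (- {c}) (X t \<omega>) \<partial>P x \<partial>\<mu>)"
    using t by (intro nn_integral_cong) (auto simp: alive_eq space_path split: split_indicator)
  also have "\<dots> = (\<integral>\<^sup>+x. \<integral>\<^sup>+y. u y * indicator (- {c}) y \<partial>transition t x \<partial>\<mu>)"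
    using t by (intro nn_integral_cong) (simp add: transition_def nn_integral_distr)
  finally show ?thesis .
qed

lemma sets_killed_law [simp]: "sets (killed_law \<F> P X c \<mu> t) = sets borel"
  by (simp add: killed_law_def)

lemma emeasure_conditional_law:
  assumes [measurable]: "A \<in> sets borel"
  shows "emeasure (conditional_law \<F> P X c \<mu> t) A
    = emeasure (killed_law \<F> P X c \<mu> t) A / emeasure (killed_law \<F> P X c \<mu> t) UNIV"
proof -
  note [measurable_cong] = sets_path_law
  note [measurable] = coordinate_measurable[OF t] alive_measurable
  have X: "X t \<in> uniform_measure (path_law P \<mu>) (alive \<F> X c t) \<rightarrow>\<^sub>M borel"
    by (simp cong: measurable_cong_sets add: sets_path_law)
  have k: "emeasure (killed_law \<F> P X c \<mu> t) B = emeasure (path_law P \<mu>) (alive \<F> X c t \<inter> (X t -` B \<inter> space \<F>))"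
    if "B \<in> sets borel" for B
  proof -
    have "X t -` B \<inter> space (restrict_space (path_law P \<mu>) (alive \<F> X c t)) = alive \<F> X c t \<inter> (X t -` B \<inter> space \<F>)"
      by (auto simp: space_restrict_space space_path_law alive_def)
    moreover have "X t \<in> restrict_space (path_law P \<mu>) (alive \<F> X c t) \<rightarrow>\<^sub>M borel"
      by (intro measurable_restrict_space1) measurable
    ultimately show ?thesis
      unfolding killed_law_def using that
      by (simp add: emeasure_distr emeasure_restrict_space sets_path_law space_path_law alive_measurable)
  qed
  have "alive \<F> X c t \<inter> space \<F> = alive \<F> X c t" by (auto simp: alive_def)
  then have kU: "emeasure (killed_law \<F> P X c \<mu> t) UNIV = emeasure (path_law P \<mu>) (alive \<F> X c t)"
    by (subst k) auto
  have "emeasure (conditional_law \<F> P X c \<mu> t) A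
      = emeasure (uniform_measure (path_law P \<mu>) (alive \<F> X c t)) (X t -` A \<inter> space \<F>)"
    unfolding conditional_law_def by (subst emeasure_distr[OF X]) (auto simp: space_path_law)
  also have "\<dots> = emeasure (path_law P \<mu>) (alive \<F> X c t \<inter> (X t -` A \<inter> space \<F>)) / emeasure (path_law P \<mu>) (alive \<F> X c t)"
    by (subst emeasure_uniform_measure) (auto simp: sets_path_law alive_measurable intro: measurable_sets[OF coordinate_measurable[OF t]])
  finally show ?thesis by (simp add: k kU)
qed

end

text \<open>The factor \<open>r\<close> cancels under conditioning and leaves the density
  \<open>h = k / N\<close>, where \<open>N\<close> is the \<alpha>-integral of \<open>k\<close>. As
  \<psi> is at least 1, \<open>\<bar>N - 1\<bar> \<le> \<epsilon>\<close>, so \<open>N\<close> is at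
  least 1/2 and \<open>\<bar>h x - 1\<bar> \<le> 2 * \<bar>k x - 1\<bar> + 2 * \<epsilon>\<close>.
  Integrated against \<psi>, the first term gives the summand 2 of the constant and the second gives
  2 \<alpha>(\<psi>).\<close>

lemma W1_conditional_law_le:
  fixes \<alpha> \<mu> :: "'a measure" and k :: "'a \<Rightarrow> real" and x\<^sub>0 :: 'a
  assumes \<alpha>: "prob_space \<alpha>" and sets_\<alpha>[measurable_cong]: "sets \<alpha> = sets borel"
    and \<mu>: "prob_space \<mu>" "sets \<mu> = sets borel" and t: "0 \<le> t"
    and k[measurable]: "k \<in> borel_measurable borel" and k_nonneg: "\<And>x. 0 \<le> k x"
    and r: "0 < r"
    and killed: "\<And>A. A \<in> sets borel \<Longrightarrow>
      emeasure (killed_law \<F> P X c \<mu> t) A = ennreal r * (\<integral>\<^sup>+x. ennreal (k x) * indicator A x \<partial>\<alpha>)"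
    and moment: "integrable \<alpha> (\<lambda>x. 1 + dist x x\<^sub>0)"
    and \<epsilon>: "(\<integral>\<^sup>+x. ennreal ((1 + dist x x\<^sub>0) * \<bar>k x - 1\<bar>) \<partial>\<alpha>) \<le> ennreal \<epsilon>" "0 \<le> \<epsilon>" "\<epsilon> \<le> 1 / 2"
  shows "W1 (conditional_law \<F> P X c \<mu> t) \<alpha> \<le> ennreal ((2 + 2 * (\<integral>x. 1 + dist x x\<^sub>0 \<partial>\<alpha>)) * \<epsilon>)"
proof -
  interpret prob_space \<alpha> by (rule \<alpha>)
  define \<psi> where "\<psi> x = 1 + dist x x\<^sub>0" for x
  have space_\<alpha>[simp]: "space \<alpha> = UNIV" using sets_eq_imp_space_eq[OF sets_\<alpha>] by simp
  have [measurable]: "(\<lambda>x::'a. dist x x\<^sub>0) \<in> borel_measurable borel"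
    by (intro borel_measurable_continuous_onI continuous_intros)
  have [measurable]: "\<psi> \<in> borel_measurable borel" unfolding \<psi>_def by measurable
  have \<psi>_ge: "1 \<le> \<psi> x" for x by (simp add: \<psi>_def)
  have int_\<psi>k: "integrable \<alpha> (\<lambda>x. \<psi> x * \<bar>k x - 1\<bar>)"
  proof (rule integrableI_nonneg)
    show "(\<integral>\<^sup>+x. ennreal (\<psi> x * \<bar>k x - 1\<bar>) \<partial>\<alpha>) < \<infinity>"
      using \<epsilon>(1) by (simp add: \<psi>_def le_less_trans[OF _ ennreal_less_top])
    show "AE x in \<alpha>. 0 \<le> \<psi> x * \<bar>k x - 1\<bar>"
      by (intro AE_I2) (simp add: \<psi>_def)
  qed measurable
  have \<psi>k: "(\<integral>x. \<psi> x * \<bar>k x - 1\<bar> \<partial>\<alpha>) \<le> \<epsilon>"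
  proof -
    have "ennreal (\<integral>x. \<psi> x * \<bar>k x - 1\<bar> \<partial>\<alpha>) = (\<integral>\<^sup>+x. ennreal (\<psi> x * \<bar>k x - 1\<bar>) \<partial>\<alpha>)"
      by (rule nn_integral_eq_integral[OF int_\<psi>k, symmetric]) (simp add: \<psi>_def)
    also have "\<dots> \<le> ennreal \<epsilon>" using \<epsilon>(1) by (simp add: \<psi>_def)
    finally show ?thesis using \<epsilon>(2) by (simp add: ennreal_le_iff)
  qed
  have int_k1: "integrable \<alpha> (\<lambda>x. \<bar>k x - 1\<bar>)"
  proof (rule Bochner_Integration.integrable_bound[OF int_\<psi>k])
    show "AE x in \<alpha>. norm \<bar>k x - 1\<bar> \<le> norm (\<psi> x * \<bar>k x - 1\<bar>)"
      using mult_right_mono[OF \<psi>_ge, of "\<bar>k _ - 1\<bar>"] \<psi>_ge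
      by (intro AE_I2) (simp add: \<psi>_def abs_mult)
  qed measurable
  have int_k: "integrable \<alpha> k"
  proof (rule Bochner_Integration.integrable_bound)
    show "integrable \<alpha> (\<lambda>x. 1 + \<bar>k x - 1\<bar>)" using int_k1 by simp
    show "AE x in \<alpha>. norm (k x) \<le> norm (1 + \<bar>k x - 1\<bar>)" by (intro AE_I2) auto
  qed measurable
  define N where "N = (\<integral>x. k x \<partial>\<alpha>)"
  have N1: "\<bar>N - 1\<bar> \<le> \<epsilon>"
  proof -
    have "\<bar>N - 1\<bar> = \<bar>\<integral>x. k x - 1 \<partial>\<alpha>\<bar>" unfolding N_def using int_k prob_space by simp
    also have "\<dots> \<le> (\<integral>x. \<bar>k x - 1\<bar> \<partial>\<alpha>)" by (rule integral_abs_bound)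
    also have "\<dots> \<le> (\<integral>x. \<psi> x * \<bar>k x - 1\<bar> \<partial>\<alpha>)"
      using mult_right_mono[OF \<psi>_ge abs_ge_zero, of "k _ - 1"]
      by (intro integral_mono int_k1 int_\<psi>k) (simp add: \<psi>_def)
    finally show ?thesis using \<psi>k by simp
  qed
  then have N: "1 / 2 \<le> N" using \<epsilon>(3) by linarith
  have nn_N: "(\<integral>\<^sup>+x. ennreal (k x) \<partial>\<alpha>) = ennreal N"
    unfolding N_def using k_nonneg by (intro nn_integral_eq_integral[OF int_k]) simp
  define h where "h x = k x / N" for x
  have h_nonneg: "0 \<le> h x" for x using k_nonneg N by (simp add: h_def)
  have [measurable]: "h \<in> borel_measurable borel" unfolding h_def by measurable
  have cond: "conditional_law \<F> P X c \<mu> t = density \<alpha> (\<lambda>x. ennreal (h x))"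
  proof (rule measure_eqI)
    show "sets (conditional_law \<F> P X c \<mu> t) = sets (density \<alpha> (\<lambda>x. ennreal (h x)))"
      by (simp add: conditional_law_def sets_\<alpha>)
    fix A assume "A \<in> sets (conditional_law \<F> P X c \<mu> t)"
    then have A[measurable]: "A \<in> sets borel" by (simp add: conditional_law_def)
    let ?I = "\<integral>\<^sup>+x. ennreal (k x) * indicator A x \<partial>\<alpha>"
    have "emeasure (conditional_law \<F> P X c \<mu> t) A = (ennreal r * ?I) / (ennreal r * ennreal N)"
      using killed[OF A] killed[of UNIV] by (simp add: emeasure_conditional_law[OF \<mu> t A] nn_N)
    also have "\<dots> = ?I / ennreal N"
      using r divide_mult_eq[of "ennreal r" ?I "ennreal N"] by (simp add: mult.commute)
    also have "\<dots> = (\<integral>\<^sup>+x. (ennreal (k x) * indicator A x) / ennreal N \<partial>\<alpha>)"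
      by (rule nn_integral_divide[symmetric]) measurable
    also have "\<dots> = (\<integral>\<^sup>+x. ennreal (h x) * indicator A x \<partial>\<alpha>)"
      using N k_nonneg by (intro nn_integral_cong) (auto simp: h_def divide_ennreal split: split_indicator)
    also have "\<dots> = emeasure (density \<alpha> (\<lambda>x. ennreal (h x))) A"
      by (subst emeasure_density) auto
    finally show "emeasure (conditional_law \<F> P X c \<mu> t) A = emeasure (density \<alpha> (\<lambda>x. ennreal (h x))) A" .
  qed
  have "prob_space (density \<alpha> (\<lambda>x. ennreal (h x)))"
  proof
    have "emeasure (density \<alpha> (\<lambda>x. ennreal (h x))) (space (density \<alpha> (\<lambda>x. ennreal (h x)))) = (\<integral>\<^sup>+x. ennreal (h x) \<partial>\<alpha>)"
      by (simp add: emeasure_density)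
    also have "\<dots> = (\<integral>\<^sup>+x. ennreal (k x) / ennreal N \<partial>\<alpha>)"
      using N k_nonneg by (intro nn_integral_cong) (auto simp: h_def divide_ennreal)
    also have "\<dots> = ennreal N / ennreal N"
      by (subst nn_integral_divide) (auto simp: nn_N)
    also have "\<dots> = 1" using N by (simp add: divide_ennreal)
    finally show "emeasure (density \<alpha> (\<lambda>x. ennreal (h x))) (space (density \<alpha> (\<lambda>x. ennreal (h x)))) = 1" .
  qed
  then have "W1 (conditional_law \<F> P X c \<mu> t) \<alpha> \<le> (\<integral>\<^sup>+x. ennreal (dist x x\<^sub>0 * \<bar>h x - 1\<bar>) \<partial>\<alpha>)"
    unfolding cond using h_nonneg by (intro W1_density_le[OF \<alpha> sets_\<alpha>]) auto
  also have "\<dots> \<le> (\<integral>\<^sup>+x. ennreal (2 * (\<psi> x * \<bar>k x - 1\<bar>) + 2 * \<epsilon> * \<psi> x) \<partial>\<alpha>)"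
  proof (intro nn_integral_mono ennreal_leI)
    fix x
    have "h x - 1 = (k x - 1 - (N - 1)) / N" using N by (simp add: h_def field_simps)
    then have "\<bar>h x - 1\<bar> = \<bar>k x - 1 - (N - 1)\<bar> / N" using N by simp
    also have "\<dots> \<le> (\<bar>k x - 1\<bar> + \<epsilon>) / (1 / 2)"
      using N N1 by (intro frac_le) auto
    finally have "\<bar>h x - 1\<bar> \<le> 2 * \<bar>k x - 1\<bar> + 2 * \<epsilon>" by simp
    then have "dist x x\<^sub>0 * \<bar>h x - 1\<bar> \<le> \<psi> x * (2 * \<bar>k x - 1\<bar> + 2 * \<epsilon>)"
      using \<epsilon>(2) by (intro mult_mono) (auto simp: \<psi>_def)
    then show "dist x x\<^sub>0 * \<bar>h x - 1\<bar> \<le> 2 * (\<psi> x * \<bar>k x - 1\<bar>) + 2 * \<epsilon> * \<psi> x"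
      by (simp add: algebra_simps)
  qed
  also have "\<dots> = ennreal (2 * (\<integral>x. \<psi> x * \<bar>k x - 1\<bar> \<partial>\<alpha>) + 2 * \<epsilon> * (\<integral>x. \<psi> x \<partial>\<alpha>))"
  proof -
    have i: "integrable \<alpha> \<psi>" using moment unfolding \<psi>_def .
    have "(\<integral>\<^sup>+x. ennreal (2 * (\<psi> x * \<bar>k x - 1\<bar>) + 2 * \<epsilon> * \<psi> x) \<partial>\<alpha>)
        = ennreal (\<integral>x. 2 * (\<psi> x * \<bar>k x - 1\<bar>) + 2 * \<epsilon> * \<psi> x \<partial>\<alpha>)"
    proof (rule nn_integral_eq_integral)
      show "integrable \<alpha> (\<lambda>x. 2 * (\<psi> x * \<bar>k x - 1\<bar>) + 2 * \<epsilon> * \<psi> x)"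
        using i int_\<psi>k by simp
      show "AE x in \<alpha>. 0 \<le> 2 * (\<psi> x * \<bar>k x - 1\<bar>) + 2 * \<epsilon> * \<psi> x"
        using \<epsilon>(2) by (intro AE_I2) (simp add: \<psi>_def)
    qed
    then show ?thesis using i int_\<psi>k by simp
  qed
  also have "\<dots> \<le> ennreal ((2 + 2 * (\<integral>x. \<psi> x \<partial>\<alpha>)) * \<epsilon>)"
    using \<psi>k by (intro ennreal_leI) (simp add: algebra_simps)
  finally show ?thesis by (simp add: \<psi>_def)
qed

end

section \<open>The Doob transform\<close>

lemma prob_on_E_AE: "prob_on_E c \<mu> \<Longrightarrow> AE x in \<mu>. x \<noteq> c"
  using AE_not_in[of "{c}" \<mu>] by (auto simp: prob_on_E_def null_sets_def)

locale qsd_eigenfunction = absorbed_markov_process \<F> P X c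
  for \<F> :: "'w measure" and P :: "'a::metric_space \<Rightarrow> 'w measure" and X :: "real \<Rightarrow> 'w \<Rightarrow> 'a" and c :: 'a +
  fixes \<alpha> :: "'a measure" and \<eta> :: "'a \<Rightarrow> real" and lambda0 :: real
  assumes prob_\<alpha>: "prob_on_E c \<alpha>"
    and killed_law_\<alpha>: "0 \<le> t \<Longrightarrow> killed_law \<F> P X c \<alpha> t = scale_measure (ennreal (exp (- lambda0 * t))) \<alpha>"
    and \<eta>_measurable [measurable]: "\<eta> \<in> borel_measurable borel"
    and \<eta>_pos: "x \<noteq> c \<Longrightarrow> 0 < \<eta> x"
    and \<eta>_integrable: "integrable \<alpha> \<eta>"
    and \<eta>_integral: "(\<integral>x. \<eta> x \<partial>\<alpha>) = 1"
    and eigenfunction: "x \<noteq> c \<Longrightarrow> 0 \<le> t \<Longrightarrow> killed_semigroup \<F> P X c t \<eta> x = exp (- lambda0 * t) * \<eta> x"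
begin

lemma prob_space_\<alpha>: "prob_space \<alpha>"
  and sets_\<alpha> [simp, measurable_cong]: "sets \<alpha> = sets borel"
  and AE_\<alpha>: "AE x in \<alpha>. x \<noteq> c"
  using prob_\<alpha> prob_on_E_AE by (auto simp: prob_on_E_def)

lemma space_\<alpha> [simp]: "space \<alpha> = UNIV"
  using sets_eq_imp_space_eq[OF sets_\<alpha>] by simp

text \<open>The value of \<eta> at \<open>c\<close> is arbitrary, possibly negative. Replacing it by
  0 gives a function that is nonnegative on the whole type and already contains the killing
  indicator.\<close>

definition \<eta>_alive :: "'a \<Rightarrow> real" where
  "\<eta>_alive y = \<eta> y * indicator (- {c}) y"

lemma \<eta>_alive_measurable [measurable]: "\<eta>_alive \<in> borel_measurable borel"
  unfolding \<eta>_alive_def by measurable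

lemma \<eta>_alive_nonneg: "0 \<le> \<eta>_alive y"
  and \<eta>_alive_cemetery [simp]: "\<eta>_alive c = 0"
  and \<eta>_alive_eq: "y \<noteq> c \<Longrightarrow> \<eta>_alive y = \<eta> y"
  using \<eta>_pos[of y] by (auto simp: \<eta>_alive_def split: split_indicator)

lemma \<eta>_alive_transition:
  assumes x: "x \<noteq> c" and t: "0 \<le> t"
  shows "integrable (transition t x) \<eta>_alive"
    and "(\<integral>y. \<eta>_alive y \<partial>transition t x) = exp (- lambda0 * t) * \<eta> x"
proof -
  show eq: "(\<integral>y. \<eta>_alive y \<partial>transition t x) = exp (- lambda0 * t) * \<eta> x"
    using killed_semigroup_eq(1)[OF t \<eta>_measurable, of x] eigenfunction[OF x t] by (simp add: \<eta>_alive_def)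
  \<comment> \<open>The integral of a non-integrable function is 0 by convention, whereas the
    eigenvalue identity gives a positive value; so the identity itself yields integrability.\<close>
  show "integrable (transition t x) \<eta>_alive"
    using eq \<eta>_pos[OF x] not_integrable_integral_eq[of "transition t x" \<eta>_alive]
    by (cases "integrable (transition t x) \<eta>_alive") auto
qed

text \<open>The trap at \<open>c\<close>, which \<open>\<eta> \<circ> \<alpha>\<close> does not charge, and the \<open>max\<close> only serve to make this a Markov
  kernel, jointly measurable on the whole type.\<close>

definition doob :: "real \<Rightarrow> 'a \<Rightarrow> 'a measure" where
  "doob t x = (if x = c then return borel c
     else density (transition t x) (\<lambda>y. ennreal (exp (lambda0 * max 0 t) * \<eta>_alive y / \<eta> x)))"

lemma sets_doob [simp, measurable_cong]: "sets (doob t x) = sets borel"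
  by (simp add: doob_def)

lemma nn_integral_doob:
  assumes x: "x \<noteq> c" and t: "0 \<le> t" and [measurable]: "u \<in> borel_measurable borel"
  shows "(\<integral>\<^sup>+y. u y \<partial>doob t x) = (\<integral>\<^sup>+y. ennreal (exp (lambda0 * t) * \<eta>_alive y / \<eta> x) * u y \<partial>transition t x)"
  using x t by (simp add: doob_def nn_integral_density)

text \<open>Away from \<open>c\<close>, total mass 1 is precisely the eigenfunction equation. At
  negative times the kernel and its exponential weight both refer to time 0.\<close>

lemma prob_space_doob: "prob_space (doob t x)"
proof (cases "x = c")
  case True
  then show ?thesis by (simp add: doob_def prob_space_return)
next
  case False
  have t: "transition t x = transition (max 0 t) x" by (simp add: transition_def)
  have i: "integrable (transition t x) (\<lambda>y. exp (lambda0 * max 0 t) * \<eta>_alive y / \<eta> x)"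
    using \<eta>_alive_transition(1)[OF False, of "max 0 t"] unfolding t by simp
  have "(\<integral>\<^sup>+y. ennreal (exp (lambda0 * max 0 t) * \<eta>_alive y / \<eta> x) \<partial>transition t x)
      = ennreal (\<integral>y. exp (lambda0 * max 0 t) * \<eta>_alive y / \<eta> x \<partial>transition t x)"
    using \<eta>_pos[OF False] \<eta>_alive_nonneg by (intro nn_integral_eq_integral[OF i]) auto
  also have "(\<integral>y. exp (lambda0 * max 0 t) * \<eta>_alive y / \<eta> x \<partial>transition t x)
      = exp (lambda0 * max 0 t) * (\<integral>y. \<eta>_alive y \<partial>transition (max 0 t) x) / \<eta> x"
    unfolding t by simp
  also have "\<dots> = 1"
    using \<eta>_pos[OF False] by (subst \<eta>_alive_transition(2)[OF False]) (auto simp flip: exp_add)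
  finally show ?thesis
    using False by (intro prob_spaceI) (simp add: doob_def emeasure_density)
qed

lemma doob_measurable: "(\<lambda>(t, x). doob t x) \<in> borel \<Otimes>\<^sub>M borel \<rightarrow>\<^sub>M prob_algebra borel"
proof (rule measurable_prob_algebra_generated[where G = "sets borel" and \<Omega> = UNIV])
  show "sets (borel :: 'a measure) = sigma_sets UNIV (sets borel)"
    using sets.sigma_sets_eq[of "borel :: 'a measure"] by simp
  show "Int_stable (sets (borel :: 'a measure))"
    by (auto simp: Int_stable_def)
  fix A :: "'a set" assume [measurable]: "A \<in> sets borel"
  have [measurable]: "(\<lambda>p. transition (fst p) (snd p)) \<in> borel \<Otimes>\<^sub>M borel \<rightarrow>\<^sub>M subprob_algebra borel"
    using measurable_prob_algebraD[OF transition_measurable] by (simp add: case_prod_beta')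
  have m: "(\<lambda>p. \<integral>\<^sup>+y. ennreal (exp (lambda0 * max 0 (fst p)) * \<eta>_alive y / \<eta> (snd p)) * indicator A y
      \<partial>transition (fst p) (snd p)) \<in> borel_measurable (borel \<Otimes>\<^sub>M borel)"
    by (rule nn_integral_measurable_subprob_algebra2[where N = borel]) measurable
  have "emeasure (case p of (t, x) \<Rightarrow> doob t x) A = (if snd p = c then indicator A c
     else \<integral>\<^sup>+y. ennreal (exp (lambda0 * max 0 (fst p)) * \<eta>_alive y / \<eta> (snd p)) * indicator A y
      \<partial>transition (fst p) (snd p))" for p
    by (auto simp: doob_def case_prod_beta' emeasure_density)
  then show "(\<lambda>p. emeasure (case p of (t, x) \<Rightarrow> doob t x) A) \<in> borel_measurable (borel \<Otimes>\<^sub>M borel)"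
    using m by simp
qed (auto simp: prob_space_doob)

lemma doob_kernel: "doob t \<in> borel \<rightarrow>\<^sub>M prob_algebra borel"
  using measurable_compose[OF measurable_Pair1'[of t borel borel] doob_measurable] by simp

lemma emeasure_doob_measurable:
  "A \<in> sets borel \<Longrightarrow> (\<lambda>y. emeasure (doob t y) A) \<in> borel_measurable borel"
  by (rule measurable_compose[OF measurable_prob_algebraD[OF doob_kernel] measurable_emeasure_subprob_algebra])

text \<open>In the Chapman-Kolmogorov identity the value of \<eta> at the intermediate point appears
  once in a numerator and once in a denominator and cancels. An intermediate point \<open>c\<close>
  contributes 0 to both sides, since \<open>\<eta>_alive\<close> vanishes there and the process does
  not leave it.\<close>

lemma doob_semigroup:
  assumes s: "0 \<le> s" and t: "0 \<le> t"
  shows "doob (s + t) x = doob s x \<bind> doob t"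
proof (cases "x = c")
  case True
  have "return borel c \<bind> doob t = doob t c"
    by (rule bind_return[OF measurable_prob_algebraD[OF doob_kernel]]) simp
  then show ?thesis using True by (simp add: doob_def[of _ c])
next
  case False
  have d: "doob s x \<in> space (prob_algebra borel)"
    by (simp add: space_prob_algebra prob_space_doob)
  have st: "0 \<le> s + t" using s t by simp
  show ?thesis
  proof (rule measure_eqI)
    show "sets (doob (s + t) x) = sets (doob s x \<bind> doob t)"
      by (simp add: sets_bind'[OF d doob_kernel])
    fix A assume "A \<in> sets (doob (s + t) x)"
    then have A[measurable]: "A \<in> sets borel" by simp
    define u where "u z = ennreal (exp (lambda0 * (s + t)) * \<eta>_alive z / \<eta> x) * indicator A z" for z
    have [measurable]: "u \<in> borel_measurable borel" unfolding u_def by measurable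
    note [measurable] = emeasure_doob_measurable[OF A]
    have "emeasure (doob (s + t) x) A = (\<integral>\<^sup>+z. u z \<partial>transition (s + t) x)"
      using nn_integral_doob[OF False st, of "indicator A"] by (simp add: u_def)
    also have "\<dots> = (\<integral>\<^sup>+y. \<integral>\<^sup>+z. u z \<partial>transition t y \<partial>transition s x)"
      unfolding chapman_kolmogorov[OF s t]
      using measurable_prob_algebraD[OF transition_kernel]
      by (intro nn_integral_bind[of _ borel]) (auto cong: measurable_cong_sets)
    also have "\<dots> = (\<integral>\<^sup>+y. ennreal (exp (lambda0 * s) * \<eta>_alive y / \<eta> x) * emeasure (doob t y) A \<partial>transition s x)"
    proof (rule nn_integral_cong)
      fix y
      show "(\<integral>\<^sup>+z. u z \<partial>transition t y) = ennreal (exp (lambda0 * s) * \<eta>_alive y / \<eta> x) * emeasure (doob t y) A"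
      proof (cases "y = c")
        case True
        have "AE z in transition t c. u z = 0"
          using transition_cemetery by eventually_elim (simp add: u_def)
        then show ?thesis using True by (subst nn_integral_0_iff_AE[THEN iffD2]) auto
      next
        case y: False
        have "emeasure (doob t y) A = (\<integral>\<^sup>+z. ennreal (exp (lambda0 * t) * \<eta>_alive z / \<eta> y) * indicator A z \<partial>transition t y)"
          using nn_integral_doob[OF y t, of "indicator A"] by simp
        then have "ennreal (exp (lambda0 * s) * \<eta>_alive y / \<eta> x) * emeasure (doob t y) A
          = (\<integral>\<^sup>+z. ennreal (exp (lambda0 * s) * \<eta>_alive y / \<eta> x) * (ennreal (exp (lambda0 * t) * \<eta>_alive z / \<eta> y) * indicator A z) \<partial>transition t y)"
          by (simp add: nn_integral_cmult)
        also have "\<dots> = (\<integral>\<^sup>+z. u z \<partial>transition t y)"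
        proof (rule nn_integral_cong)
          fix z
          have "exp (lambda0 * s) * \<eta>_alive y / \<eta> x * (exp (lambda0 * t) * \<eta>_alive z / \<eta> y)
              = exp (lambda0 * (s + t)) * \<eta>_alive z / \<eta> x"
            using \<eta>_pos[OF y] by (simp add: \<eta>_alive_eq[OF y] distrib_left exp_add)
          moreover have "0 \<le> exp (lambda0 * s) * \<eta>_alive y / \<eta> x" "0 \<le> exp (lambda0 * t) * \<eta>_alive z / \<eta> y"
            using \<eta>_pos[OF y] \<eta>_pos[OF False] by (simp_all add: \<eta>_alive_nonneg)
          ultimately have "ennreal (exp (lambda0 * s) * \<eta>_alive y / \<eta> x) * ennreal (exp (lambda0 * t) * \<eta>_alive z / \<eta> y)
              = ennreal (exp (lambda0 * (s + t)) * \<eta>_alive z / \<eta> x)"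
            by (metis ennreal_mult)
          then show "ennreal (exp (lambda0 * s) * \<eta>_alive y / \<eta> x) * (ennreal (exp (lambda0 * t) * \<eta>_alive z / \<eta> y) * indicator A z) = u z"
            unfolding u_def by (metis mult.assoc)
        qed
        finally show ?thesis by simp
      qed
    qed
    also have "\<dots> = (\<integral>\<^sup>+y. emeasure (doob t y) A \<partial>doob s x)"
      by (rule nn_integral_doob[OF False s, symmetric]) measurable
    also have "\<dots> = emeasure (doob s x \<bind> doob t) A"
      by (rule emeasure_bind_prob_algebra[OF d doob_kernel A, symmetric])
    finally show "emeasure (doob (s + t) x) A = emeasure (doob s x \<bind> doob t) A" .
  qed
qed

section \<open>The stationary law of the Doob transform\<close>

lemma nn_integral_\<eta>: "(\<integral>\<^sup>+x. ennreal (\<eta> x) \<partial>\<alpha>) = 1"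
proof -
  have "AE x in \<alpha>. 0 \<le> \<eta> x"
    using AE_\<alpha> by eventually_elim (use \<eta>_pos in \<open>auto intro: less_imp_le\<close>)
  then show ?thesis
    using nn_integral_eq_integral[OF \<eta>_integrable] \<eta>_integral by simp
qed

abbreviation \<pi> :: "'a measure" where
  "\<pi> \<equiv> reweight \<eta> \<alpha>"

lemma \<pi>_eq: "\<pi> = density \<alpha> (\<lambda>x. ennreal (\<eta> x))"
  by (simp add: reweight_def nn_integral_\<eta> divide_ennreal_def)

lemma sets_\<pi>: "sets \<pi> = sets borel"
  by (simp add: \<pi>_eq)

lemma nn_integral_\<pi>: "u \<in> borel_measurable borel \<Longrightarrow> (\<integral>\<^sup>+x. u x \<partial>\<pi>) = (\<integral>\<^sup>+x. ennreal (\<eta> x) * u x \<partial>\<alpha>)"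
  unfolding \<pi>_eq by (subst nn_integral_density) auto

lemma integral_\<pi>:
  fixes u :: "'a \<Rightarrow> real"
  assumes [measurable]: "u \<in> borel_measurable borel"
  shows "(\<integral>x. u x \<partial>\<pi>) = (\<integral>x. \<eta> x * u x \<partial>\<alpha>)"
    and "integrable \<pi> u \<longleftrightarrow> integrable \<alpha> (\<lambda>x. \<eta> x * u x)"
proof -
  have ae: "AE x in \<alpha>. 0 \<le> \<eta> x"
    using AE_\<alpha> by eventually_elim (use \<eta>_pos in \<open>auto intro: less_imp_le\<close>)
  show "(\<integral>x. u x \<partial>\<pi>) = (\<integral>x. \<eta> x * u x \<partial>\<alpha>)"
    unfolding \<pi>_eq using ae by (subst integral_density) auto
  show "integrable \<pi> u \<longleftrightarrow> integrable \<alpha> (\<lambda>x. \<eta> x * u x)"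
    unfolding \<pi>_eq using ae by (subst integrable_density) auto
qed

lemma prob_space_\<pi>: "prob_space \<pi>"
proof
  have "emeasure \<pi> (space \<pi>) = (\<integral>\<^sup>+x. 1 \<partial>\<pi>)" by simp
  also have "\<dots> = 1" by (subst nn_integral_\<pi>) (auto simp: nn_integral_\<eta>)
  finally show "emeasure \<pi> (space \<pi>) = 1" .
qed

text \<open>The Doob transform read backwards, P_t(\<eta> u) = e^(-\<lambda> t) \<eta> Q_t u.
  Extended nonnegative values allow unbounded \<open>u\<close>, such as 1/\<eta> on a set in
  \<open>killed_law_via_doob\<close>.\<close>

lemma transition_via_doob:
  assumes x: "x \<noteq> c" and t: "0 \<le> t" and [measurable]: "u \<in> borel_measurable borel"
  shows "ennreal (exp (- lambda0 * t)) * (ennreal (\<eta> x) * (\<integral>\<^sup>+y. u y \<partial>doob t x))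
    = (\<integral>\<^sup>+y. ennreal (\<eta> y) * u y * indicator (- {c}) y \<partial>transition t x)"
proof -
  have "ennreal (exp (- lambda0 * t)) * (ennreal (\<eta> x) * (\<integral>\<^sup>+y. u y \<partial>doob t x))
    = (\<integral>\<^sup>+y. ennreal (exp (- lambda0 * t)) * (ennreal (\<eta> x) * (ennreal (exp (lambda0 * t) * \<eta>_alive y / \<eta> x) * u y)) \<partial>transition t x)"
    using x t by (simp add: nn_integral_doob nn_integral_cmult)
  also have "\<dots> = (\<integral>\<^sup>+y. ennreal (\<eta> y) * u y * indicator (- {c}) y \<partial>transition t x)"
  proof (rule nn_integral_cong)
    fix y
    have "exp (- lambda0 * t) * (\<eta> x * (exp (lambda0 * t) * \<eta>_alive y / \<eta> x)) = \<eta>_alive y"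
      using \<eta>_pos[OF x] by (simp add: exp_minus field_simps)
    then have "ennreal (exp (- lambda0 * t)) * (ennreal (\<eta> x) * ennreal (exp (lambda0 * t) * \<eta>_alive y / \<eta> x)) = ennreal (\<eta>_alive y)"
      using \<eta>_pos[OF x] \<eta>_alive_nonneg[of y] by (simp flip: ennreal_mult)
    then have "ennreal (exp (- lambda0 * t)) * (ennreal (\<eta> x) * (ennreal (exp (lambda0 * t) * \<eta>_alive y / \<eta> x) * u y)) = ennreal (\<eta>_alive y) * u y"
      by (metis mult.assoc)
    then show "ennreal (exp (- lambda0 * t)) * (ennreal (\<eta> x) * (ennreal (exp (lambda0 * t) * \<eta>_alive y / \<eta> x) * u y))
        = ennreal (\<eta> y) * u y * indicator (- {c}) y"
      by (auto simp: \<eta>_alive_def split: split_indicator)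
  qed
  finally show ?thesis .
qed

text \<open>Integrating \<open>transition_via_doob\<close> against \<alpha> produces the killed law
  of \<alpha>, whose decay factor is the same as that of \<eta>. The common factor is carried along
  on both sides and cancelled at the end.\<close>

lemma doob_stationary:
  assumes t: "0 \<le> t"
  shows "\<pi> \<bind> doob t = \<pi>"
proof (rule measure_eqI)
  have d: "\<pi> \<in> space (prob_algebra borel)"
    by (simp add: space_prob_algebra prob_space_\<pi> sets_\<pi>)
  show "sets (\<pi> \<bind> doob t) = sets \<pi>"
    by (simp add: sets_bind'[OF d doob_kernel] sets_\<pi>)
  fix A assume "A \<in> sets (\<pi> \<bind> doob t)"
  then have A[measurable]: "A \<in> sets borel"
    by (simp add: sets_bind'[OF d doob_kernel])
  note [measurable] = emeasure_doob_measurable[OF A]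
  have "ennreal (exp (- lambda0 * t)) * emeasure (\<pi> \<bind> doob t) A
      = ennreal (exp (- lambda0 * t)) * (\<integral>\<^sup>+x. ennreal (\<eta> x) * emeasure (doob t x) A \<partial>\<alpha>)"
    by (simp add: emeasure_bind_prob_algebra[OF d doob_kernel A] nn_integral_\<pi>)
  also have "\<dots> = (\<integral>\<^sup>+x. ennreal (exp (- lambda0 * t)) * (ennreal (\<eta> x) * emeasure (doob t x) A) \<partial>\<alpha>)"
    by (rule nn_integral_cmult[symmetric]) measurable
  also have "\<dots> = (\<integral>\<^sup>+x. \<integral>\<^sup>+y. ennreal (\<eta> y) * indicator A y * indicator (- {c}) y \<partial>transition t x \<partial>\<alpha>)"
  proof (rule nn_integral_cong_AE)
    show "AE x in \<alpha>. ennreal (exp (- lambda0 * t)) * (ennreal (\<eta> x) * emeasure (doob t x) A)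
       = (\<integral>\<^sup>+y. ennreal (\<eta> y) * indicator A y * indicator (- {c}) y \<partial>transition t x)"
      using AE_\<alpha> by eventually_elim (use transition_via_doob[OF _ t, of _ "indicator A"] in simp)
  qed
  also have "\<dots> = (\<integral>\<^sup>+y. ennreal (\<eta> y) * indicator A y \<partial>killed_law \<F> P X c \<alpha> t)"
    by (rule nn_integral_killed_law[OF prob_space_\<alpha> sets_\<alpha> t, symmetric]) measurable
  also have "\<dots> = ennreal (exp (- lambda0 * t)) * (\<integral>\<^sup>+y. ennreal (\<eta> y) * indicator A y \<partial>\<alpha>)"
    unfolding killed_law_\<alpha>[OF t] by (rule nn_integral_scale_measure) measurable
  also have "(\<integral>\<^sup>+y. ennreal (\<eta> y) * indicator A y \<partial>\<alpha>) = emeasure \<pi> A"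
    unfolding \<pi>_eq by (subst emeasure_density) auto
  finally show "emeasure (\<pi> \<bind> doob t) A = emeasure \<pi> A"
    by (simp add: ennreal_mult_cancel_left)
qed

sublocale doob: stationary_semigroup borel \<pi> doob
proof (rule stationary_semigroup.intro)
  show "doob (s + t) x = doob s x \<bind> doob t" if "0 \<le> s" "0 \<le> t" for s t x
    using that by (rule doob_semigroup)
qed (fact doob_measurable prob_space_\<pi> sets_\<pi> doob_stationary)+

end

locale qsd_poincare = qsd_eigenfunction \<F> P X c \<alpha> \<eta> lambda0
  for \<F> :: "'w measure" and P :: "'a::metric_space \<Rightarrow> 'w measure" and X :: "real \<Rightarrow> 'w \<Rightarrow> 'a" and c :: 'a
    and \<alpha> :: "'a measure" and \<eta> :: "'a \<Rightarrow> real" and lambda0 :: real +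
  fixes C :: real
  assumes C_pos: "0 < C"
    and poincare_generator:
      "\<lbrakk>f \<in> borel_measurable borel; (\<lambda>x. f x * \<eta> x) \<in> generator_domain \<F> P X c;
        integrable (reweight \<eta> \<alpha>) (\<lambda>x. (f x)\<^sup>2);
        integrable \<alpha> (\<lambda>x. f x * generator \<F> P X c (\<lambda>y. f y * \<eta> y) x)\<rbrakk>
       \<Longrightarrow> Var (reweight \<eta> \<alpha>) f \<le>
         - C * (\<integral>x. f x * (lambda0 * f x * \<eta> x + generator \<F> P X c (\<lambda>y. f y * \<eta> y) x) \<partial>\<alpha>)"
begin

lemma integral_doob:
  fixes f :: "'a \<Rightarrow> real"
  assumes x: "x \<noteq> c" and t: "0 \<le> t" and [measurable]: "f \<in> borel_measurable borel"
    and B: "\<And>x. \<bar>f x\<bar> \<le> B"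
  shows "integrable (P x) (\<lambda>\<omega>. f (X t \<omega>) * \<eta> (X t \<omega>) * indicator (alive \<F> X c t) \<omega>)"
    and "killed_semigroup \<F> P X c t (\<lambda>y. f y * \<eta> y) x = exp (- lambda0 * t) * (\<eta> x * (\<integral>y. f y \<partial>doob t x))"
proof -
  have eq: "(\<lambda>y. f y * \<eta> y * indicator (- {c}) y) = (\<lambda>y. f y * \<eta>_alive y)"
    by (simp add: \<eta>_alive_def mult.assoc)
  have "integrable (transition t x) (\<lambda>y. f y * \<eta>_alive y)"
  proof (rule Bochner_Integration.integrable_bound)
    show "integrable (transition t x) (\<lambda>y. B * \<eta>_alive y)"
      using \<eta>_alive_transition(1)[OF x t] by simp
    show "AE y in transition t x. norm (f y * \<eta>_alive y) \<le> norm (B * \<eta>_alive y)"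
      using B by (intro AE_I2) (simp add: abs_mult mult_right_mono order_trans[OF _ abs_ge_self])
  qed measurable
  then show "integrable (P x) (\<lambda>\<omega>. f (X t \<omega>) * \<eta> (X t \<omega>) * indicator (alive \<F> X c t) \<omega>)"
    using killed_semigroup_eq(2)[OF t, of "\<lambda>y. f y * \<eta> y" x] by (simp add: eq)
  have "(\<integral>y. f y \<partial>doob t x) = (\<integral>y. exp (lambda0 * t) * \<eta>_alive y / \<eta> x * f y \<partial>transition t x)"
    using x t \<eta>_pos[OF x] \<eta>_alive_nonneg unfolding doob_def by (simp add: integral_density)
  also have "\<dots> = exp (lambda0 * t) / \<eta> x * (\<integral>y. f y * \<eta>_alive y \<partial>transition t x)"
    by (simp add: mult.commute mult.left_commute flip: integral_mult_right_zero)
  finally show "killed_semigroup \<F> P X c t (\<lambda>y. f y * \<eta> y) x = exp (- lambda0 * t) * (\<eta> x * (\<integral>y. f y \<partial>doob t x))"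
    using killed_semigroup_eq(1)[OF t, of "\<lambda>y. f y * \<eta> y" x] \<eta>_pos[OF x] by (simp add: eq exp_minus)
qed

text \<open>The product rule at time 0 for P_t(f \<eta>) = e^(-\<lambda> t) \<eta> Q_t f.\<close>

lemma killed_generator_limit:
  fixes f :: "'a \<Rightarrow> real" and l :: real
  assumes x: "x \<noteq> c" and f: "f \<in> borel_measurable borel" and B: "\<And>x. \<bar>f x\<bar> \<le> B"
    and lim: "((\<lambda>t. ((\<integral>y. f y \<partial>doob t x) - f x) / t) \<longlongrightarrow> l) (at_right 0)"
  shows "((\<lambda>t. (killed_semigroup \<F> P X c t (\<lambda>y. f y * \<eta> y) x - f x * \<eta> x) / t)
    \<longlongrightarrow> \<eta> x * (l - lambda0 * f x)) (at_right 0)"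
proof -
  have "((\<lambda>t. exp (- lambda0 * t)) has_real_derivative - lambda0) (at 0)"
    by (auto intro!: derivative_eq_intros)
  then have e: "((\<lambda>t. (exp (- lambda0 * t) - 1) / t) \<longlongrightarrow> - lambda0) (at_right 0)"
    unfolding DERIV_def by (simp add: filterlim_at_split)
  have e0: "((\<lambda>t. exp (- lambda0 * t)) \<longlongrightarrow> exp (- lambda0 * 0)) (at_right 0)"
    by (intro tendsto_intros)
  have "((\<lambda>t. \<eta> x * (exp (- lambda0 * t) * (((\<integral>y. f y \<partial>doob t x) - f x) / t) + f x * ((exp (- lambda0 * t) - 1) / t)))
      \<longlongrightarrow> \<eta> x * (exp (- lambda0 * 0) * l + f x * (- lambda0))) (at_right 0)"
    by (intro tendsto_intros lim e e0)
  moreover have "\<forall>\<^sub>F t in at_right 0.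
      \<eta> x * (exp (- lambda0 * t) * (((\<integral>y. f y \<partial>doob t x) - f x) / t) + f x * ((exp (- lambda0 * t) - 1) / t))
      = (killed_semigroup \<F> P X c t (\<lambda>y. f y * \<eta> y) x - f x * \<eta> x) / t"
    using eventually_at_right_less[of "0::real"]
  proof eventually_elim
    case (elim t)
    then have t: "0 \<le> t" by simp
    show ?case unfolding integral_doob(2)[OF x t f B] using elim by (simp add: field_simps)
  qed
  ultimately show ?thesis
    by (auto dest: Lim_transform_eventually simp: algebra_simps)
qed

text \<open>The zeroth-order term in the hypothesis cancels the one in
  \<open>killed_generator_limit\<close> and leaves \<eta> g, so the \<alpha>-integral becomes a
  \<pi>-integral. The bounds on \<open>f\<close> and \<open>g\<close> supply the integrability
  conditions of the hypothesis.\<close>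

lemma doob_poincare:
  fixes f g :: "'a \<Rightarrow> real"
  assumes f[measurable]: "f \<in> borel_measurable borel" and g[measurable]: "g \<in> borel_measurable borel"
    and B: "\<And>x. \<bar>f x\<bar> \<le> B" and B': "\<And>x. \<bar>g x\<bar> \<le> B'"
    and lim: "\<And>x. ((\<lambda>t. ((\<integral>y. f y \<partial>doob t x) - f x) / t) \<longlongrightarrow> g x) (at_right 0)"
  shows "(\<integral>x. (f x - (\<integral>y. f y \<partial>\<pi>))\<^sup>2 \<partial>\<pi>) \<le> - C * (\<integral>x. f x * g x \<partial>\<pi>)"
proof -
  let ?q = "\<lambda>y. f y * \<eta> y"
  let ?L = "generator \<F> P X c ?q"
  have L: "?L x = \<eta> x * (g x - lambda0 * f x)" if "x \<noteq> c" for x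
    unfolding generator_def using killed_generator_limit[OF that f B lim] by (intro tendsto_Lim) auto
  have L_measurable[measurable]: "?L \<in> borel_measurable borel"
  proof -
    \<comment> \<open>The generator at \<open>c\<close> is one unspecified real number; splitting it
      off leaves a formula that is visibly measurable.\<close>
    have "?L = (\<lambda>x. if x = c then ?L c else \<eta> x * (g x - lambda0 * f x))"
      using L by auto
    moreover have "(\<lambda>x. if x = c then ?L c else \<eta> x * (g x - lambda0 * f x)) \<in> borel_measurable borel"
      by measurable
    ultimately show ?thesis by simp
  qed
  have dom: "?q \<in> generator_domain \<F> P X c"
    unfolding generator_domain_def
  proof (intro CollectI conjI allI impI)
    fix x assume x: "x \<noteq> c"
    show "\<forall>\<^sub>F t in at_right 0. integrable (P x) (\<lambda>\<omega>. f (X t \<omega>) * \<eta> (X t \<omega>) * indicator (alive \<F> X c t) \<omega>)"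
      using eventually_at_right_less[of "0::real"]
      by eventually_elim (intro integral_doob(1)[OF x _ f B], simp)
    show "\<exists>l. ((\<lambda>t. (killed_semigroup \<F> P X c t ?q x - f x * \<eta> x) / t) \<longlongrightarrow> l) (at_right 0)"
      using killed_generator_limit[OF x f B lim] by blast
  qed measurable
  have sq: "integrable \<pi> (\<lambda>x. (f x)\<^sup>2)"
    using power_mono[OF B, of _ 2] by (intro doob.integrable_bounded[of _ "B\<^sup>2"]) auto
  have fg: "integrable \<alpha> (\<lambda>x. \<eta> x * (f x * g x))"
  proof -
    have "\<bar>f x * g x\<bar> \<le> B * B'" for x
      using mult_mono[OF B B'] order_trans[OF abs_ge_zero B] by (simp add: abs_mult)
    then have "integrable \<pi> (\<lambda>x. f x * g x)"
      by (intro doob.integrable_bounded[of _ "B * B'"]) auto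
    then show ?thesis by (subst (asm) integral_\<pi>(2)) auto
  qed
  have ff: "integrable \<alpha> (\<lambda>x. \<eta> x * (f x)\<^sup>2)"
    using sq by (subst (asm) integral_\<pi>(2)) auto
  have "integrable \<alpha> (\<lambda>x. \<eta> x * (f x * g x) - lambda0 * (\<eta> x * (f x)\<^sup>2))"
    using fg ff by simp
  then have fL: "integrable \<alpha> (\<lambda>x. f x * ?L x)"
  proof (rule integrable_cong_AE_imp)
    show "AE x in \<alpha>. \<eta> x * (f x * g x) - lambda0 * (\<eta> x * (f x)\<^sup>2) = f x * ?L x"
      using AE_\<alpha>
    proof eventually_elim
      case (elim x)
      show ?case unfolding L[OF elim] by (simp add: power2_eq_square algebra_simps)
    qed
  qed measurable
  have "Var \<pi> f \<le> - C * (\<integral>x. f x * (lambda0 * f x * \<eta> x + ?L x) \<partial>\<alpha>)"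
    by (rule poincare_generator[OF f dom sq fL])
  also have "(\<integral>x. f x * (lambda0 * f x * \<eta> x + ?L x) \<partial>\<alpha>) = (\<integral>x. \<eta> x * (f x * g x) \<partial>\<alpha>)"
  proof (rule integral_cong_AE)
    show "AE x in \<alpha>. f x * (lambda0 * f x * \<eta> x + ?L x) = \<eta> x * (f x * g x)"
      using AE_\<alpha>
    proof eventually_elim
      case (elim x)
      show ?case unfolding L[OF elim] by (simp add: algebra_simps)
    qed
  qed measurable
  also have "\<dots> = (\<integral>x. f x * g x \<partial>\<pi>)"
    by (subst integral_\<pi>(1)) auto
  finally show ?thesis by (simp add: Var_def)
qed

sublocale doob: poincare_semigroup borel \<pi> doob C
proof unfold_locales
  fix f g :: "'a \<Rightarrow> real" and B B' :: real
  assume f: "f \<in> borel_measurable borel" and g: "g \<in> borel_measurable borel"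
    and B: "\<And>x. x \<in> space borel \<Longrightarrow> \<bar>f x\<bar> \<le> B" and B': "\<And>x. x \<in> space borel \<Longrightarrow> \<bar>g x\<bar> \<le> B'"
    and lim: "\<And>x. x \<in> space borel \<Longrightarrow> ((\<lambda>t. ((\<integral>y. f y \<partial>doob t x) - f x) / t) \<longlongrightarrow> g x) (at_right 0)"
  show "(\<integral>x. (f x - (\<integral>y. f y \<partial>\<pi>))\<^sup>2 \<partial>\<pi>) \<le> - C * (\<integral>x. f x * g x \<partial>\<pi>)"
    by (rule doob_poincare[OF f g B B' lim]) simp_all
qed (fact C_pos)

text \<open>For \<open>u\<close> the indicator of \<open>A\<close> divided by \<eta>, the product
  \<eta> u is that indicator, so survival in \<open>A\<close> is expressed through
  \<open>doob\<close>. Absorbing \<eta> into the reweighted initial law brings out \<open>m\<close>;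
  at the terminal time the \<eta> in \<pi> cancels the one in \<open>u\<close>, leaving
  \<open>k\<close> as a density with respect to \<alpha>.\<close>

lemma killed_law_via_doob:
  assumes \<mu>: "prob_on_E c \<mu>" and t: "0 \<le> t" and m: "(\<integral>\<^sup>+x. ennreal (\<eta> x) \<partial>\<mu>) = ennreal m" "0 < m"
    and \<nu>_prob: "prob_space (reweight \<eta> \<mu>)"
    and k[measurable]: "k \<in> borel_measurable borel" and k_nonneg: "\<And>x. 0 \<le> k x"
    and k_eq: "reweight \<eta> \<mu> \<bind> doob t = density \<pi> (\<lambda>x. ennreal (k x))"
    and A[measurable]: "A \<in> sets borel"
  shows "emeasure (killed_law \<F> P X c \<mu> t) A
    = ennreal (exp (- lambda0 * t) * m) * (\<integral>\<^sup>+x. ennreal (k x) * indicator A x \<partial>\<alpha>)"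
proof -
  have p: "prob_space \<mu>" and sets_\<mu>[measurable_cong]: "sets \<mu> = sets borel"
    using \<mu> by (auto simp: prob_on_E_def)
  note AE_\<mu> = prob_on_E_AE[OF \<mu>]
  define u where "u y = (if y = c then 0 else ennreal (1 / \<eta> y)) * indicator A y" for y
  have [measurable]: "u \<in> borel_measurable borel" unfolding u_def by measurable
  have \<eta>u: "ennreal (\<eta> y) * u y = indicator A y" if "y \<noteq> c" for y
    using \<eta>_pos[OF that] that by (auto simp: u_def ennreal_1 split: split_indicator simp flip: ennreal_mult)
  have [measurable]: "(\<lambda>x. \<integral>\<^sup>+y. u y \<partial>doob t x) \<in> borel_measurable borel"
    by (rule measurable_compose[OF measurable_prob_algebraD[OF doob_kernel] nn_integral_measurable_subprob_algebra]) measurable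
  have "emeasure (killed_law \<F> P X c \<mu> t) A = (\<integral>\<^sup>+y. indicator A y \<partial>killed_law \<F> P X c \<mu> t)"
    by (simp add: sets_killed_law[OF p sets_\<mu> t])
  also have "\<dots> = (\<integral>\<^sup>+x. \<integral>\<^sup>+y. indicator A y * indicator (- {c}) y \<partial>transition t x \<partial>\<mu>)"
    by (rule nn_integral_killed_law[OF p sets_\<mu> t]) measurable
  also have "\<dots> = (\<integral>\<^sup>+x. ennreal (exp (- lambda0 * t)) * (ennreal (\<eta> x) * (\<integral>\<^sup>+y. u y \<partial>doob t x)) \<partial>\<mu>)"
  proof (rule nn_integral_cong_AE)
    show "AE x in \<mu>. (\<integral>\<^sup>+y. indicator A y * indicator (- {c}) y \<partial>transition t x)
      = ennreal (exp (- lambda0 * t)) * (ennreal (\<eta> x) * (\<integral>\<^sup>+y. u y \<partial>doob t x))"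
      using AE_\<mu>
    proof eventually_elim
      case (elim x)
      have "ennreal (exp (- lambda0 * t)) * (ennreal (\<eta> x) * (\<integral>\<^sup>+y. u y \<partial>doob t x))
          = (\<integral>\<^sup>+y. ennreal (\<eta> y) * u y * indicator (- {c}) y \<partial>transition t x)"
        by (rule transition_via_doob[OF elim t]) measurable
      also have "\<dots> = (\<integral>\<^sup>+y. indicator A y * indicator (- {c}) y \<partial>transition t x)"
        by (intro nn_integral_cong) (auto simp: \<eta>u split: split_indicator)
      finally show ?case by simp
    qed
  qed
  also have "\<dots> = (\<integral>\<^sup>+x. ennreal (exp (- lambda0 * t) * m) * ((ennreal (\<eta> x) / ennreal m) * (\<integral>\<^sup>+y. u y \<partial>doob t x)) \<partial>\<mu>)"
  proof (rule nn_integral_cong)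
    fix x
    have "ennreal (exp (- lambda0 * t) * m) * (ennreal (\<eta> x) / ennreal m)
       = ennreal (exp (- lambda0 * t)) * ennreal (\<eta> x)"
    proof -
      have "ennreal m * (ennreal (\<eta> x) / ennreal m) = ennreal (\<eta> x)"
        using m(2) by (simp add: ennreal_times_divide mult.commute[of "ennreal m"] mult_divide_eq_ennreal)
      moreover have "ennreal (exp (- lambda0 * t) * m) = ennreal (exp (- lambda0 * t)) * ennreal m"
        using m(2) by (intro ennreal_mult) auto
      ultimately show ?thesis by (simp only: mult.assoc)
    qed
    then show "ennreal (exp (- lambda0 * t)) * (ennreal (\<eta> x) * (\<integral>\<^sup>+y. u y \<partial>doob t x))
        = ennreal (exp (- lambda0 * t) * m) * ((ennreal (\<eta> x) / ennreal m) * (\<integral>\<^sup>+y. u y \<partial>doob t x))"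
      by (metis mult.assoc)
  qed
  also have "\<dots> = ennreal (exp (- lambda0 * t) * m) * (\<integral>\<^sup>+x. (\<integral>\<^sup>+y. u y \<partial>doob t x) \<partial>reweight \<eta> \<mu>)"
    unfolding reweight_def m(1) by (simp add: nn_integral_cmult nn_integral_density)
  also have "(\<integral>\<^sup>+x. (\<integral>\<^sup>+y. u y \<partial>doob t x) \<partial>reweight \<eta> \<mu>) = (\<integral>\<^sup>+y. u y \<partial>(reweight \<eta> \<mu> \<bind> doob t))"
    using measurable_prob_algebraD[OF doob_kernel]
    by (intro nn_integral_bind[of _ borel, symmetric]) (auto cong: measurable_cong_sets simp: reweight_def sets_\<mu>)
  also have "\<dots> = (\<integral>\<^sup>+x. ennreal (\<eta> x) * (ennreal (k x) * u x) \<partial>\<alpha>)"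
    unfolding k_eq by (simp add: nn_integral_density nn_integral_\<pi> sets_\<pi> cong: measurable_cong_sets)
  also have "\<dots> = (\<integral>\<^sup>+x. ennreal (k x) * indicator A x \<partial>\<alpha>)"
  proof (rule nn_integral_cong_AE)
    show "AE x in \<alpha>. ennreal (\<eta> x) * (ennreal (k x) * u x) = ennreal (k x) * indicator A x"
      using AE_\<alpha> by eventually_elim (use \<eta>u in \<open>metis mult.left_commute\<close>)
  qed
  finally show ?thesis .
qed

section \<open>Reweighted initial laws and their densities\<close>

lemma prob_space_reweight:
  assumes \<mu>: "prob_on_E c \<mu>" and m: "(\<integral>\<^sup>+x. ennreal (\<eta> x) \<partial>\<mu>) \<noteq> \<infinity>"
  shows "0 < (\<integral>\<^sup>+x. ennreal (\<eta> x) \<partial>\<mu>)" and "prob_space (reweight \<eta> \<mu>)"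
proof -
  have p: "prob_space \<mu>" and sets_\<mu>[measurable_cong]: "sets \<mu> = sets borel"
    using \<mu> by (auto simp: prob_on_E_def)
  interpret prob_space \<mu> by (rule p)
  note AE_\<mu> = prob_on_E_AE[OF \<mu>]
  have "(\<integral>\<^sup>+x. ennreal (\<eta> x) \<partial>\<mu>) \<noteq> 0"
  proof
    assume "(\<integral>\<^sup>+x. ennreal (\<eta> x) \<partial>\<mu>) = 0"
    then have "AE x in \<mu>. ennreal (\<eta> x) = 0" by (subst (asm) nn_integral_0_iff_AE) auto
    then have "AE x in \<mu>. False"
      using AE_\<mu> by eventually_elim (use \<eta>_pos in force)
    then show False by simp
  qed
  then show pos: "0 < (\<integral>\<^sup>+x. ennreal (\<eta> x) \<partial>\<mu>)" by (simp add: zero_less_iff_neq_zero)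
  show "prob_space (reweight \<eta> \<mu>)"
  proof
    have "emeasure (reweight \<eta> \<mu>) (space (reweight \<eta> \<mu>)) = (\<integral>\<^sup>+x. ennreal (\<eta> x) / (\<integral>\<^sup>+y. ennreal (\<eta> y) \<partial>\<mu>) \<partial>\<mu>)"
      unfolding reweight_def by (subst emeasure_density) (auto intro!: nn_integral_cong)
    also have "\<dots> = (\<integral>\<^sup>+x. ennreal (\<eta> x) \<partial>\<mu>) / (\<integral>\<^sup>+x. ennreal (\<eta> x) \<partial>\<mu>)"
      by (rule nn_integral_divide) measurable
    also have "\<dots> = 1"
      using pos m by (intro ennreal_divide_self) (auto simp: less_top)
    finally show "emeasure (reweight \<eta> \<mu>) (space (reweight \<eta> \<mu>)) = 1" .
  qed
qed

text \<open>By stationarity, \<open>doob t x\<close> gives no mass to a \<pi>-null set for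
  \<pi>-almost every, hence \<nu>-almost every, \<open>x\<close>. This is what provides a density of
  the evolved law.\<close>

lemma absolutely_continuous_doob:
  assumes \<nu>: "prob_space \<nu>" "sets \<nu> = sets borel" and ac: "absolutely_continuous \<pi> \<nu>" and t: "0 \<le> t"
  shows "absolutely_continuous \<pi> (\<nu> \<bind> doob t)"
  unfolding absolutely_continuous_def
proof
  have n: "\<nu> \<in> space (prob_algebra borel)" and p: "\<pi> \<in> space (prob_algebra borel)"
    using \<nu> prob_space_\<pi> sets_\<pi> by (auto simp: space_prob_algebra)
  fix A assume "A \<in> null_sets \<pi>"
  then have A: "A \<in> sets borel" and "emeasure (\<pi> \<bind> doob t) A = 0"
    by (auto simp: null_sets_def sets_\<pi> doob_stationary[OF t])
  then have "(\<integral>\<^sup>+x. emeasure (doob t x) A \<partial>\<pi>) = 0"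
    by (simp add: emeasure_bind_prob_algebra[OF p doob_kernel])
  then have "AE x in \<pi>. emeasure (doob t x) A = 0"
    using emeasure_doob_measurable[OF A] by (subst (asm) nn_integral_0_iff_AE) (auto cong: measurable_cong_sets simp: sets_\<pi>)
  then have "AE x in \<nu>. emeasure (doob t x) A = 0"
    by (rule absolutely_continuous_AE[OF _ ac, rotated]) (simp add: \<nu>(2) sets_\<pi>)
  then have "emeasure (\<nu> \<bind> doob t) A = 0"
    using emeasure_doob_measurable[OF A]
    by (subst emeasure_bind_prob_algebra[OF n doob_kernel A], subst nn_integral_0_iff_AE)
      (auto cong: measurable_cong_sets simp: \<nu>(2))
  then show "A \<in> null_sets (\<nu> \<bind> doob t)"
    using A by (simp add: null_sets_def sets_bind'[OF n doob_kernel])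
qed

text \<open>\<open>enn2real\<close> would send an infinite derivative to 0; total mass 1 confines
  infinite values to a null set.\<close>

lemma real_density:
  assumes \<nu>: "prob_space \<nu>" "sets \<nu> = sets borel" and ac: "absolutely_continuous \<pi> \<nu>"
  shows "\<nu> = density \<pi> (\<lambda>x. ennreal (enn2real (RN_deriv \<pi> \<nu> x)))"
proof -
  have eq: "density \<pi> (RN_deriv \<pi> \<nu>) = \<nu>"
    using ac by (rule doob.density_RN_deriv) (simp add: \<nu>(2) sets_\<pi>)
  then have "(\<integral>\<^sup>+x. RN_deriv \<pi> \<nu> x \<partial>\<pi>) = 1"
    using \<nu>(1) by (intro prob_space_density_nn_integral) auto
  then have "AE x in \<pi>. RN_deriv \<pi> \<nu> x \<noteq> \<infinity>"
    by (intro nn_integral_noteq_infinite) auto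
  then have "density \<pi> (RN_deriv \<pi> \<nu>) = density \<pi> (\<lambda>x. ennreal (enn2real (RN_deriv \<pi> \<nu> x)))"
    by (intro density_cong) (auto simp: less_top)
  then show ?thesis using eq by simp
qed

theorem W1_conditional_law_decay:
  fixes x\<^sub>0 :: 'a
  assumes moment: "integrable \<alpha> (\<lambda>x. 1 + dist x x\<^sub>0)"
    and moment2: "integrable \<alpha> (\<lambda>x. (1 + dist x x\<^sub>0)\<^sup>2 / \<eta> x)"
    and \<mu>: "prob_on_E c \<mu>"
  shows "\<exists>t\<^sub>\<mu>\<ge>0. \<forall>t\<ge>t\<^sub>\<mu>. W1 (conditional_law \<F> P X c \<mu> t) \<alpha> \<le>
    ennreal ((2 + 2 * (\<integral>x. 1 + dist x x\<^sub>0 \<partial>\<alpha>)) * sqrt (\<integral>x. (1 + dist x x\<^sub>0)\<^sup>2 / \<eta> x \<partial>\<alpha>))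
    * (if (\<integral>\<^sup>+x. ennreal (\<eta> x) \<partial>\<mu>) = \<infinity> then \<infinity> else chi2 (reweight \<eta> \<mu>) (reweight \<eta> \<alpha>))
    * ennreal (exp (- t / C))"
proof -
  have [measurable]: "(\<lambda>x::'a. dist x x\<^sub>0) \<in> borel_measurable borel"
    by (intro borel_measurable_continuous_onI continuous_intros)
  have p: "prob_space \<mu>" and sets_\<mu>[measurable_cong]: "sets \<mu> = sets borel"
    using \<mu> by (auto simp: prob_on_E_def)
  define \<psi> where "\<psi> x = 1 + dist x x\<^sub>0" for x
  have \<psi>: "1 \<le> \<psi> x" for x by (simp add: \<psi>_def)
  have [measurable]: "\<psi> \<in> borel_measurable borel" unfolding \<psi>_def by measurable
  define S where "S = sqrt (\<integral>x. (\<psi> x)\<^sup>2 / \<eta> x \<partial>\<alpha>)"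
  define X2 where "X2 = (if (\<integral>\<^sup>+x. ennreal (\<eta> x) \<partial>\<mu>) = \<infinity> then \<infinity> else chi2 (reweight \<eta> \<mu>) \<pi>)"
  have int2: "integrable \<alpha> (\<lambda>x. (\<psi> x)\<^sup>2 / \<eta> x)" using moment2 by (simp add: \<psi>_def)
  have "AE x in \<alpha>. 0 \<le> (\<psi> x)\<^sup>2 / \<eta> x"
    using AE_\<alpha> by eventually_elim (simp add: \<eta>_pos less_imp_le)
  \<comment> \<open>In \<open>ennreal\<close> zero times infinity is 0, so strict positivity is
    required for the right-hand side to be infinite when \<open>X2\<close> is.\<close>
  have S_pos: "0 < S"
  proof -
    have ne: "(\<integral>x. (\<psi> x)\<^sup>2 / \<eta> x \<partial>\<alpha>) \<noteq> 0"
    proof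
      assume "(\<integral>x. (\<psi> x)\<^sup>2 / \<eta> x \<partial>\<alpha>) = 0"
      then have "AE x in \<alpha>. (\<psi> x)\<^sup>2 / \<eta> x = 0"
        using integral_nonneg_eq_0_iff_AE[OF int2 \<open>AE x in \<alpha>. 0 \<le> (\<psi> x)\<^sup>2 / \<eta> x\<close>] by simp
      then have "AE x in \<alpha>. False"
        using AE_\<alpha>
      proof eventually_elim
        case (elim x)
        then show ?case using \<eta>_pos[of x] \<psi>[of x] by auto
      qed
      then show False
        using prob_space.AE_False[OF prob_space_\<alpha>] by simp
    qed
    then show ?thesis
      using integral_nonneg_AE[OF \<open>AE x in \<alpha>. 0 \<le> (\<psi> x)\<^sup>2 / \<eta> x\<close>] by (simp add: S_def less_le)
  qed
  have \<psi>_int: "0 \<le> (\<integral>x. \<psi> x \<partial>\<alpha>)"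
    by (intro Bochner_Integration.integral_nonneg) (simp add: \<psi>_def)
  have "\<exists>t\<^sub>\<mu>\<ge>0. \<forall>t\<ge>t\<^sub>\<mu>. W1 (conditional_law \<F> P X c \<mu> t) \<alpha>
    \<le> ennreal ((2 + 2 * (\<integral>x. \<psi> x \<partial>\<alpha>)) * S) * X2 * ennreal (exp (- t / C))"
  proof (cases "X2 = \<infinity>")
    case True
    have "ennreal ((2 + 2 * (\<integral>x. \<psi> x \<partial>\<alpha>)) * S) \<noteq> 0"
      using S_pos \<psi>_int by (simp add: ennreal_eq_0_iff not_le zero_less_mult_iff)
    then have "ennreal ((2 + 2 * (\<integral>x. \<psi> x \<partial>\<alpha>)) * S) * X2 * ennreal (exp (- t / C)) = \<infinity>" for t
      using True by (simp add: ennreal_mult_top ennreal_top_mult ennreal_mult_eq_top_iff)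
    then show ?thesis by (intro exI[of _ 0]) simp
  next
    case False
    define \<nu> where "\<nu> = reweight \<eta> \<mu>"
    have m_fin: "(\<integral>\<^sup>+x. ennreal (\<eta> x) \<partial>\<mu>) \<noteq> \<infinity>" and chi_fin: "chi2 \<nu> \<pi> \<noteq> \<infinity>" and X2: "X2 = chi2 \<nu> \<pi>"
      using False by (auto simp: X2_def \<nu>_def split: if_splits)
    obtain m where m: "(\<integral>\<^sup>+x. ennreal (\<eta> x) \<partial>\<mu>) = ennreal m" "0 < m"
      using prob_space_reweight(1)[OF \<mu> m_fin] m_fin
      by (cases "(\<integral>\<^sup>+x. ennreal (\<eta> x) \<partial>\<mu>)") (auto simp: less_le)
    have \<nu>: "prob_space \<nu>" "sets \<nu> = sets borel"
      using prob_space_reweight(2)[OF \<mu> m_fin] by (auto simp: \<nu>_def reweight_def sets_\<mu>)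
    have ac: "absolutely_continuous \<pi> \<nu>"
      using chi_fin by (auto simp: chi2_def split: if_splits)
    define g where "g x = enn2real (RN_deriv \<pi> \<nu> x)" for x
    have g[measurable]: "g \<in> borel_measurable borel"
      unfolding g_def using borel_measurable_RN_deriv[of \<pi> \<nu>] by (simp cong: measurable_cong_sets add: sets_\<pi>)
    have \<nu>_eq: "\<nu> = density \<pi> (\<lambda>x. ennreal (g x))"
      unfolding g_def by (rule real_density[OF \<nu> ac])
    have chi: "chi2 \<nu> \<pi> = ennreal_sqrt (\<integral>\<^sup>+x. ennreal ((g x - 1)\<^sup>2) \<partial>\<pi>)"
      using ac by (simp add: chi2_def g_def)
    have nn_fin: "(\<integral>\<^sup>+x. ennreal ((g x - 1)\<^sup>2) \<partial>\<pi>) \<noteq> \<infinity>"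
      using chi_fin unfolding chi by (auto simp: ennreal_sqrt_def)
    have g_sq: "integrable \<pi> (\<lambda>x. (g x - 1)\<^sup>2)"
      using nn_fin by (intro integrableI_nonneg) (auto simp: less_top cong: measurable_cong_sets simp: sets_\<pi>)
    define dev where "dev = sqrt (\<integral>x. (g x - 1)\<^sup>2 \<partial>\<pi>)"
    have "(\<integral>\<^sup>+x. ennreal ((g x - 1)\<^sup>2) \<partial>\<pi>) = ennreal (\<integral>x. (g x - 1)\<^sup>2 \<partial>\<pi>)"
      by (rule nn_integral_eq_integral[OF g_sq]) simp
    then have X2_eq: "X2 = ennreal dev"
      unfolding X2 chi ennreal_sqrt_def dev_def by (simp add: integral_nonneg_AE)
    have dev_nonneg: "0 \<le> dev" by (simp add: dev_def)
    \<comment> \<open>Under \<pi> the weight \<psi>/\<eta> acts as \<psi> does under \<alpha>, and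
      its square integrates to \<alpha>(\<psi>^2/\<eta>).\<close>
    define w where "w x = (if x = c then 0 else \<psi> x / \<eta> x)" for x
    have [measurable]: "w \<in> borel_measurable borel" unfolding w_def by measurable
    have w_nonneg: "0 \<le> w x" for x
      using \<eta>_pos[of x] \<psi>[of x] by (auto simp: w_def)
    have w_sq_ae: "AE x in \<alpha>. (\<psi> x)\<^sup>2 / \<eta> x = \<eta> x * (w x)\<^sup>2"
      using AE_\<alpha>
    proof eventually_elim
      case (elim x)
      then show ?case using \<eta>_pos[OF elim] by (simp add: w_def power2_eq_square)
    qed
    have w_sq: "integrable \<pi> (\<lambda>x. (w x)\<^sup>2)"
      by (subst integral_\<pi>(2)) (auto intro: integrable_cong_AE_imp[OF int2 _ w_sq_ae])
    have w_int: "(\<integral>x. (w x)\<^sup>2 \<partial>\<pi>) = (\<integral>x. (\<psi> x)\<^sup>2 / \<eta> x \<partial>\<alpha>)"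
      using w_sq_ae by (subst integral_\<pi>(1)) (auto intro!: integral_cong_AE)
    \<comment> \<open>The threshold comes from \<open>y \<le> exp y\<close> at
      \<open>y = t / C\<close>: once \<open>t / C\<close> is at least \<open>2 * dev * S\<close>, so
      is \<open>exp (t / C)\<close>, which says that \<epsilon> is at most 1/2. The initial law
      enters only through \<open>dev\<close>.\<close>
    have bound: "W1 (conditional_law \<F> P X c \<mu> t) \<alpha>
        \<le> ennreal ((2 + 2 * (\<integral>x. \<psi> x \<partial>\<alpha>)) * S) * X2 * ennreal (exp (- t / C))"
      if t_ge: "C * (2 * dev * S) \<le> t" for t
    proof -
      have t: "0 \<le> t"
        using order_trans[OF _ t_ge, of 0] C_pos dev_nonneg S_pos by simp
      let ?k = "\<lambda>x. enn2real (RN_deriv \<pi> (\<nu> \<bind> doob t) x)"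
      have n: "\<nu> \<in> space (prob_algebra borel)" using \<nu> by (simp add: space_prob_algebra)
      have k: "?k \<in> borel_measurable borel"
        using borel_measurable_RN_deriv[of \<pi> "\<nu> \<bind> doob t"] by (simp cong: measurable_cong_sets add: sets_\<pi>)
      have k_eq: "\<nu> \<bind> doob t = density \<pi> (\<lambda>x. ennreal (?k x))"
        by (rule real_density[OF prob_space_bind'[OF n doob_kernel] sets_bind'[OF n doob_kernel]
              absolutely_continuous_doob[OF \<nu> ac t]])
      define \<epsilon> where "\<epsilon> = dev * exp (- t / C) * S"
      have "2 * dev * S \<le> exp (t / C)"
      proof -
        have "2 * dev * S \<le> t / C" using t_ge C_pos by (simp add: field_simps)
        also have "\<dots> \<le> exp (t / C)" using exp_ge_add_one_self[of "t / C"] by linarith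
        finally show ?thesis .
      qed
      then have \<epsilon>_half: "\<epsilon> \<le> 1 / 2" by (simp add: \<epsilon>_def exp_minus field_simps)
      have "(\<integral>\<^sup>+x. ennreal (w x * \<bar>?k x - 1\<bar>) \<partial>\<pi>) \<le> ennreal \<epsilon>"
        unfolding \<epsilon>_def dev_def S_def w_int[symmetric]
        by (rule doob.density_duality[OF _ w_nonneg w_sq t \<nu>(1) g _ \<nu>_eq g_sq k _ k_eq]) (auto simp: g_def)
      moreover have "(\<integral>\<^sup>+x. ennreal (w x * \<bar>?k x - 1\<bar>) \<partial>\<pi>) = (\<integral>\<^sup>+x. ennreal (\<psi> x * \<bar>?k x - 1\<bar>) \<partial>\<alpha>)"
      proof -
        note [measurable] = k
        have "(\<integral>\<^sup>+x. ennreal (w x * \<bar>?k x - 1\<bar>) \<partial>\<pi>) = (\<integral>\<^sup>+x. ennreal (\<eta> x) * ennreal (w x * \<bar>?k x - 1\<bar>) \<partial>\<alpha>)"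
          by (rule nn_integral_\<pi>) measurable
        also have "\<dots> = (\<integral>\<^sup>+x. ennreal (\<psi> x * \<bar>?k x - 1\<bar>) \<partial>\<alpha>)"
        proof (rule nn_integral_cong_AE)
          show "AE x in \<alpha>. ennreal (\<eta> x) * ennreal (w x * \<bar>?k x - 1\<bar>) = ennreal (\<psi> x * \<bar>?k x - 1\<bar>)"
            using AE_\<alpha>
          proof eventually_elim
            case (elim x)
            have "\<eta> x * (w x * \<bar>?k x - 1\<bar>) = \<psi> x * \<bar>?k x - 1\<bar>"
              using elim \<eta>_pos[OF elim] by (simp add: w_def)
            then show ?case
              using \<eta>_pos[OF elim] w_nonneg[of x] by (metis ennreal_mult' less_imp_le)
          qed
        qed
        finally show ?thesis .
      qed
      ultimately have \<psi>k: "(\<integral>\<^sup>+x. ennreal ((1 + dist x x\<^sub>0) * \<bar>?k x - 1\<bar>) \<partial>\<alpha>) \<le> ennreal \<epsilon>"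
        by (simp add: \<psi>_def)
      have "W1 (conditional_law \<F> P X c \<mu> t) \<alpha> \<le> ennreal ((2 + 2 * (\<integral>x. 1 + dist x x\<^sub>0 \<partial>\<alpha>)) * \<epsilon>)"
      proof (rule W1_conditional_law_le[OF prob_space_\<alpha> sets_\<alpha> p sets_\<mu> t k _ _ _ moment \<psi>k _ \<epsilon>_half])
        show "emeasure (killed_law \<F> P X c \<mu> t) A
            = ennreal (exp (- lambda0 * t) * m) * (\<integral>\<^sup>+x. ennreal (?k x) * indicator A x \<partial>\<alpha>)"
          if "A \<in> sets borel" for A
          using \<nu>(1) k_eq that unfolding \<nu>_def
          by (intro killed_law_via_doob[OF \<mu> t m]) (use k in \<open>auto simp: \<nu>_def\<close>)
      qed (use m(2) dev_nonneg S_pos in \<open>auto simp: \<epsilon>_def\<close>)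
      also have "(2 + 2 * (\<integral>x. 1 + dist x x\<^sub>0 \<partial>\<alpha>)) * \<epsilon> = (2 + 2 * (\<integral>x. \<psi> x \<partial>\<alpha>)) * S * dev * exp (- t / C)"
        by (simp add: \<epsilon>_def \<psi>_def mult_ac)
      also have "ennreal \<dots> = ennreal ((2 + 2 * (\<integral>x. \<psi> x \<partial>\<alpha>)) * S) * X2 * ennreal (exp (- t / C))"
        unfolding X2_eq using S_pos \<psi>_int dev_nonneg by (simp add: ennreal_mult')
      finally show ?thesis .
    qed
    have "0 \<le> C * (2 * dev * S)" using C_pos dev_nonneg S_pos by simp
    then show ?thesis using bound by blast
  qed
  then show ?thesis unfolding X2_def S_def \<psi>_def .
qed

end

theorem corollary1:
  shows "\<exists>a>0. \<exists>b>0.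
    \<forall>(\<F> :: 'w measure) (P :: 'a::metric_space \<Rightarrow> 'w measure) (X :: real \<Rightarrow> 'w \<Rightarrow> 'a) (c :: 'a)
      (\<alpha> :: 'a measure) (\<eta> :: 'a \<Rightarrow> real) (lambda0 :: real) (C\<^sub>P :: real) (x\<^sub>0 :: 'a) (\<psi> :: 'a \<Rightarrow> real).
      absorbed_markov_process \<F> P X c \<longrightarrow>
      lambda0 > 0 \<longrightarrow>
      quasi_stationary \<F> P X c \<alpha> \<longrightarrow>
      (\<forall>t\<ge>0. killed_law \<F> P X c \<alpha> t = scale_measure (ennreal (exp (- lambda0 * t))) \<alpha>) \<longrightarrow>
      \<eta> \<in> borel_measurable borel \<longrightarrow>
      (\<forall>x. x \<noteq> c \<longrightarrow> \<eta> x > 0) \<longrightarrow>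
      integrable \<alpha> \<eta> \<longrightarrow> (\<integral>x. \<eta> x \<partial>\<alpha>) = 1 \<longrightarrow>
      (\<forall>x t. x \<noteq> c \<longrightarrow> 0 \<le> t \<longrightarrow> killed_semigroup \<F> P X c t \<eta> x = exp (- lambda0 * t) * \<eta> x) \<longrightarrow>
      C\<^sub>P > 0 \<longrightarrow>
      (\<forall>f \<in> borel_measurable borel.
         (\<lambda>x. f x * \<eta> x) \<in> generator_domain \<F> P X c \<longrightarrow>
         integrable (reweight \<eta> \<alpha>) (\<lambda>x. (f x)\<^sup>2) \<longrightarrow>
         integrable \<alpha> (\<lambda>x. f x * generator \<F> P X c (\<lambda>y. f y * \<eta> y) x) \<longrightarrow>
         Var (reweight \<eta> \<alpha>) f \<le>
           - C\<^sub>P * (\<integral>x. f x * (lambda0 * f x * \<eta> x + generator \<F> P X c (\<lambda>y. f y * \<eta> y) x) \<partial>\<alpha>)) \<longrightarrow>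
      x\<^sub>0 \<noteq> c \<longrightarrow>
      \<psi> = (\<lambda>x. 1 + dist x x\<^sub>0) \<longrightarrow>
      integrable \<alpha> \<psi> \<longrightarrow>
      integrable \<alpha> (\<lambda>x. (\<psi> x)\<^sup>2 / \<eta> x) \<longrightarrow>
      (\<forall>\<mu>. prob_on_E c \<mu> \<longrightarrow>
        (\<exists>t\<^sub>\<mu>\<ge>0. \<forall>t\<ge>t\<^sub>\<mu>.
          W1 (conditional_law \<F> P X c \<mu> t) \<alpha> \<le>
            ennreal ((a + b * (\<integral>x. \<psi> x \<partial>\<alpha>)) * sqrt (\<integral>x. (\<psi> x)\<^sup>2 / \<eta> x \<partial>\<alpha>))
            * (if (\<integral>\<^sup>+x. ennreal (\<eta> x) \<partial>\<mu>) = \<infinity> then \<infinity>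
               else chi2 (reweight \<eta> \<mu>) (reweight \<eta> \<alpha>))
            * ennreal (exp (- t / C\<^sub>P))))"
\<comment> \<open>Both constants are fixed before the process and the initial law; they are those of
  \<open>W1_conditional_law_le\<close>.\<close>
proof (rule exI[of _ 2], rule conjI, simp, rule exI[of _ 2], rule conjI, simp, intro allI impI)
  fix \<F> :: "'w measure" and P :: "'a \<Rightarrow> 'w measure" and X :: "real \<Rightarrow> 'w \<Rightarrow> 'a" and c :: 'a
    and \<alpha> :: "'a measure" and \<eta> :: "'a \<Rightarrow> real" and lambda0 C\<^sub>P :: real and x\<^sub>0 :: 'a
    and \<psi> :: "'a \<Rightarrow> real" and \<mu> :: "'a measure"
  assume process: "absorbed_markov_process \<F> P X c"
    and qsd: "quasi_stationary \<F> P X c \<alpha>"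
    and killed: "\<forall>t\<ge>0. killed_law \<F> P X c \<alpha> t = scale_measure (ennreal (exp (- lambda0 * t))) \<alpha>"
    and \<eta>: "\<eta> \<in> borel_measurable borel" "\<forall>x. x \<noteq> c \<longrightarrow> \<eta> x > 0" "integrable \<alpha> \<eta>" "(\<integral>x. \<eta> x \<partial>\<alpha>) = 1"
      "\<forall>x t. x \<noteq> c \<longrightarrow> 0 \<le> t \<longrightarrow> killed_semigroup \<F> P X c t \<eta> x = exp (- lambda0 * t) * \<eta> x"
    and C: "C\<^sub>P > 0"
    and poincare: "\<forall>f \<in> borel_measurable borel.
         (\<lambda>x. f x * \<eta> x) \<in> generator_domain \<F> P X c \<longrightarrow>
         integrable (reweight \<eta> \<alpha>) (\<lambda>x. (f x)\<^sup>2) \<longrightarrow>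
         integrable \<alpha> (\<lambda>x. f x * generator \<F> P X c (\<lambda>y. f y * \<eta> y) x) \<longrightarrow>
         Var (reweight \<eta> \<alpha>) f \<le>
           - C\<^sub>P * (\<integral>x. f x * (lambda0 * f x * \<eta> x + generator \<F> P X c (\<lambda>y. f y * \<eta> y) x) \<partial>\<alpha>)"
    and \<psi>: "\<psi> = (\<lambda>x. 1 + dist x x\<^sub>0)" "integrable \<alpha> \<psi>" "integrable \<alpha> (\<lambda>x. (\<psi> x)\<^sup>2 / \<eta> x)"
    and \<mu>: "prob_on_E c \<mu>"
  interpret absorbed_markov_process \<F> P X c by (rule process)
  interpret qsd_poincare \<F> P X c \<alpha> \<eta> lambda0 C\<^sub>P
  proof unfold_locales
    show "prob_on_E c \<alpha>" using qsd by (simp add: quasi_stationary_def)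
  qed (use killed \<eta> C poincare in blast)+
  show "\<exists>t\<^sub>\<mu>\<ge>0. \<forall>t\<ge>t\<^sub>\<mu>. W1 (conditional_law \<F> P X c \<mu> t) \<alpha> \<le>
      ennreal ((2 + 2 * (\<integral>x. \<psi> x \<partial>\<alpha>)) * sqrt (\<integral>x. (\<psi> x)\<^sup>2 / \<eta> x \<partial>\<alpha>))
      * (if (\<integral>\<^sup>+x. ennreal (\<eta> x) \<partial>\<mu>) = \<infinity> then \<infinity> else chi2 (reweight \<eta> \<mu>) (reweight \<eta> \<alpha>))
      * ennreal (exp (- t / C\<^sub>P))"
    using W1_conditional_law_decay[of x\<^sub>0 \<mu>] \<psi> \<mu> by simp
qed

end
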